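(* Let $\alpha=[a_0;a_1,\dots,a_s,\overline{a_{s+1},\dots,a_{s+p}}]$ be a quadratic irrational, and for $1\le r\le p$ let $C_r,E_r$ and $\alpha_r$ be as in the context, and define \[ G_r(\alpha, x)= 2 \pi |x+C_r E_r| \prod_{n=1}^{\infty} \left| \left( 1 - C_r E_r \frac{\{ n \alpha_r \} -\frac{1}{2}}{n} \right)^2 - \frac{\left( x+\frac{C_r E_r}{2} \right)^2}{n^2} \right| , \qquad x\in\mathbb{R}. \] Then the infinite product is locally uniformly convergent on $\mathbb{R}$; the function $G_r(\alpha,\cdot)$ is continuous on $\mathbb{R}$ and continuously differentiable on the open set $\{x\in\mathbb{R}: G_r(\alpha,x)\ne0\}$. Moreover, for any compact interval $I\subset\mathbb{R}$ and any integer $k\ge1$, \[ P_{q_k} (\alpha, x) = \left( 1 + O \left( q_k^{-1/2} \log^{3/4} q_k \right) \right) G_{[k]} (\alpha, x) + O \left( q_k^{-2} \right) , \qquad x \in I, \] with implied constants depending only on $I$ and $\alpha$. In particular, $P_{q_{s+mp+r}}(\alpha,\cdot)\to G_r(\alpha,\cdot)$ locally uniformly on $\mathbb{R}$ as $m\to\infty$.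
   Context: $p_k/q_k=[a_0;a_1,\dots,a_k]$ are the convergents of $\alpha$ and $\delta_k=(-1)^k(q_k\alpha-p_k)$; $\{t\}$ is the fractional part. The overline denotes the period (pre-period length $s$, period length $p$); $[k]\in\{1,\dots,p\}$ is the residue of $k-s$ modulo $p$. For $1\le r\le p$ let $T_r=\begin{pmatrix}0&1\\1&a_{s+r+p}\end{pmatrix}\cdots\begin{pmatrix}0&1\\1&a_{s+r+1}\end{pmatrix}$; its eigenvalues do not depend on $r$, and are $\eta>1$ and $(-1)^p/\eta$. The constants $C_r>0$, $D_r$, $E_r>0$ are the unique reals such that for all integers $m\ge0$, $q_{s+mp+r}=C_r\eta^m+D_r(-1)^{mp}\eta^{-m}$ and $\delta_{s+mp+r}=E_r\eta^{-m}$ (in particular $C_rE_r=\lim_{m\to\infty}q_{s+mp+r}\delta_{s+mp+r}$). Also $\alpha_r=[0;\overline{a_{s+r+p},\dots,a_{s+r+2},a_{s+r+1}}]$. The perturbed Sudler product is $P_{q_k}(\alpha,x)=\prod_{n=1}^{q_k}|2\sin(\pi(n\alpha+(-1)^kx/q_k))|$. *)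

theory Defs
  imports "HOL-Analysis.Analysis"
begin

section \<open>Continued fractions\<close>

text \<open>
  The partial quotients are \<open>a 0, a 1, a 2, \<dots>\<close>, where \<open>a 0\<close> is an arbitrary integer and
  \<open>a n \<ge> 1\<close> for \<open>n \<ge> 1\<close>. The convergents are \<open>cf_num a k / cf_den a k = [a 0; a 1, \<dots>, a k]\<close>.
\<close>

fun cf_num :: "(nat \<Rightarrow> int) \<Rightarrow> nat \<Rightarrow> int" where
  "cf_num a 0 = a 0"
| "cf_num a (Suc 0) = a 1 * a 0 + 1"
| "cf_num a (Suc (Suc k)) = a (Suc (Suc k)) * cf_num a (Suc k) + cf_num a k"

fun cf_den :: "(nat \<Rightarrow> int) \<Rightarrow> nat \<Rightarrow> int" where
  "cf_den a 0 = 1"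
| "cf_den a (Suc 0) = a 1"
| "cf_den a (Suc (Suc k)) = a (Suc (Suc k)) * cf_den a (Suc k) + cf_den a k"

definition cf_value :: "(nat \<Rightarrow> int) \<Rightarrow> real" where
  "cf_value a = lim (\<lambda>k. real_of_int (cf_num a k) / real_of_int (cf_den a k))"

definition cf_delta :: "(nat \<Rightarrow> int) \<Rightarrow> nat \<Rightarrow> real" where
  "cf_delta a k = (-1) ^ k * (real_of_int (cf_den a k) * cf_value a - real_of_int (cf_num a k))"

text \<open>
  \<open>a\<close> is the sequence of partial quotients of
  \<open>[a\<^sub>0; a\<^sub>1, \<dots>, a\<^sub>s, a\<^sub>s\<^sub>+\<^sub>1, \<dots>, a\<^sub>s\<^sub>+\<^sub>p, a\<^sub>s\<^sub>+\<^sub>1, \<dots>, a\<^sub>s\<^sub>+\<^sub>p, \<dots>]\<close>; the value of such a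
  continued fraction is automatically a quadratic irrational. Neither \<open>s\<close> nor \<open>p\<close> has to be
  minimal.
\<close>

definition periodic_cf :: "(nat \<Rightarrow> int) \<Rightarrow> nat \<Rightarrow> nat \<Rightarrow> bool" where
  "periodic_cf a s p \<longleftrightarrow> p \<ge> 1 \<and> (\<forall>n\<ge>1. a n \<ge> 1) \<and> (\<forall>n>s. a (n + p) = a n)"

text \<open>The representative in \<open>{1..p}\<close>, also for \<open>k \<le> s\<close>.\<close>

definition cf_residue :: "nat \<Rightarrow> nat \<Rightarrow> nat \<Rightarrow> nat" where
  "cf_residue s p k = nat ((int k - int s - 1) mod int p) + 1"


section \<open>The constants attached to the period\<close>

definition cf_step_matrix :: "int \<Rightarrow> real^2^2" where
  "cf_step_matrix c = vector [vector [0, 1], vector [1, real_of_int c]]"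

text \<open>\<open>cf_matrix a i j\<close> is the product of the step matrices of \<open>a (i + j), \<dots>, a (i + 1)\<close>,
  in this order.\<close>

primrec cf_matrix :: "(nat \<Rightarrow> int) \<Rightarrow> nat \<Rightarrow> nat \<Rightarrow> real^2^2" where
  "cf_matrix a i 0 = mat 1"
| "cf_matrix a i (Suc j) = cf_step_matrix (a (i + Suc j)) ** cf_matrix a i j"

definition T_matrix :: "(nat \<Rightarrow> int) \<Rightarrow> nat \<Rightarrow> nat \<Rightarrow> nat \<Rightarrow> real^2^2" where
  "T_matrix a s p r = cf_matrix a (s + r) p"

definition eta :: "(nat \<Rightarrow> int) \<Rightarrow> nat \<Rightarrow> nat \<Rightarrow> nat \<Rightarrow> real" where
  "eta a s p r = (THE \<eta>. \<eta> > 1 \<and> (\<exists>v. v \<noteq> 0 \<and> T_matrix a s p r *v v = \<eta> *s v))"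

definition C_const :: "(nat \<Rightarrow> int) \<Rightarrow> nat \<Rightarrow> nat \<Rightarrow> nat \<Rightarrow> real" where
  "C_const a s p r = (THE C. C > 0 \<and> (\<exists>D. \<forall>m.
     real_of_int (cf_den a (s + m * p + r))
       = C * eta a s p r ^ m + D * (-1) ^ (m * p) * inverse (eta a s p r ^ m)))"

definition E_const :: "(nat \<Rightarrow> int) \<Rightarrow> nat \<Rightarrow> nat \<Rightarrow> nat \<Rightarrow> real" where
  "E_const a s p r = (THE E. E > 0 \<and> (\<forall>m.
     cf_delta a (s + m * p + r) = E * inverse (eta a s p r ^ m)))"

text \<open>\<open>\<alpha>\<^sub>r\<close> has partial quotients \<open>0\<close> and then, periodically,
  \<open>a (s + r + p), \<dots>, a (s + r + 2), a (s + r + 1)\<close>.\<close>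

definition alpha_rev :: "(nat \<Rightarrow> int) \<Rightarrow> nat \<Rightarrow> nat \<Rightarrow> nat \<Rightarrow> real" where
  "alpha_rev a s p r =
     cf_value (\<lambda>n. if n = 0 then 0 else a (s + r + p - (n - 1) mod p))"


section \<open>Perturbed Sudler products and their limit functions\<close>

text \<open>\<open>perturbed_sudler a k x\<close> is $P_{q_k}(\alpha, x)$ for \<open>\<alpha> = cf_value a\<close>. It depends on \<open>k\<close>
  through the sign as well as through \<open>q\<^sub>k\<close>.\<close>

definition perturbed_sudler :: "(nat \<Rightarrow> int) \<Rightarrow> nat \<Rightarrow> real \<Rightarrow> real" where
  "perturbed_sudler a k x =
     (\<Prod>n = 1..nat (cf_den a k).
        \<bar>2 * sin (pi * (real n * cf_value a + (-1) ^ k * x / real_of_int (cf_den a k)))\<bar>)"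

definition G_factor :: "(nat \<Rightarrow> int) \<Rightarrow> nat \<Rightarrow> nat \<Rightarrow> nat \<Rightarrow> nat \<Rightarrow> real \<Rightarrow> real" where
  "G_factor a s p r n x =
     (let c = C_const a s p r * E_const a s p r
      in \<bar>(1 - c * ((frac (real n * alpha_rev a s p r) - 1 / 2) / real n))\<^sup>2
            - (x + c / 2)\<^sup>2 / (real n)\<^sup>2\<bar>)"

definition G_limit :: "(nat \<Rightarrow> int) \<Rightarrow> nat \<Rightarrow> nat \<Rightarrow> nat \<Rightarrow> real \<Rightarrow> real" where
  "G_limit a s p r x =
     2 * pi * \<bar>x + C_const a s p r * E_const a s p r\<bar> * (\<Prod>n. G_factor a s p r (Suc n) x)"


section \<open>Locally uniform convergence\<close>

definition locally_uniform_limit ::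
    "('i \<Rightarrow> 'a::topological_space \<Rightarrow> 'b::metric_space) \<Rightarrow> ('a \<Rightarrow> 'b) \<Rightarrow> 'i filter \<Rightarrow> bool" where
  "locally_uniform_limit f l F \<longleftrightarrow> (\<forall>x. \<exists>U. open U \<and> x \<in> U \<and> uniform_limit U f l F)"

text \<open>
  The locally uniform version of \<^const>\<open>convergent_prod\<close>: near every point, after omitting finitely
  many factors, the partial products converge uniformly to a function without zeros.
\<close>

definition locally_uniformly_convergent_prod ::
    "(nat \<Rightarrow> 'a::topological_space \<Rightarrow> 'b::{metric_space, comm_semiring_1}) \<Rightarrow> bool" where
  "locally_uniformly_convergent_prod f \<longleftrightarrow>
     (\<forall>x. \<exists>U M g. open U \<and> x \<in> U \<and> (\<forall>y\<in>U. g y \<noteq> 0) \<and>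
        uniform_limit U (\<lambda>N y. \<Prod>n\<le>N. f (n + M) y) g sequentially)"

end

theory Submission
  imports Defs "HOL-Real_Asymp.Real_Asymp"
begin

text \<open>
  Put \<open>q = q\<^sub>k\<close>, \<open>q' = q\<^sub>k\<^sub>-\<^sub>1\<close>, \<open>c\<^sub>k = q \<delta>\<^sub>k\<close> and \<open>\<gamma> = q'/q\<close>. Substituting \<open>n \<equiv> h q'\<close> modulo \<open>q\<close> turns the
  perturbed product into the product over \<open>h\<close> of \<open>2 sin (\<pi> (h - c\<^sub>k {h \<gamma>} - x)/q)\<close>. For \<open>h \<le> H\<close> the factors of
  \<open>h\<close> and \<open>q - h\<close> combine, after division by \<open>4 sin\<^sup>2 (\<pi> h/q)\<close>, to the \<open>h\<close>-th factor of the limit function,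
  with \<open>c\<^sub>k\<close>, \<open>\<gamma>\<close> instead of \<open>C\<^sub>r E\<^sub>r\<close>, \<open>\<alpha>\<^sub>r\<close>, up to a relative error \<open>O(h\<^sup>2/q\<^sup>2)\<close>. Both replacements
  cost \<open>O(q\<^sup>-\<^sup>2)\<close> per factor; only in the finitely many factors that can vanish this has to be counted
  additively. The remaining \<open>h\<close> and the tail of the infinite product contribute \<open>O(log q/H)\<close>, by partial
  summation from the logarithmic bound for sums of \<open>{n \<gamma>} - 1/2\<close>, valid since the partial quotients are
  bounded. The choice \<open>H \<approx> q\<^sup>1\<^sup>/\<^sup>2 (log q)\<^sup>1\<^sup>/\<^sup>4\<close> balances \<open>H\<^sup>3/q\<^sup>2\<close> against \<open>log q/H\<close>.
\<close>

section \<open>Sums of fractional parts\<close>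

text \<open>Three facts stand behind the overview. The infinite product relies on cancellation: its
  factors are \<open>1 - 2 c y/n + O(1/n^2)\<close> with the sawtooth \<open>y\<close>, and only
  oscillation of \<open>y\<close> makes the linear part summable. The variable \<open>x\<close> sits
  entirely in the quadratic part, so tails are uniform in bounded \<open>x\<close> and the
  differentiated logarithms converge absolutely. Next, the same cancellation is needed for the
  moving slope \<open>q'/q\<close>, uniformly in \<open>k\<close>; hence the discrepancy bound is
  derived from rational approximations that survive a change of slope by \<open>O(q^-2)\<close>, for
  sums shorter than \<open>q\<close>. Finally, slope and \<open>c\<^sub>k\<close> are
  \<open>O(q^-2)\<close>-close to their limits for algebraic reasons: reversing the continued
  fraction expresses \<open>(q, q')\<close> through two consecutive convergents of the reversed
  period, and in the product of \<open>q\<close> and \<delta> the growing mode of one meets the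
  purely decaying mode of the other. Small \<open>k\<close>, outside the asymptotic regime, are
  absorbed one by one into the additive error.\<close>

lemma prod_two_sin:
  assumes "q \<ge> (1::nat)"
  shows "(\<Prod>h=1..<q. 2 * sin (pi * real h / real q)) = real q"
proof -
  define A where "A = {z::complex. z ^ q = 1} - {1}"
  define P where "P = (\<Prod>z\<in>A. [:-z, 1:])"
  define R where "R = (\<Sum>i<q. monom (1::complex) i)"
  have fin: "finite {z::complex. z ^ q = 1}"
    using finite_roots_unity[of q] assms by simp
  hence finA: "finite A" unfolding A_def by simp
  have cardA: "card A = q - 1"
    using card_roots_unity_eq[of q] assms fin unfolding A_def by simp
  have degP: "degree P = q - 1"
    unfolding P_def using cardA by (subst degree_prod_eq_sum_degree) auto
  have lcP: "coeff P (q - 1) = 1"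
  proof -
    have "lead_coeff P = 1" unfolding P_def by (simp add: lead_coeff_prod)
    thus ?thesis by (simp add: degP)
  qed
  have degR: "degree R \<le> q - 1"
    unfolding R_def by (rule degree_sum_le) (auto intro: order.trans[OF degree_monom_le])
  have lcR: "coeff R (q - 1) = 1"
    using assms by (simp add: R_def coeff_sum sum.delta)
  \<comment> \<open>The product over the nontrivial roots of unity is
    \<open>1 + X + ... + X^(q-1)\<close>: both sides have degree at most \<open>q - 1\<close>, the
    same coefficient there, and agree at the \<open>q - 1\<close> points of \<open>A\<close>. At
    \<open>1\<close> the sum is \<open>q\<close>, while each factor has modulus
    \<open>2 sin (pi k/q)\<close>.\<close>
  have "P = R"
  proof (rule poly_eqI_degree_lead_coeff[of _ "q - 1" _ A])
    fix z assume z: "z \<in> A"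
    have "poly P z = 0"
      using z finA by (auto simp: P_def poly_prod)
    moreover have "poly R z = 0"
    proof -
      have "(z - 1) * poly R z = z ^ q - 1"
        by (simp add: R_def poly_sum poly_monom power_diff_1_eq)
      thus ?thesis using z by (auto simp: A_def)
    qed
    ultimately show "poly P z = poly R z" by simp
  qed (use degP degR lcP lcR cardA in auto)
  hence "poly P 1 = poly R 1" by simp
  hence prod1: "(\<Prod>z\<in>A. 1 - z) = of_nat q"
    by (simp add: P_def R_def poly_prod poly_sum poly_monom)
  have bij: "bij_betw (\<lambda>k. cis (2 * pi * real k / real q)) {1..<q} A"
  proof -
    let ?f = "\<lambda>k. cis (2 * pi * real k / real q)"
    have b: "bij_betw ?f {..<q} {z. z ^ q = 1}"
      using assms by (intro Complex.bij_betw_roots_unity) auto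
    have "?f ` {1..<q} = ?f ` ({..<q} - {0})" by (rule arg_cong[of _ _ "image ?f"]) auto
    also have "\<dots> = ?f ` {..<q} - ?f ` {0}"
      using b assms by (intro inj_on_image_set_diff[of _ "{..<q}"]) (auto simp: bij_betw_def)
    also have "\<dots> = A" using b by (simp add: bij_betw_def A_def)
    finally have "?f ` {1..<q} = A" .
    moreover have "inj_on ?f {1..<q}"
      using b by (auto simp: bij_betw_def elim!: inj_on_subset)
    ultimately show ?thesis by (simp add: bij_betw_def)
  qed
  have "real q = norm (\<Prod>z\<in>A. 1 - z)" by (simp add: prod1)
  also have "\<dots> = (\<Prod>z\<in>A. norm (1 - z))" by (simp add: prod_norm)
  also have "\<dots> = (\<Prod>k=1..<q. norm (1 - cis (2 * pi * real k / real q)))"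
    by (rule prod.reindex_bij_betw[OF bij, symmetric])
  also have "\<dots> = (\<Prod>k=1..<q. 2 * sin (pi * real k / real q))"
  proof (rule prod.cong[OF refl])
    fix k assume k: "k \<in> {1..<q}"
    have "norm (1 - cis (2 * pi * real k / real q)) = 2 * \<bar>sin (pi * real k / real q)\<bar>"
      using dist_exp_i_1[of "2 * pi * real k / real q"]
      by (simp add: cis_conv_exp norm_minus_commute)
    moreover have "sin (pi * real k / real q) > 0"
      using k by (intro sin_gt_zero) (auto simp: field_simps)
    ultimately show "norm (1 - cis (2 * pi * real k / real q)) = 2 * sin (pi * real k / real q)"
      by simp
  qed
  finally show ?thesis by simp
qed

section \<open>Residue permutations and the sawtooth function\<close>

lemma bij_betw_affine_mod:
  fixes p n :: int and Q :: nat
  assumes "coprime p (int Q)" "Q > 0"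
  shows "bij_betw (\<lambda>i. nat ((p * int i + n) mod int Q)) {..<Q} {..<Q}"
proof -
  have "inj_on (\<lambda>i. nat ((p * int i + n) mod int Q)) {..<Q}"
  proof (rule inj_onI)
    fix i j assume ij: "i \<in> {..<Q}" "j \<in> {..<Q}"
      "nat ((p * int i + n) mod int Q) = nat ((p * int j + n) mod int Q)"
    hence "(p * int i + n) mod int Q = (p * int j + n) mod int Q"
      by (metis assms(2) eq_nat_nat_iff of_nat_0_less_iff pos_mod_sign)
    hence "int Q dvd p * (int i - int j)" by (simp add: mod_eq_dvd_iff right_diff_distrib)
    hence "int Q dvd (int i - int j)"
      using assms by (simp add: coprime_dvd_mult_right_iff coprime_commute)
    hence "int i mod int Q = int j mod int Q" by (simp add: mod_eq_dvd_iff)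
    thus "i = j" using ij by simp
  qed
  moreover have "(\<lambda>i. nat ((p * int i + n) mod int Q)) ` {..<Q} \<subseteq> {..<Q}"
    using assms by (auto simp: nat_less_iff)
  ultimately show ?thesis by (simp add: bij_betw_def endo_inj_surj)
qed

lemma of_int_divide_eq:
  assumes "Q > 0"
  shows "real_of_int n / real Q = real_of_int (n div int Q) + real_of_int (n mod int Q) / real Q"
proof -
  have "v / real Q = d + m / real Q" if "d * real Q + m = v" for v d m
    using assms unfolding that[symmetric] by (simp add: add_divide_distrib)
  thus ?thesis using arg_cong[OF div_mult_mod_eq[of n "int Q"], of real_of_int]
    by (simp only: of_int_add of_int_mult of_int_of_nat_eq)
qed

lemma frac_of_int_divide:
  assumes "Q > 0"
  shows "frac (real_of_int n / real Q) = real_of_int (n mod int Q) / real Q"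
proof -
  have "0 \<le> n mod int Q" "n mod int Q < int Q" using assms by auto
  hence "0 \<le> real_of_int (n mod int Q)" "real_of_int (n mod int Q) < real Q" by linarith+
  hence "frac (real_of_int (n mod int Q) / real Q) = real_of_int (n mod int Q) / real Q"
    using assms by (intro frac_eq[THEN iffD2]) auto
  thus ?thesis unfolding of_int_divide_eq[OF assms, of n] by simp
qed

text \<open>This is Raabe's multiplication formula for the first Bernoulli polynomial
  \<open>x - 1/2\<close>. On a grid of step \<open>1/Q\<close> every fractional part is a common
  offset \<open>t\<close> plus a multiple of \<open>1/Q\<close>, and these multiples run through all
  residues once.\<close>

lemma sum_frac_shift:
  assumes "Q > 0"
  shows "(\<Sum>j<Q. frac (x + real j / real Q) - 1/2) = frac (real Q * x) - 1/2"
proof -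
  define t where "t = frac (real Q * x) / real Q"
  define n where "n = \<lfloor>real Q * x\<rfloor>"
  have t: "0 \<le> t" "t < 1 / real Q"
    using assms frac_lt_1[of "real Q * x"] frac_ge_0[of "real Q * x"]
    by (auto simp: t_def divide_strict_right_mono)
  have x: "x = (real_of_int n) / real Q + t"
    using assms by (simp add: n_def t_def frac_def field_simps)
  have step: "frac (x + real j / real Q) = t + real_of_int ((n + int j) mod int Q) / real Q" for j
  proof -
    define m where "m = (n + int j) mod int Q"
    have m: "0 \<le> m" "m \<le> int Q - 1" using assms by (auto simp: m_def)
    have "x + real j / real Q = t + real_of_int (n + int j) / real Q"
      by (simp add: x add_divide_distrib)
    hence "x + real j / real Q = real_of_int ((n + int j) div int Q) + (t + real_of_int m / real Q)"
      using of_int_divide_eq[OF assms, of "n + int j"] by (simp add: m_def)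
    hence "frac (x + real j / real Q) = frac (t + real_of_int m / real Q)"
      by simp
    also have "\<dots> = t + real_of_int m / real Q"
    proof -
      have "real_of_int m \<le> real Q - 1" using m by linarith
      hence "real_of_int m / real Q \<le> 1 - 1 / real Q" using assms by (simp add: field_simps)
      moreover have "real_of_int m / real Q \<ge> 0" using m by simp
      ultimately show ?thesis using t by (intro frac_eq[THEN iffD2]) linarith
    qed
    finally show ?thesis by (simp add: m_def)
  qed
  have "(\<Sum>j<Q. real_of_int ((n + int j) mod int Q)) = (\<Sum>j<Q. real j)"
  proof -
    have "bij_betw (\<lambda>j. nat ((n + int j) mod int Q)) {..<Q} {..<Q}"
      using bij_betw_affine_mod[of 1 Q n] assms by (simp add: add.commute)
    from sum.reindex_bij_betw[OF this, of real] show ?thesis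
      using assms by (simp add: of_nat_nat)
  qed
  moreover have "(\<Sum>j<Q. real j) = real Q * (real Q - 1) / 2"
    by (induction Q) (auto simp: field_simps)
  ultimately have "(\<Sum>j<Q. frac (x + real j / real Q)) = real Q * t + (real Q - 1) / 2"
    using assms unfolding step by (simp add: sum.distrib flip: sum_divide_distrib)
  moreover have "real Q * t = frac (real Q * x)" using assms by (simp add: t_def)
  moreover have "(\<Sum>j<Q. frac (x + real j / real Q) - 1/2) = (\<Sum>j<Q. frac (x + real j / real Q)) - real Q / 2"
    by (simp only: sum_subtractf sum_constant) simp
  ultimately show ?thesis by (simp add: field_simps)
qed

text \<open>Jumps of \<open>frac\<close> always go downwards, so a shift \<theta> that varies with
  the summand can be traded for the uniform shift \<open>- \<tau>\<close> or \<open>\<tau>\<close>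
  at the price \<open>2 * \<tau>\<close>. After that the exact grid formula applies to the whole
  sum.\<close>

lemma frac_perturb:
  assumes "\<bar>\<theta>\<bar> \<le> (\<tau>::real)"
  shows "frac (x + \<theta>) \<le> frac (x - \<tau>) + 2 * \<tau>" "frac (x + \<tau>) - 2 * \<tau> \<le> frac (x + \<theta>)"
proof -
  have "\<lfloor>x - \<tau>\<rfloor> \<le> \<lfloor>x + \<theta>\<rfloor>" "\<lfloor>x + \<theta>\<rfloor> \<le> \<lfloor>x + \<tau>\<rfloor>"
    using assms by (auto intro!: floor_mono)
  hence "real_of_int \<lfloor>x - \<tau>\<rfloor> \<le> real_of_int \<lfloor>x + \<theta>\<rfloor>"
    "real_of_int \<lfloor>x + \<theta>\<rfloor> \<le> real_of_int \<lfloor>x + \<tau>\<rfloor>" by simp_all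
  thus "frac (x + \<theta>) \<le> frac (x - \<tau>) + 2 * \<tau>" "frac (x + \<tau>) - 2 * \<tau> \<le> frac (x + \<theta>)"
    using assms unfolding frac_def by linarith+
qed

text \<open>For the slope \<open>p/Q\<close> the points form a permuted grid, so the sum is a single
  sawtooth value, at most 1/2 in size. The true slope moves each point by at most
  \<open>\<kappa> / Q\<close>, which costs \<open>2 * \<kappa> / Q\<close> per term and
  \<open>2 * \<kappa>\<close> in total.\<close>

lemma sum_frac_block:
  fixes p :: int and Q :: nat
  assumes "coprime p (int Q)" "Q > 0" "\<bar>\<beta> - real_of_int p / real Q\<bar> \<le> \<kappa> / (real Q)\<^sup>2"
  shows "\<bar>\<Sum>i<Q. frac (x + real i * \<beta>) - 1/2\<bar> \<le> 1/2 + 2 * \<kappa>"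
proof -
  have exact: "(\<Sum>i<Q. frac (y + real i * (real_of_int p / real Q)) - 1/2) = frac (real Q * y) - 1/2" for y
  proof -
    have bij: "bij_betw (\<lambda>i. nat ((p * int i) mod int Q)) {..<Q} {..<Q}"
      using bij_betw_affine_mod[of p Q 0] assms by simp
    have "frac (y + real i * (real_of_int p / real Q)) = frac (y + real (nat ((p * int i) mod int Q)) / real Q)" for i
    proof -
      have "real i * (real_of_int p / real Q) = real_of_int (p * int i) / real Q" by (simp add: mult.commute)
      hence "y + real i * (real_of_int p / real Q)
          = real_of_int ((p * int i) div int Q) + (y + real_of_int ((p * int i) mod int Q) / real Q)"
        by (simp only: of_int_divide_eq[OF assms(2), of "p * int i"] add.assoc add.left_commute)
      moreover have "real (nat ((p * int i) mod int Q)) = real_of_int ((p * int i) mod int Q)"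
        using assms(2) by simp
      ultimately show ?thesis by (simp only: frac_add_of_int_left)
    qed
    hence "(\<Sum>i<Q. frac (y + real i * (real_of_int p / real Q)) - 1/2)
         = (\<Sum>i<Q. frac (y + real (nat ((p * int i) mod int Q)) / real Q) - 1/2)" by simp
    also have "\<dots> = (\<Sum>j<Q. frac (y + real j / real Q) - 1/2)"
      by (rule sum.reindex_bij_betw[OF bij, of "\<lambda>j. frac (y + real j / real Q) - 1/2"])
    finally show ?thesis using sum_frac_shift[of Q y] assms by simp
  qed
  define \<tau> where "\<tau> = \<kappa> / real Q"
  define \<theta> where "\<theta> i = real i * (\<beta> - real_of_int p / real Q)" for i
  have \<theta>: "\<bar>\<theta> i\<bar> \<le> \<tau>" if "i < Q" for i
  proof -
    have "\<bar>\<theta> i\<bar> \<le> real i * (\<kappa> / (real Q)\<^sup>2)"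
      unfolding \<theta>_def abs_mult using mult_left_mono[OF assms(3), of "real i"] by simp
    also have "\<dots> \<le> real Q * (\<kappa> / (real Q)\<^sup>2)"
      using that assms(3) by (intro mult_right_mono) auto
    also have "\<dots> = \<tau>" using assms(2) by (simp add: \<tau>_def power2_eq_square)
    finally show ?thesis .
  qed
  have e: "x + real i * \<beta> = x + real i * (real_of_int p / real Q) + \<theta> i" for i
    by (simp add: \<theta>_def algebra_simps)
  have "(\<Sum>i<Q. frac (x + real i * \<beta>) - 1/2)
      \<le> (\<Sum>i<Q. (frac (x - \<tau> + real i * (real_of_int p / real Q)) - 1/2) + 2 * \<tau>)"
  proof (rule sum_mono)
    fix i assume "i \<in> {..<Q}"
    hence "\<bar>\<theta> i\<bar> \<le> \<tau>" using \<theta> by simp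
    from frac_perturb(1)[OF this, of "x + real i * (real_of_int p / real Q)"]
    show "frac (x + real i * \<beta>) - 1/2 \<le> (frac (x - \<tau> + real i * (real_of_int p / real Q)) - 1/2) + 2 * \<tau>"
      unfolding e by (simp add: algebra_simps)
  qed
  also have "\<dots> = frac (real Q * (x - \<tau>)) - 1/2 + 2 * \<kappa>"
    using assms(2) by (simp only: sum.distrib exact) (simp add: \<tau>_def)
  finally have up: "(\<Sum>i<Q. frac (x + real i * \<beta>) - 1/2) \<le> 1/2 + 2 * \<kappa>"
    using frac_lt_1[of "real Q * (x - \<tau>)"] by linarith
  have "(\<Sum>i<Q. frac (x + real i * \<beta>) - 1/2)
      \<ge> (\<Sum>i<Q. (frac (x + \<tau> + real i * (real_of_int p / real Q)) - 1/2) - 2 * \<tau>)"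
  proof (rule sum_mono)
    fix i assume "i \<in> {..<Q}"
    hence "\<bar>\<theta> i\<bar> \<le> \<tau>" using \<theta> by simp
    from frac_perturb(2)[OF this, of "x + real i * (real_of_int p / real Q)"]
    show "(frac (x + \<tau> + real i * (real_of_int p / real Q)) - 1/2) - 2 * \<tau> \<le> frac (x + real i * \<beta>) - 1/2"
      unfolding e by (simp add: algebra_simps)
  qed
  also have "(\<Sum>i<Q. (frac (x + \<tau> + real i * (real_of_int p / real Q)) - 1/2) - 2 * \<tau>)
     = frac (real Q * (x + \<tau>)) - 1/2 - 2 * \<kappa>"
    using assms(2) by (simp only: sum_subtractf[of "\<lambda>i. frac (x + \<tau> + real i * (real_of_int p / real Q)) - 1/2"] exact) (simp add: \<tau>_def)
  finally have "(\<Sum>i<Q. frac (x + real i * \<beta>) - 1/2) \<ge> - (1/2 + 2 * \<kappa>)"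
    using frac_ge_0[of "real Q * (x + \<tau>)"] by linarith
  with up show ?thesis by linarith
qed

text \<open>Peeling off the last \<open>Q\<close> terms with \<open>Q \<le> N < A Q\<close> costs \<open>O(1)\<close> and shrinks \<open>N\<close> by the factor
  \<open>1 - 1/A\<close>, which leads to the logarithm.\<close>

lemma sum_frac_log_bound:
  fixes \<beta> A \<kappa> :: real and M :: nat
  assumes A: "A > 1" and k0: "\<kappa> \<ge> 0"
    and conv: "\<And>N. 1 \<le> N \<Longrightarrow> N < M \<Longrightarrow> \<exists>(p::int) (Q::nat). coprime p (int Q) \<and> 0 < Q \<and> Q \<le> N \<and>
            real N \<le> A * real Q \<and> \<bar>\<beta> - real_of_int p / real Q\<bar> \<le> \<kappa> / (real Q)\<^sup>2"
    and N: "1 \<le> N" "N < M"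
  shows "\<bar>\<Sum>n=1..N. frac (real n * \<beta>) - 1/2\<bar> \<le> (1/2 + 2 * \<kappa>) * (1 + A) * (1 + ln (real N))"
  using N
proof (induction N rule: less_induct)
  case (less N)
  define c where "c = 1/2 + 2 * \<kappa>"
  have c: "c > 0" using k0 by (simp add: c_def)
  obtain p :: int and Q :: nat where Q: "coprime p (int Q)" "0 < Q" "Q \<le> N" "real N \<le> A * real Q"
      "\<bar>\<beta> - real_of_int p / real Q\<bar> \<le> \<kappa> / (real Q)\<^sup>2"
    using conv less.prems by blast
  define L where "L = N - Q"
  have NL: "N = L + Q" using Q by (simp add: L_def)
  have "(\<Sum>n=1..N. frac (real n * \<beta>) - 1/2) = (\<Sum>n=1..L. frac (real n * \<beta>) - 1/2)
        + (\<Sum>n=Suc L..L+Q. frac (real n * \<beta>) - 1/2)"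
    unfolding NL by (simp only: sum.ub_add_nat[of 1 L] Suc_eq_plus1 le_add2)
  also have "(\<Sum>n=Suc L..L+Q. frac (real n * \<beta>) - 1/2) =
       (\<Sum>i<Q. frac (real (Suc L) * \<beta> + real i * \<beta>) - 1/2)"
    by (rule sum.reindex_bij_witness[of _ "\<lambda>i. Suc L + i" "\<lambda>n. n - Suc L"]) (auto simp: algebra_simps)
  finally have *: "\<bar>\<Sum>n=1..N. frac (real n * \<beta>) - 1/2\<bar> \<le> \<bar>\<Sum>n=1..L. frac (real n * \<beta>) - 1/2\<bar> + c"
    using sum_frac_block[OF Q(1,2,5), of "real (Suc L) * \<beta>"] unfolding c_def by linarith
  show ?case
  proof (cases "L = 0")
    case True
    have "1 \<le> (1 + A) * (1 + ln (real N))"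
      using mult_mono[of 1 "1 + A" 1 "1 + ln (real N)"] A less.prems by simp
    hence "c \<le> c * ((1 + A) * (1 + ln (real N)))" using c by (simp add: mult_le_cancel_left1)
    moreover have "(\<Sum>n=1..L. frac (real n * \<beta>) - 1/2) = 0" using True by simp
    ultimately show ?thesis using * unfolding c_def[symmetric] by (simp only: mult.assoc)
  next
    case False
    hence L: "1 \<le> L" "L < N" using Q by (auto simp: L_def)
    have IH: "\<bar>\<Sum>n=1..L. frac (real n * \<beta>) - 1/2\<bar> \<le> c * (1 + A) * (1 + ln (real L))"
      using less.IH[of L] L less.prems unfolding c_def by simp
    have "real Q / real N \<ge> 1 / A" using Q A less.prems by (simp add: field_simps)
    moreover have "ln (real L / real N) \<le> real L / real N - 1"
      using L by (intro ln_le_minus_one) simp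
    moreover have "real L / real N = 1 - real Q / real N"
      using less.prems NL by (simp add: field_simps)
    ultimately have "ln (real L / real N) \<le> - (1 / A)" by linarith
    hence "ln (real L) \<le> ln (real N) - 1 / A" using L by (simp add: ln_div)
    hence "c * (1 + A) * (1 + ln (real L)) \<le> c * (1 + A) * (1 + (ln (real N) - 1/A))"
      using c A by (intro mult_left_mono) auto
    also have "\<dots> = c * (1 + A) * (1 + ln (real N)) - c * ((1 + A) / A)"
      by (simp add: algebra_simps add_divide_distrib)
    \<comment> \<open>One step lowers the claimed bound by at least \<open>c\<close>, exactly what
      the removed block may contribute.\<close>
    also have "c * ((1 + A) / A) \<ge> c" using c A by (simp add: field_simps)
    hence "c * (1 + A) * (1 + ln (real N)) - c * ((1 + A) / A) \<le> c * (1 + A) * (1 + ln (real N)) - c"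
      by linarith
    finally show ?thesis using * IH unfolding c_def[symmetric] by linarith
  qed
qed

text \<open>The partial sums start at \<open>1\<close> although the range starts at
  \<open>Suc M\<close>, because discrepancy bounds are available for initial segments. The weight is
  then also evaluated at \<open>Suc N\<close>.\<close>

lemma sum_mult_Abel:
  fixes y g :: "nat \<Rightarrow> real"
  assumes "M \<le> N"
  shows "(\<Sum>n=Suc M..N. y n * g n) = (\<Sum>n=1..N. y n) * g (Suc N) - (\<Sum>n=1..M. y n) * g (Suc M)
           + (\<Sum>n=Suc M..N. (\<Sum>i=1..n. y i) * (g n - g (Suc n)))"
  using assms by (induction N rule: dec_induct) (auto simp: algebra_simps)

section \<open>Continued fractions\<close>

locale pos_cf =
  fixes a :: "nat \<Rightarrow> int"
  assumes pos: "\<And>n. n \<ge> 1 \<Longrightarrow> a n \<ge> 1"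
begin

abbreviation den :: "nat \<Rightarrow> real" where "den k \<equiv> real_of_int (cf_den a k)"

lemma cf_den_pos: "cf_den a k \<ge> 1"
proof (induction k rule: less_induct)
  case (less k)
  consider "k = 0" | "k = Suc 0" | j where "k = Suc (Suc j)" by (metis not0_implies_Suc)
  thus ?case
  proof cases
    case 2 thus ?thesis using pos[of 1] by simp
  next
    case (3 j)
    have "a (Suc (Suc j)) * cf_den a (Suc j) \<ge> 1 * 1"
      using less.IH[of "Suc j"] 3 pos[of "Suc (Suc j)"] by (intro mult_mono) auto
    thus ?thesis using less.IH[of j] 3 by simp
  qed auto
qed

lemma cf_den_Suc_Suc_ge: "cf_den a (Suc (Suc k)) \<ge> cf_den a (Suc k) + cf_den a k"
proof -
  have "a (Suc (Suc k)) * cf_den a (Suc k) \<ge> 1 * cf_den a (Suc k)"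
    using pos[of "Suc (Suc k)"] order.trans[OF _ cf_den_pos[of "Suc k"]] by (intro mult_right_mono) auto
  thus ?thesis unfolding cf_den.simps by linarith
qed

lemma cf_den_Suc_ge: "cf_den a (Suc k) \<ge> cf_den a k"
proof (cases k)
  case 0 thus ?thesis using pos[of 1] by simp
next
  case (Suc j) thus ?thesis using cf_den_Suc_Suc_ge[of j] cf_den_pos[of j] by simp
qed

lemma cf_den_ge: "cf_den a k \<ge> int k"
proof (induction k)
  case (Suc k)
  show ?case
  proof (cases k)
    case 0 thus ?thesis using cf_den_pos[of 1] by simp
  next
    case (Suc j)
    thus ?thesis using cf_den_Suc_Suc_ge[of j] Suc.IH cf_den_pos[of j] unfolding Suc by linarith
  qed
qed auto

lemma cf_den_Suc_le:
  assumes "a (Suc k) \<le> A"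
  shows "cf_den a (Suc k) \<le> (A + 1) * cf_den a k"
proof (cases k)
  case 0 thus ?thesis using assms by simp
next
  case (Suc j)
  have "a (Suc (Suc j)) * cf_den a (Suc j) \<le> A * cf_den a (Suc j)"
    using cf_den_pos assms Suc by (intro mult_right_mono) (auto intro: order.trans[OF _ cf_den_pos])
  thus ?thesis using Suc cf_den_Suc_ge[of j] by (simp add: algebra_simps)
qed

end

lemma cf_det: "cf_num a (Suc k) * cf_den a k - cf_num a k * cf_den a (Suc k) = (-1) ^ k"
  by (induction k) (auto simp: algebra_simps)

lemma coprime_cf_num_den: "coprime (cf_num a k) (cf_den a k)"
  and coprime_cf_den_Suc: "coprime (cf_den a k) (cf_den a (Suc k))"
proof -
  have unit: "is_unit c" if "c dvd cf_num a (Suc k) * cf_den a k - cf_num a k * cf_den a (Suc k)" for c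
  proof -
    have "c dvd (-1) ^ k * (-1) ^ k" using that unfolding cf_det by (rule dvd_mult2)
    thus ?thesis by (simp flip: power_add)
  qed
  show "coprime (cf_num a k) (cf_den a k)" by (intro coprimeI unit) simp
  show "coprime (cf_den a k) (cf_den a (Suc k))" by (intro coprimeI unit) simp
qed

lemma cf_delta_rec:
  "cf_delta a k = real_of_int (a (Suc (Suc k))) * cf_delta a (Suc k) + cf_delta a (Suc (Suc k))"
  by (simp add: cf_delta_def algebra_simps)

lemma cf_delta_den:
  "real_of_int (cf_den a (Suc k)) * cf_delta a k + real_of_int (cf_den a k) * cf_delta a (Suc k) = 1"
proof -
  have "real_of_int (cf_den a (Suc k)) * cf_delta a k + real_of_int (cf_den a k) * cf_delta a (Suc k)
      = (-1) ^ k * real_of_int (cf_num a (Suc k) * cf_den a k - cf_num a k * cf_den a (Suc k))"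
    by (simp add: cf_delta_def algebra_simps del: cf_den.simps cf_num.simps)
  also have "\<dots> = 1" unfolding cf_det by (simp flip: power_add)
  finally show ?thesis .
qed

section \<open>Convergence of continued fractions and positivity of \<open>cf_delta\<close>\<close>

context pos_cf
begin

lemma cf_quotient_eq_sum:
  "real_of_int (cf_num a n) / den n =
     real_of_int (a 0) + (\<Sum>i<n. (-1) ^ i * (1 / (den i * den (Suc i))))"
proof (induction n)
  case (Suc n)
  have q: "den n > 0" "den (Suc n) > 0"
    using cf_den_pos[of n] cf_den_pos[of "Suc n"] by linarith+
  have "real_of_int (cf_num a (Suc n)) * den n - real_of_int (cf_num a n) * den (Suc n) = (-1) ^ n"
    using arg_cong[OF cf_det[of a n], of real_of_int] by simp
  hence "real_of_int (cf_num a (Suc n)) / den (Suc n) =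
      real_of_int (cf_num a n) / den n +
      (-1) ^ n * (1 / (den n * den (Suc n)))"
    using q by (simp add: divide_simps del: cf_num.simps cf_den.simps)
  thus ?case using Suc by (simp del: cf_num.simps cf_den.simps)
qed auto

text \<open>Since \<open>cf_value\<close> is defined through \<open>lim\<close>, convergence has to
  be established along with the inequality. The telescoped determinants form an alternating series
  with decreasing terms; the Leibniz criterion yields the limit and shows that even convergents are
  at most, odd ones at least, this limit.\<close>

lemma cf_delta_nonneg: "cf_delta a k \<ge> 0"
proof -
  define t where "t i = 1 / (den i * den (Suc i))" for i
  define S where "S = (\<Sum>i. (-1) ^ i * t i)"
  have q: "den n \<ge> 1" for n
    using cf_den_pos[of n] by linarith
  have q': "den n \<ge> real n" for n
    using cf_den_ge[of n] by linarith
  have t0: "t i \<ge> 0" for i using q[of i] q[of "Suc i"] by (simp add: t_def)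
  have tle: "t i \<le> inverse (real (Suc i))" for i
  proof -
    have "1 * real (Suc i) \<le> den i * den (Suc i)"
      using q[of i] q'[of "Suc i"] by (intro mult_mono) auto
    thus ?thesis unfolding t_def by (simp add: inverse_eq_divide frac_le del: of_nat_Suc)
  qed
  have lim: "t \<longlonglongrightarrow> 0"
    by (rule tendsto_sandwich[OF _ _ tendsto_const LIMSEQ_inverse_real_of_nat])
       (use t0 tle in auto)
  have mono: "t (Suc i) \<le> t i" for i
  proof -
    have "den i * den (Suc i)
        \<le> den (Suc i) * den (Suc (Suc i))"
      using q[of i] q[of "Suc i"] cf_den_Suc_ge[of i] cf_den_Suc_ge[of "Suc i"]
      by (intro mult_mono) (simp_all del: cf_den.simps)
    moreover have "den i * den (Suc i) > 0"
      using q[of i] q[of "Suc i"] by simp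
    ultimately show ?thesis unfolding t_def by (intro divide_left_mono) auto
  qed
  note L = summable_Leibniz'[OF lim t0 mono]
  have "(\<lambda>n. \<Sum>i<n. (-1) ^ i * t i) \<longlonglongrightarrow> S"
    using L(1) unfolding S_def by (simp add: summable_LIMSEQ)
  hence "(\<lambda>n. real_of_int (a 0) + (\<Sum>i<n. (-1) ^ i * t i)) \<longlonglongrightarrow> real_of_int (a 0) + S"
    by (intro tendsto_intros)
  hence val: "cf_value a = real_of_int (a 0) + S"
    unfolding cf_value_def cf_quotient_eq_sum t_def[symmetric] by (rule limI)
  have "(-1) ^ k * (cf_value a - real_of_int (cf_num a k) / den k) \<ge> 0"
  proof (cases "even k")
    case True
    then obtain n where k: "k = 2 * n" by blast
    show ?thesis using L(2)[of n] unfolding val cf_quotient_eq_sum t_def[symmetric] S_def k by simp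
  next
    case False
    then obtain n where k: "k = 2 * n + 1" using oddE by blast
    show ?thesis using L(4)[of n] unfolding val cf_quotient_eq_sum t_def[symmetric] S_def k by simp
  qed
  hence "den k * ((-1) ^ k * (cf_value a - real_of_int (cf_num a k) / den k)) \<ge> 0"
    using q[of k] by simp
  also have "den k * ((-1) ^ k * (cf_value a - real_of_int (cf_num a k) / den k))
     = cf_delta a k"
    using q[of k] by (simp add: cf_delta_def field_simps)
  finally show ?thesis .
qed

text \<open>If \<open>cf_delta a k\<close> vanished, the recurrence between nonnegative terms would
  force \<open>cf_delta a (Suc k) = 0\<close> as well, against the determinant identity
  \<open>cf_delta_den\<close>.\<close>

lemma cf_delta_pos: "cf_delta a k > 0"
proof (rule ccontr)
  assume "\<not> cf_delta a k > 0"
  hence 0: "cf_delta a k = 0" using cf_delta_nonneg[of k] by linarith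
  have "real_of_int (a (Suc (Suc k))) * cf_delta a (Suc k) \<ge> 0"
    using pos[of "Suc (Suc k)"] cf_delta_nonneg[of "Suc k"] by simp
  hence "real_of_int (a (Suc (Suc k))) * cf_delta a (Suc k) = 0"
    using cf_delta_rec[of a k] 0 cf_delta_nonneg[of "Suc (Suc k)"] by linarith
  hence "cf_delta a (Suc k) = 0" using pos[of "Suc (Suc k)"] by auto
  thus False using 0 cf_delta_den[of a k] by simp
qed

lemma cf_den_Suc_delta_le: "den (Suc k) * cf_delta a k \<le> 1"
proof -
  have "den k * cf_delta a (Suc k) \<ge> 0"
    using cf_den_pos[of k] cf_delta_pos[of "Suc k"] by simp
  thus ?thesis using cf_delta_den[of a k] by linarith
qed

lemma cf_den_delta_le: "den k * cf_delta a k \<le> 1"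
proof -
  have "den k * cf_delta a k \<le> den (Suc k) * cf_delta a k"
    using cf_den_Suc_ge[of k] cf_delta_pos[of k] by (intro mult_right_mono) auto
  thus ?thesis using cf_den_Suc_delta_le[of k] by linarith
qed

lemma abs_cf_delta: "\<bar>den k * cf_value a - real_of_int (cf_num a k)\<bar> = cf_delta a k"
proof -
  have "cf_delta a k = \<bar>cf_delta a k\<bar>" using cf_delta_pos[of k] by simp
  also have "\<dots> = \<bar>den k * cf_value a - real_of_int (cf_num a k)\<bar>"
    by (simp add: cf_delta_def abs_mult power_abs)
  finally show ?thesis by simp
qed

lemma cf_delta_le: "cf_delta a k \<le> 1 / den k"
  using cf_den_delta_le[of k] cf_den_pos[of k] by (simp add: field_simps)

text \<open>The last convergent with denominator at most \<open>N\<close> works: the next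
  denominator exceeds \<open>N\<close> and is at most \<open>A + 1\<close> times larger. This is the
  kind of approximation that \<open>sum_frac_log_bound\<close> consumes.\<close>

lemma convergent_between:
  assumes "\<And>n. n \<ge> 1 \<Longrightarrow> a n \<le> A" "N \<ge> (1::nat)"
  shows "\<exists>(p::int) (Q::nat). coprime p (int Q) \<and> 0 < Q \<and> Q \<le> N \<and>
            real N \<le> (real_of_int A + 1) * real Q \<and> \<bar>cf_value a - real_of_int p / real Q\<bar> \<le> 1 / (real Q)\<^sup>2"
proof -
  define j where "j = (GREATEST j. cf_den a j \<le> int N)"
  \<comment> \<open>Linear growth of the denominators bounds the candidates, which makes
    \<open>GREATEST\<close> meaningful.\<close>
  have bd: "i \<le> N" if "cf_den a i \<le> int N" for i using cf_den_ge[of i] that by linarith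
  have j1: "cf_den a j \<le> int N"
    unfolding j_def by (rule GreatestI_nat[of _ 0 N]) (use assms(2) bd in auto)
  have j2: "cf_den a (Suc j) > int N"
  proof (rule ccontr)
    assume "\<not> ?thesis"
    hence "Suc j \<le> j" unfolding j_def by (intro Greatest_le_nat[of _ _ N]) (use bd in auto)
    thus False by simp
  qed
  define Q where "Q = nat (cf_den a j)"
  have Q: "int Q = cf_den a j" "real Q = den j" "Q > 0" using cf_den_pos[of j] by (simp_all add: Q_def)
  have "int N \<le> (A + 1) * cf_den a j"
    using j2 cf_den_Suc_le[of j A] assms(1)[of "Suc j"] by linarith
  hence "real_of_int (int N) \<le> real_of_int ((A + 1) * cf_den a j)" by (simp only: of_int_le_iff)
  hence 1: "real N \<le> (real_of_int A + 1) * real Q" by (simp add: Q)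
  have "\<bar>cf_value a - real_of_int (cf_num a j) / real Q\<bar> = cf_delta a j / real Q"
  proof -
    have "cf_value a - real_of_int (cf_num a j) / real Q =
        (den j * cf_value a - real_of_int (cf_num a j)) / real Q"
      using Q(3) by (simp add: Q(2)[symmetric] field_simps)
    thus ?thesis by (simp add: abs_cf_delta)
  qed
  also have "\<dots> \<le> (1 / real Q) / real Q"
    using cf_delta_le[of j] Q by (intro divide_right_mono) auto
  finally have "\<bar>cf_value a - real_of_int (cf_num a j) / real Q\<bar> \<le> 1 / (real Q)\<^sup>2"
    by (simp add: power2_eq_square)
  moreover have "coprime (cf_num a j) (int Q)" unfolding Q(1) by (rule coprime_cf_num_den)
  moreover have "Q \<le> N" using Q(1) j1 by linarith
  ultimately show ?thesis using 1 Q(3) by blast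
qed

end

text \<open>Reading the partial quotients of \<open>q_k\<close> backwards produces the convergents
  of \<open>[0; a_k, a_(k-1), ...]\<close>. The pair \<open>(q_k, q_(k-1))\<close> becomes a
  combination of two successive convergents of \<open>b\<close>, with earlier denominators of
  \<open>a\<close> as coefficients, so a pre-period can be left inside these coefficients.\<close>

lemma cf_den_reverse:
  assumes b0: "b 0 = 0" and b: "\<And>i. i \<ge> 1 \<Longrightarrow> i \<le> Suc j \<Longrightarrow> b i = a (Suc k - i)" and j: "Suc j < k"
  shows "cf_den a k = cf_den b (Suc j) * cf_den a (k - Suc j) + cf_den b j * cf_den a (k - Suc j - 1) \<and>
         cf_den a (k - 1) = cf_num b (Suc j) * cf_den a (k - Suc j) + cf_num b j * cf_den a (k - Suc j - 1)"
  using b j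
proof (induction j)
  case 0
  then obtain l where "k = Suc (Suc l)" by (metis One_nat_def Suc_lessE less_imp_Suc_add)
  thus ?case using 0(1)[of 1] b0 by simp
next
  case (Suc j)
  then obtain l where k: "k = Suc (Suc (Suc j + l))"
    by (metis add_Suc less_imp_Suc_add)
  have b': "b (Suc (Suc j)) = a (Suc (Suc l))" using Suc.prems(1)[of "Suc (Suc j)"] k by simp
  have e: "k - Suc j = Suc (Suc l)" "k - Suc j - 1 = Suc l" "k - Suc (Suc j) = Suc l" "k - Suc (Suc j) - 1 = l"
    using k by auto
  have IH: "cf_den a k = cf_den b (Suc j) * cf_den a (Suc (Suc l)) + cf_den b j * cf_den a (Suc l)"
    "cf_den a (k - 1) = cf_num b (Suc j) * cf_den a (Suc (Suc l)) + cf_num b j * cf_den a (Suc l)"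
    using Suc.IH Suc.prems k unfolding e by auto
  show ?case unfolding e IH by (simp add: b' algebra_simps)
qed

section \<open>The constants of the period\<close>

lemma cf_matrix_entries:
  "cf_matrix a i 0 $ u $ v = (if u = v then 1 else 0)"
  "cf_matrix a i (Suc j) $ 1 $ v = cf_matrix a i j $ 2 $ v"
  "cf_matrix a i (Suc j) $ 2 $ v =
     cf_matrix a i j $ 1 $ v + real_of_int (a (i + Suc j)) * cf_matrix a i j $ 2 $ v"
  by (simp_all add: mat_def cf_step_matrix_def matrix_matrix_mult_def sum_2)

text \<open>Formulated for every solution of the recurrence, so that \<open>q\<close> and
  \<open>q \<alpha> - p\<close> can be treated alike. The matrix starts at \<open>Suc k\<close>
  because the first partial quotient acting on \<open>(X k, X (Suc k))\<close> is
  \<open>a (k + 2)\<close>.\<close>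

lemma cf_matrix_solution:
  fixes X :: "nat \<Rightarrow> real"
  assumes "\<And>k. X (Suc (Suc k)) = real_of_int (a (Suc (Suc k))) * X (Suc k) + X k"
  shows "X (k + j) = cf_matrix a (Suc k) j $ 1 $ 1 * X k + cf_matrix a (Suc k) j $ 1 $ 2 * X (Suc k) \<and>
         X (Suc k + j) = cf_matrix a (Suc k) j $ 2 $ 1 * X k + cf_matrix a (Suc k) j $ 2 $ 2 * X (Suc k)"
  by (induction j) (auto simp: cf_matrix_entries assms algebra_simps simp del: cf_matrix.simps)

lemma cf_matrix_det:
  "cf_matrix a i j $ 1 $ 1 * cf_matrix a i j $ 2 $ 2 - cf_matrix a i j $ 1 $ 2 * cf_matrix a i j $ 2 $ 1 = (-1) ^ j"
  by (induction j) (auto simp: cf_matrix_entries algebra_simps simp del: cf_matrix.simps)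

lemma cf_matrix_periodic:
  assumes "periodic_cf a s p" "i \<ge> s"
  shows "cf_matrix a (i + m * p) j = cf_matrix a i j"
proof (induction m)
  case (Suc m)
  have "cf_matrix a (n + p) j = cf_matrix a n j" if "n \<ge> s" for n
  proof (induction j)
    case (Suc j)
    have "\<forall>n>s. a (n + p) = a n" using assms(1) by (simp add: periodic_cf_def)
    hence "a (n + Suc j + p) = a (n + Suc j)" by (rule allE[of _ "n + Suc j"]) (use that in simp)
    hence "a (n + p + Suc j) = a (n + Suc j)" by (simp add: ac_simps)
    thus ?case using Suc by simp
  qed auto
  from this[of "i + m * p"] Suc assms(2) show ?case by (simp add: ac_simps)
qed auto

text \<open>With determinant 1, a trace of at least 3 is what yields a real eigenvalue above 1 here;
  determinant 1 means even length, hence length at least 2. A single step has determinant -1, where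
  trace 1 is enough.\<close>

lemma (in pos_cf) cf_matrix_trace:
  assumes "j \<ge> 1"
  shows "cf_matrix a i j $ 1 $ 1 \<ge> 0 \<and> cf_matrix a i j $ 1 $ 2 \<ge> 1 \<and>
         cf_matrix a i j $ 2 $ 1 \<ge> 1 \<and> cf_matrix a i j $ 2 $ 2 \<ge> 1 \<and>
         (j \<ge> 2 \<longrightarrow> cf_matrix a i j $ 1 $ 1 \<ge> 1 \<and> cf_matrix a i j $ 2 $ 2 \<ge> 2)"
  using assms
proof (induction j rule: dec_induct)
  case base
  have "real_of_int (a (Suc i)) \<ge> 1" using pos[of "Suc i"] by simp
  thus ?case by (simp add: cf_matrix_entries del: cf_matrix.simps)
next
  case (step j)
  have "real_of_int (a (i + Suc j)) \<ge> 1" using pos[of "i + Suc j"] by simp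
  hence "real_of_int (a (i + Suc j)) * cf_matrix a i j $ 2 $ v \<ge> 1 * 1" if "cf_matrix a i j $ 2 $ v \<ge> 1" for v
    using that by (intro mult_mono) auto
  from this[of 1] this[of 2] step show ?case
    unfolding cf_matrix_entries by simp
qed

lemma linear_recurrence_solution:
  fixes v :: "nat \<Rightarrow> real"
  assumes rec: "\<And>m. v (Suc (Suc m)) = t * v (Suc m) - d * v m"
    and roots: "x\<^sup>2 - t * x + d = 0" "y\<^sup>2 - t * y + d = 0" "x \<noteq> y"
  shows "\<exists>C D. \<forall>m. v m = C * x ^ m + D * y ^ m"
proof -
  define C where "C = (v 1 - y * v 0) / (x - y)"
  define D where "D = (x * v 0 - v 1) / (x - y)"
  have x: "x ^ Suc (Suc m) = t * x ^ Suc m - d * x ^ m" for m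
  proof -
    have "x ^ Suc (Suc m) - (t * x ^ Suc m - d * x ^ m) = x ^ m * (x\<^sup>2 - t * x + d)"
      by (simp add: algebra_simps power2_eq_square)
    thus ?thesis using roots by simp
  qed
  have y: "y ^ Suc (Suc m) = t * y ^ Suc m - d * y ^ m" for m
  proof -
    have "y ^ Suc (Suc m) - (t * y ^ Suc m - d * y ^ m) = y ^ m * (y\<^sup>2 - t * y + d)"
      by (simp add: algebra_simps power2_eq_square)
    thus ?thesis using roots by simp
  qed
  have "C + D = v 0"
  proof -
    have "C + D = ((x - y) * v 0) / (x - y)"
      unfolding C_def D_def add_divide_distrib[symmetric] by (simp add: algebra_simps)
    thus ?thesis using roots(3) by simp
  qed
  moreover have "C * x + D * y = v 1"
  proof -
    have "C * x + D * y = ((x - y) * v 1) / (x - y)"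
      unfolding C_def D_def times_divide_eq_left add_divide_distrib[symmetric] by (simp add: algebra_simps)
    thus ?thesis using roots(3) by simp
  qed
  ultimately have "v m = C * x ^ m + D * y ^ m \<and> v (Suc m) = C * x ^ Suc m + D * y ^ Suc m" for m
  proof (induction m)
    case (Suc m)
    have "v (Suc (Suc m)) = C * x ^ Suc (Suc m) + D * y ^ Suc (Suc m)"
      unfolding rec x y using Suc by (simp add: algebra_simps)
    thus ?case using Suc by simp
  qed auto
  thus ?thesis by blast
qed

text \<open>The product of the two roots is \<open>d\<close>, at most 1, so at most one root exceeds
  1. Existence and uniqueness together unfold the definite description in
  \<open>eta\<close>.\<close>

lemma quadratic_root_gt_1:
  fixes t d :: real
  assumes "(d = -1 \<and> t \<ge> 1) \<or> (d = 1 \<and> t \<ge> 3)"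
  shows "\<exists>!x. x > 1 \<and> x\<^sup>2 - t * x + d = 0"
proof -
  define x where "x = (t + sqrt (t\<^sup>2 - 4 * d)) / 2"
  have t: "t \<ge> 1" using assms by auto
  have disc: "t\<^sup>2 - 4 * d > 0"
  proof (cases "d = 1")
    case True
    hence "t\<^sup>2 \<ge> 3\<^sup>2" using assms by (intro power_mono) auto
    thus ?thesis using True by simp
  qed (use assms t in \<open>auto simp: add_nonneg_pos\<close>)
  have "(sqrt (t\<^sup>2 - 4 * d))\<^sup>2 = t\<^sup>2 - 4 * d" using disc by simp
  moreover have "sqrt (t\<^sup>2 - 4 * d) = 2 * x - t" unfolding x_def by (simp add: field_simps)
  ultimately have "(2 * x - t)\<^sup>2 = t\<^sup>2 - 4 * d" by simp
  hence x0: "x\<^sup>2 - t * x + d = 0" by algebra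
  have x1: "x > 1"
  proof (rule ccontr)
    assume "\<not> x > 1"
    moreover have "x > 0" using t disc by (simp add: x_def add_pos_pos)
    ultimately have x: "0 < x" "x \<le> 1" by auto
    show False
    proof (cases "d = 1")
      case True
      define S where "S = sqrt (t\<^sup>2 - 4 * d)"
      have "S \<ge> 0" using disc by (simp add: S_def)
      moreover have "2 * x = t + S" by (simp add: x_def S_def)
      moreover have "t \<ge> 3" using assms True by auto
      ultimately show False using x by linarith
    next
      case False
      hence d: "d = -1" using assms by auto
      have "x * (x - t) = 1" using x0 d by (simp add: algebra_simps power2_eq_square)
      moreover have "x * (x - t) \<le> 0" using x t by (intro mult_nonneg_nonpos) auto
      ultimately show False by simp
    qed
  qed
  show ?thesis
  proof (rule ex1I[of _ x])
    fix y assume y: "y > 1 \<and> y\<^sup>2 - t * y + d = 0"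
    have "(y - x) * (y + x - t) = 0" using x0 y by (simp add: algebra_simps power2_eq_square)
    moreover have False if "y + x - t = 0"
    proof -
      have "x * y = d" using that x0 by algebra
      moreover have "x * y > 1 * 1" using x1 y by (intro mult_strict_mono) auto
      ultimately show False using assms by auto
    qed
    ultimately show "y = x" by auto
  qed (use x0 x1 in auto)
qed

text \<open>Applied to \<open>c\<close> and to \<open>- c\<close>: a growing mode that stays bounded
  has coefficient zero.\<close>

lemma power_bounded_imp_zero:
  fixes x c B :: real
  assumes "x > 1" "\<And>m::nat. c * x ^ m \<le> B" 
  shows "c \<le> 0"
proof (rule ccontr)
  assume "\<not> c \<le> 0"
  then obtain m where "B / c < x ^ m" using real_arch_pow[OF assms(1)] by blast
  thus False using assms(2)[of m] \<open>\<not> c \<le> 0\<close> by (simp add: field_simps)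
qed

section \<open>Growing and decaying modes along the period\<close>

locale periodic_cf_residue =
  fixes a :: "nat \<Rightarrow> int" and s p r :: nat
  assumes periodic: "periodic_cf a s p" and r1: "1 \<le> r"
begin

sublocale pos_cf a
  using periodic by unfold_locales (auto simp: periodic_cf_def)

lemma p1: "p \<ge> 1" using periodic by (simp add: periodic_cf_def)

abbreviation "T \<equiv> T_matrix a s p r"
abbreviation "\<eta> \<equiv> eta a s p r"
abbreviation "ix m \<equiv> s + m * p + r"
abbreviation "c \<equiv> C_const a s p r * E_const a s p r"

definition "tr = T $ 1 $ 1 + T $ 2 $ 2"

lemma eta_spec: "\<eta> > 1" "\<eta>\<^sup>2 - tr * \<eta> + (-1) ^ p = 0"
proof -
  note M = cf_matrix_trace[OF p1, of "s + r", folded T_matrix_def]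
  note det = cf_matrix_det[of a "s + r" p, folded T_matrix_def]
  have "((-1) ^ p = (-1::real) \<and> tr \<ge> 1) \<or> ((-1) ^ p = (1::real) \<and> tr \<ge> 3)"
  proof (cases "even p")
    case True
    hence "p \<ge> 2" using p1 by (cases "p = 1") auto
    thus ?thesis using M True by (auto simp: tr_def)
  next
    case False thus ?thesis using M by (auto simp: tr_def)
  qed
  note ex1 = quadratic_root_gt_1[OF this]
  have iff: "(\<exists>v. v \<noteq> 0 \<and> T *v v = x *s v) \<longleftrightarrow> x\<^sup>2 - tr * x + (-1) ^ p = 0" for x
  proof
    assume "\<exists>v. v \<noteq> 0 \<and> T *v v = x *s v"
    then obtain v where v: "v \<noteq> 0" "T *v v = x *s v" by blast
    have 1: "T $ 1 $ 1 * v $ 1 + T $ 1 $ 2 * v $ 2 = x * v $ 1"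
      using arg_cong[OF v(2), of "\<lambda>w. w $ 1"] by (simp add: matrix_vector_mult_def sum_2)
    have 2: "T $ 2 $ 1 * v $ 1 + T $ 2 $ 2 * v $ 2 = x * v $ 2"
      using arg_cong[OF v(2), of "\<lambda>w. w $ 2"] by (simp add: matrix_vector_mult_def sum_2)
    have "v $ 1 * (x\<^sup>2 - tr * x + (-1) ^ p) = 0" "v $ 2 * (x\<^sup>2 - tr * x + (-1) ^ p) = 0"
      unfolding det[symmetric] tr_def using 1 2 by algebra+
    moreover have "v $ 1 \<noteq> 0 \<or> v $ 2 \<noteq> 0" using v(1) by (simp add: vec_eq_iff forall_2)
    ultimately show "x\<^sup>2 - tr * x + (-1) ^ p = 0" by auto
  next
    assume x: "x\<^sup>2 - tr * x + (-1) ^ p = 0"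
    \<comment> \<open>Solves the first row of \<open>T - x\<close>; the entry
      \<open>T $ 1 $ 2\<close> is at least 1, which makes the vector nonzero.\<close>
    define v :: "real^2" where "v = vector [T $ 1 $ 2, x - T $ 1 $ 1]"
    have "v $ 1 \<noteq> 0" using M by (simp add: v_def)
    hence "v \<noteq> 0" by auto
    moreover have "T $ 2 $ 1 * T $ 1 $ 2 + T $ 2 $ 2 * (x - T $ 1 $ 1) = x * (x - T $ 1 $ 1)"
      using x unfolding det[symmetric] tr_def by algebra
    hence "T *v v = x *s v"
      by (simp add: vec_eq_iff forall_2 matrix_vector_mult_def sum_2 v_def algebra_simps)
    ultimately show "\<exists>v. v \<noteq> 0 \<and> T *v v = x *s v" by blast
  qed
  have "\<eta> > 1 \<and> \<eta>\<^sup>2 - tr * \<eta> + (-1) ^ p = 0"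
    unfolding eta_def iff by (rule theI'[OF ex1])
  thus "\<eta> > 1" "\<eta>\<^sup>2 - tr * \<eta> + (-1) ^ p = 0" by auto
qed

text \<open>One period multiplies the pair \<open>(X (ix m - 1), X (ix m))\<close> by the fixed
  matrix \<open>T\<close>, so its second entry obeys a scalar recurrence given by trace and
  determinant of \<open>T\<close>. The characteristic roots are \<eta> and
  \<open>(-1) ^ p / \<eta>\<close>.\<close>

lemma period_solution:
  fixes X :: "nat \<Rightarrow> real"
  assumes "\<And>k. X (Suc (Suc k)) = real_of_int (a (Suc (Suc k))) * X (Suc k) + X k"
  shows "\<exists>C D. \<forall>m. X (ix m) = C * \<eta> ^ m + D * (-1) ^ (m * p) * inverse (\<eta> ^ m)"
proof -
  define u where "u m = X (s + r - 1 + m * p)" for m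
  define v where "v m = X (ix m)" for m
  define d where "d = (-1 :: real) ^ p"
  note det = cf_matrix_det[of a "s + r" p, folded T_matrix_def d_def]
  have step: "u (Suc m) = T $ 1 $ 1 * u m + T $ 1 $ 2 * v m \<and> v (Suc m) = T $ 2 $ 1 * u m + T $ 2 $ 2 * v m" for m
  proof -
    define k where "k = s + r - 1 + m * p"
    have k: "Suc k = s + r + m * p" using r1 by (simp add: k_def)
    have "cf_matrix a (Suc k) p = T"
      unfolding k T_matrix_def using periodic by (intro cf_matrix_periodic) auto
    moreover have "k + p = s + r - 1 + Suc m * p" "Suc k + p = s + Suc m * p + r" "Suc k = ix m"
      using k by (simp_all add: k_def)
    ultimately show ?thesis
      using cf_matrix_solution[of X a k p, OF assms] unfolding u_def v_def k_def[symmetric] by metis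
  qed
  have rec: "v (Suc (Suc m)) = tr * v (Suc m) - d * v m" for m
    using step[of m] step[of "Suc m"] unfolding det[symmetric] tr_def by algebra
  have d2: "d * d = 1" by (simp add: d_def flip: power_add)
  have eta0: "\<eta> \<noteq> 0" using eta_spec(1) by linarith
  have "\<eta>\<^sup>2 * ((d / \<eta>)\<^sup>2 - tr * (d / \<eta>) + d) = d * (\<eta>\<^sup>2 - tr * \<eta> + d)"
    using eta0 d2 by (simp add: field_simps power2_eq_square)
  hence "(d / \<eta>)\<^sup>2 - tr * (d / \<eta>) + d = 0" using eta_spec(2) eta0 by (simp add: d_def)
  moreover have "\<eta> \<noteq> d / \<eta>"
  proof
    assume "\<eta> = d / \<eta>"
    hence "\<eta> * \<eta> = d" using eta0 by (simp add: field_simps)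
    moreover have "\<eta> * \<eta> > 1 * 1" using eta_spec(1) by (intro mult_strict_mono) auto
    moreover have "d \<le> 1" unfolding d_def by (cases "even p") auto
    ultimately show False by linarith
  qed
  ultimately obtain C D where "\<And>m. v m = C * \<eta> ^ m + D * (d / \<eta>) ^ m"
    using linear_recurrence_solution[of v tr d \<eta> "d / \<eta>"] rec eta_spec(2) unfolding d_def by blast
  moreover have "(d / \<eta>) ^ m = (-1) ^ (m * p) * inverse (\<eta> ^ m)" for m
    by (simp add: d_def divide_inverse power_mult_distrib power_inverse mult.commute[of m p] power_mult)
  ultimately show ?thesis unfolding v_def by (metis mult.assoc)
qed

lemma abs_inverse_eta: "\<bar>D * (-1) ^ (m * p) * inverse (\<eta> ^ m)\<bar> \<le> \<bar>D\<bar>"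
proof -
  have "inverse (\<eta> ^ m) \<le> 1" "inverse (\<eta> ^ m) \<ge> 0"
    using eta_spec(1) by (auto intro!: inverse_le_1_iff[THEN iffD2] simp: one_le_power)
  hence "\<bar>D\<bar> * inverse (\<eta> ^ m) \<le> \<bar>D\<bar>" by (intro mult_left_le) auto
  moreover have "\<bar>inverse (\<eta> ^ m)\<bar> = inverse (\<eta> ^ m)" using eta_spec(1) by simp
  ultimately show ?thesis by (simp only: abs_mult power_abs) simp
qed

text \<open>Justifies the definite description. A nonpositive coefficient would keep the
  denominators below \<open>\<bar>D\<bar>\<close>, although they grow at least linearly; two
  admissible coefficients differ by a bounded growing mode, hence not at all.\<close>

lemma C_const_spec:
  "C_const a s p r > 0 \<and> (\<exists>D. \<forall>m. den (ix m)
       = C_const a s p r * \<eta> ^ m + D * (-1) ^ (m * p) * inverse (\<eta> ^ m))"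
  unfolding C_const_def
proof (rule theI')
  obtain C D where CD: "\<And>m. den (ix m)
       = C * \<eta> ^ m + D * (-1) ^ (m * p) * inverse (\<eta> ^ m)"
    using period_solution[of "\<lambda>k. den k"] by auto
  have "C > 0"
  proof (rule ccontr)
    assume "\<not> C > 0"
    hence C0: "C * \<eta> ^ m \<le> 0" for m using eta_spec(1) by (simp add: mult_nonpos_nonneg)
    define m where "m = nat \<lceil>\<bar>D\<bar>\<rceil> + 1"
    have "den (ix m) \<le> \<bar>D\<bar>"
      unfolding CD using C0[of m] abs_inverse_eta[of D m] by linarith
    moreover have "real m \<le> den (ix m)"
    proof -
      have "m * 1 \<le> m * p" using p1 by (intro mult_left_mono) auto
      hence "m \<le> ix m" by linarith
      hence "int m \<le> int (ix m)" by (simp only: of_nat_le_iff)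
      also have "\<dots> \<le> cf_den a (ix m)" by (rule cf_den_ge)
      finally show ?thesis by linarith
    qed
    moreover have "real m > \<bar>D\<bar>" unfolding m_def by linarith
    ultimately show False by linarith
  qed
  moreover have "C' = C" if C': "\<And>m. den (ix m)
       = C' * \<eta> ^ m + D' * (-1) ^ (m * p) * inverse (\<eta> ^ m)" for C' D'
  proof -
    have "\<bar>(C' - C) * \<eta> ^ m\<bar> \<le> \<bar>D\<bar> + \<bar>D'\<bar>" for m
      using CD[of m] C'[of m] abs_inverse_eta[of D m] abs_inverse_eta[of D' m]
      unfolding left_diff_distrib by linarith
    hence "(C' - C) * \<eta> ^ m \<le> \<bar>D\<bar> + \<bar>D'\<bar>" "- (C' - C) * \<eta> ^ m \<le> \<bar>D\<bar> + \<bar>D'\<bar>" for m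
      unfolding mult_minus_left by (rule abs_le_D1, rule abs_le_D2)
    from power_bounded_imp_zero[OF eta_spec(1) this(1)] power_bounded_imp_zero[OF eta_spec(1) this(2)]
    show ?thesis by linarith
  qed
  ultimately show "\<exists>!C. C > 0 \<and> (\<exists>D. \<forall>m. den (ix m)
       = C * \<eta> ^ m + D * (-1) ^ (m * p) * inverse (\<eta> ^ m))"
    using CD by blast
qed

text \<open>The quantity \<open>q \<alpha> - p\<close> is bounded, so its growing mode vanishes. The
  factor \<open>(-1) ^ (m * p)\<close> of the decaying mode cancels against the sign in
  \<open>cf_delta\<close>, which leaves a pure power of \<open>1/\<eta>\<close>.\<close>

lemma E_const_spec:
  "E_const a s p r > 0 \<and> (\<forall>m. cf_delta a (ix m) = E_const a s p r * inverse (\<eta> ^ m))"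
  unfolding E_const_def
proof (rule theI')
  define X where "X k = den k * cf_value a - real_of_int (cf_num a k)" for k
  have "X (Suc (Suc k)) = real_of_int (a (Suc (Suc k))) * X (Suc k) + X k" for k
    by (simp add: X_def algebra_simps)
  from period_solution[OF this] obtain C D where
    CD: "\<And>m. X (ix m) = C * \<eta> ^ m + D * (-1) ^ (m * p) * inverse (\<eta> ^ m)" by blast
  have bd: "\<bar>X k\<bar> \<le> 1" for k
  proof -
    have "1 / den k \<le> 1" using cf_den_pos[of k] by simp
    thus ?thesis unfolding X_def abs_cf_delta using cf_delta_le[of k] by linarith
  qed
  have "\<bar>C * \<eta> ^ m\<bar> \<le> \<bar>D\<bar> + 1" for m
    using CD[of m] bd[of "ix m"] abs_inverse_eta[of D m] by linarith
  hence "C * \<eta> ^ m \<le> \<bar>D\<bar> + 1" "(- C) * \<eta> ^ m \<le> \<bar>D\<bar> + 1" for m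
    unfolding mult_minus_left by (rule abs_le_D1, rule abs_le_D2)
  from power_bounded_imp_zero[OF eta_spec(1) this(1)] power_bounded_imp_zero[OF eta_spec(1) this(2)]
  have "C = 0" by linarith
  have eq: "cf_delta a (ix m) = ((-1) ^ (s + r) * D) * inverse (\<eta> ^ m)" for m
  proof -
    have "cf_delta a (ix m) = (-1) ^ (ix m) * X (ix m)"
      by (simp add: cf_delta_def X_def)
    also have "\<dots> = ((-1) ^ (s + r) * D) * inverse (\<eta> ^ m) * ((-1) ^ (m * p) * (-1) ^ (m * p))"
      unfolding CD \<open>C = 0\<close> power_add by (simp only: mult_zero_left add_0_left ac_simps)
    also have "(-1) ^ (m * p) * (-1) ^ (m * p) = (1::real)"
      by (simp flip: power_add)
    finally show ?thesis by simp
  qed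
  have "(-1) ^ (s + r) * D > 0"
    using eq[of 0] cf_delta_pos[of "s + r"] by simp
  thus "\<exists>!E. E > 0 \<and> (\<forall>m. cf_delta a (ix m) = E * inverse (\<eta> ^ m))"
    using eq by (intro ex1I[of _ "(-1) ^ (s + r) * D"]) (auto dest: spec[of _ 0])
qed

text \<open>Multiplying the two modes of \<open>q\<close> by \<open>E \<eta>^(-m)\<close> leaves the
  constant \<open>C E\<close> and an error of order \<open>\<eta>^(-2m)\<close>. As \<open>q\<close>
  is at most a constant times \<open>\<eta>^m\<close>, that error is \<open>O(q^-2)\<close>.\<close>

lemma den_delta_limit:
  shows "c > 0" "c \<le> 1"
    "\<exists>K. \<forall>m. \<bar>den (ix m) * cf_delta a (ix m)
              - c\<bar> \<le> K / (den (ix m))\<^sup>2"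
proof -
  define C where "C = C_const a s p r"
  define E where "E = E_const a s p r"
  obtain D where D: "\<And>m. den (ix m)
       = C * \<eta> ^ m + D * (-1) ^ (m * p) * inverse (\<eta> ^ m)" and C: "C > 0"
    using C_const_spec unfolding C_def by blast
  have E: "\<And>m. cf_delta a (ix m) = E * inverse (\<eta> ^ m)" "E > 0"
    using E_const_spec unfolding E_def by blast+
  show CE: "c > 0" using C E unfolding C_def E_def by simp
  have ep: "\<eta> ^ m > 0" for m using eta_spec(1) by simp
  have diff: "\<bar>den (ix m) * cf_delta a (ix m) - C * E\<bar>
      = \<bar>D\<bar> * E * (inverse (\<eta> ^ m))\<^sup>2" for m
  proof -
    have "den (ix m) * cf_delta a (ix m) - C * E
      = D * E * (-1) ^ (m * p) * (inverse (\<eta> ^ m))\<^sup>2"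
    proof -
      have "\<eta> ^ m * inverse (\<eta> ^ m) = 1"
        using ep[of m] by (metis less_irrefl right_inverse)
      moreover have "(C * z + D * \<sigma> * w) * (E * w) - C * E = D * E * \<sigma> * w\<^sup>2"
        if "z * w = 1" for z w \<sigma>
        using that by algebra
      ultimately show ?thesis unfolding D E by blast
    qed
    thus ?thesis using E(2) eta_spec(1) by (simp add: abs_mult power_abs)
  qed
  show "\<exists>K. \<forall>m. \<bar>den (ix m) * cf_delta a (ix m)
              - c\<bar> \<le> K / (den (ix m))\<^sup>2"
  proof (intro exI allI)
    fix m
    define q where "q = den (ix m)"
    have q: "q > 0" using cf_den_pos[of "ix m"] unfolding q_def by linarith
    have "q \<le> (C + \<bar>D\<bar>) * \<eta> ^ m"
    proof -
      have "\<bar>D\<bar> * 1 \<le> \<bar>D\<bar> * \<eta> ^ m" using eta_spec(1) by (intro mult_left_mono) auto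
      thus ?thesis using abs_inverse_eta[of D m] unfolding q_def D distrib_right by linarith
    qed
    hence "q * inverse (\<eta> ^ m) \<le> C + \<bar>D\<bar>" using ep[of m] by (simp add: field_simps)
    hence "(q * inverse (\<eta> ^ m))\<^sup>2 \<le> (C + \<bar>D\<bar>)\<^sup>2" using q ep[of m] by (intro power_mono) auto
    hence "(inverse (\<eta> ^ m))\<^sup>2 \<le> (C + \<bar>D\<bar>)\<^sup>2 / q\<^sup>2" using q by (simp add: field_simps power_mult_distrib)
    hence "\<bar>D\<bar> * E * (inverse (\<eta> ^ m))\<^sup>2 \<le> \<bar>D\<bar> * E * ((C + \<bar>D\<bar>)\<^sup>2 / q\<^sup>2)"
      using E(2) by (intro mult_left_mono) auto
    thus "\<bar>den (ix m) * cf_delta a (ix m)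
              - c\<bar> \<le> (\<bar>D\<bar> * E * (C + \<bar>D\<bar>)\<^sup>2) / (den (ix m))\<^sup>2"
      using diff[of m] unfolding q_def C_def E_def by simp
  qed
  \<comment> \<open>The inequality \<open>q \<delta> \<le> 1\<close> in the limit: if
    \<open>C * E\<close> exceeded 1, this left side would be unbounded in \<open>m\<close>.\<close>
  have "(C * E - 1) * \<eta> ^ m \<le> \<bar>D\<bar> * E" for m
  proof -
    have "C * E - 1 \<le> \<bar>D\<bar> * E * (inverse (\<eta> ^ m))\<^sup>2"
      using diff[of m] cf_den_delta_le[of "ix m"] by linarith
    hence "(C * E - 1) * \<eta> ^ m \<le> \<bar>D\<bar> * E * (inverse (\<eta> ^ m))\<^sup>2 * \<eta> ^ m"
      using ep[of m] by (intro mult_right_mono) auto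
    also have "\<dots> = \<bar>D\<bar> * E * inverse (\<eta> ^ m)" proof -
      have "inverse (\<eta> ^ m) * \<eta> ^ m = 1" using ep[of m] by (metis less_irrefl left_inverse)
      thus ?thesis by (simp only: power2_eq_square mult.assoc mult_1_right)
    qed
    also have "\<dots> \<le> \<bar>D\<bar> * E"
      using E(2) eta_spec(1) by (intro mult_left_le) (auto simp: inverse_le_1_iff one_le_power)
    finally show ?thesis .
  qed
  from power_bounded_imp_zero[OF eta_spec(1) this] show "c \<le> 1"
    unfolding C_def E_def by simp
qed

end

section \<open>The limit function\<close>

text \<open>The parameters are free because both the limiting pair
  \<open>\<alpha>\<^sub>r, C\<^sub>r E\<^sub>r\<close> and the finite pair
  \<open>q'/q, c\<^sub>k\<close> will be inserted. Without the absolute value the factor is a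
  polynomial in \<open>x\<close>.\<close>

definition sudler_factor :: "real \<Rightarrow> real \<Rightarrow> nat \<Rightarrow> real \<Rightarrow> real" where
  "sudler_factor \<beta> c n x =
     (1 - c * ((frac (real n * \<beta>) - 1/2) / real n))\<^sup>2 - (x + c / 2)\<^sup>2 / (real n)\<^sup>2"

text \<open>Up to sign an antiderivative of \<open>(1 + ln t)/t^2\<close>; Abel sums with weight
  \<open>1/n\<close> against a logarithmic discrepancy therefore telescope.\<close>

definition log_rate :: "nat \<Rightarrow> real" where
  "log_rate N = (2 + ln (real N)) / real N"

lemma log_rate_diff:
  assumes "n \<ge> 1"
  shows "(1 + ln (real n)) * (1 / real n - 1 / real (Suc n)) \<le> log_rate n - log_rate (Suc n)"
proof -
  have n: "real n > 0" using assms by simp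
  have "ln (real (Suc n) / real n) \<le> real (Suc n) / real n - 1"
    using n by (intro ln_le_minus_one) auto
  hence "ln (real (Suc n)) \<le> ln (real n) + 1 / real n"
    using n by (simp add: ln_div field_simps)
  hence "(2 + ln (real (Suc n))) / real (Suc n) \<le> (2 + ln (real n) + 1 / real n) / real (Suc n)"
    by (intro divide_right_mono) auto
  hence "log_rate n - log_rate (Suc n) \<ge> (2 + ln (real n)) / real n - (2 + ln (real n) + 1 / real n) / real (Suc n)"
    unfolding log_rate_def by linarith
  also have "(2 + ln (real n)) / real n - (2 + ln (real n) + 1 / real n) / real (Suc n)
      = (1 + ln (real n)) * (1 / real n - 1 / real (Suc n))"
    using n by (simp add: divide_simps) (simp add: algebra_simps)
  finally show ?thesis .
qed

lemma log_rate_Suc_le: "n \<ge> 1 \<Longrightarrow> log_rate (Suc n) \<le> log_rate n"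
proof -
  assume n: "n \<ge> 1"
  have "(1 + ln (real n)) * (1 / real n - 1 / real (Suc n)) \<ge> 0"
    using n by (intro mult_nonneg_nonneg) (auto simp: field_simps)
  thus ?thesis using log_rate_diff[OF n] by linarith
qed

lemma inverse_le_log_rate: "n \<ge> 1 \<Longrightarrow> 1 / real n \<le> log_rate n"
  unfolding log_rate_def by (intro divide_right_mono) auto

lemma log_rate_tendsto: "log_rate \<longlonglongrightarrow> 0"
  unfolding log_rate_def by real_asymp

lemma sum_inverse_squares_le:
  assumes "1 \<le> M" "M \<le> N"
  shows "(\<Sum>n=Suc M..N. 1 / (real n)\<^sup>2) \<le> 1 / real M - 1 / real N"
  using assms(2)
proof (induction N rule: dec_induct)
  case (step n)
  have n: "real n > 0" using assms step by simp
  have "1 / (real (Suc n))\<^sup>2 \<le> 1 / (real n * real (Suc n))"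
    using n unfolding power2_eq_square by (intro divide_left_mono mult_right_mono) auto
  also have "\<dots> = 1 / real n - 1 / real (Suc n)" using n by (simp add: field_simps)
  finally show ?case using step by simp
qed auto

section \<open>Elementary estimates for logarithms and exponentials, and gluing of
  derivatives\<close>

lemma abs_ln_prod_one_plus:
  fixes z :: "'i \<Rightarrow> real"
  assumes "finite I" "\<And>i. i \<in> I \<Longrightarrow> \<bar>z i\<bar> \<le> 1/2"
  shows "\<bar>ln (\<Prod>i\<in>I. 1 + z i) - (\<Sum>i\<in>I. z i)\<bar> \<le> 2 * (\<Sum>i\<in>I. (z i)\<^sup>2)"
proof -
  have nz: "1 + z i \<noteq> 0" if "i \<in> I" for i using assms(2)[OF that] by linarith
  have "\<bar>ln (\<Prod>i\<in>I. 1 + z i) - (\<Sum>i\<in>I. z i)\<bar> = \<bar>\<Sum>i\<in>I. ln (1 + z i) - z i\<bar>"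
    using ln_prod[OF assms(1), of "\<lambda>i. 1 + z i"] nz by (simp add: sum_subtractf)
  also have "\<dots> \<le> (\<Sum>i\<in>I. \<bar>ln (1 + z i) - z i\<bar>)" by (rule sum_abs)
  also have "\<dots> \<le> (\<Sum>i\<in>I. 2 * (z i)\<^sup>2)"
    using assms(2) by (intro sum_mono abs_ln_one_plus_x_minus_x_bound)
  finally show ?thesis by (simp add: sum_distrib_left)
qed

lemma abs_exp_diff_le:
  fixes a l :: real
  assumes "\<bar>a - l\<bar> \<le> 1"
  shows "\<bar>exp a - exp l\<bar> \<le> 2 * exp l * \<bar>a - l\<bar>"
proof -
  define t where "t = a - l"
  have "\<bar>exp t - 1\<bar> \<le> 2 * \<bar>t\<bar>"
  proof (cases "t \<ge> 0")
    case True
    have "exp t \<le> 1 + t + t\<^sup>2" using True assms by (intro exp_bound) (auto simp: t_def)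
    moreover have "t\<^sup>2 \<le> t * 1"
      unfolding power2_eq_square using True assms by (intro mult_left_mono) (auto simp: t_def)
    moreover have "exp t \<ge> 1" using True by simp
    ultimately show ?thesis using True by linarith
  next
    case False
    have "exp t \<ge> 1 + t" by (rule exp_ge_add_one_self)
    moreover have "exp t \<le> 1" using False by simp
    ultimately show ?thesis using False by linarith
  qed
  hence "\<bar>exp (a - l) - 1\<bar> \<le> 2 * \<bar>a - l\<bar>" unfolding t_def .
  hence "exp l * \<bar>exp (a - l) - 1\<bar> \<le> exp l * (2 * \<bar>a - l\<bar>)" by (intro mult_left_mono) auto
  moreover have "exp a - exp l = exp l * (exp (a - l) - 1)" by (simp add: exp_diff algebra_simps)
  ultimately show ?thesis by (simp add: abs_mult)
qed

text \<open>\<open>C1_differentiable_on\<close> asks for one derivative function on the whole set,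
  whereas the explicit formulas for the limit function change with the bound on \<open>x\<close>. On
  open sets the derivative is unique, so the local ones glue.\<close>

lemma C1_differentiable_on_locally:
  fixes f :: "real \<Rightarrow> 'a::real_normed_vector"
  assumes "\<And>x. x \<in> S \<Longrightarrow> \<exists>U g. open U \<and> x \<in> U \<and> g C1_differentiable_on U \<and> (\<forall>y\<in>U. f y = g y)"
  shows "f C1_differentiable_on S"
  unfolding C1_differentiable_on_eq continuous_on_eq_continuous_within
proof (intro conjI ballI)
  fix x assume "x \<in> S"
  from assms[OF this] obtain U g where
    U: "open U" "x \<in> U" "g C1_differentiable_on U" "\<forall>y\<in>U. f y = g y"
    by (elim exE conjE)
  obtain D where D: "\<forall>y\<in>U. (g has_vector_derivative D y) (at y)" "continuous_on U D"
    using U(3) unfolding C1_differentiable_on_def by (elim exE conjE)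
  have fD: "(f has_vector_derivative D y) (at y)" if "y \<in> U" for y
    by (rule has_vector_derivative_transform_within_open[OF bspec[OF D(1) that] U(1) that]) (use U(4) in simp)
  show "f differentiable at x" using fD[OF U(2)] by (rule differentiableI_vector)
  have "isCont D x" using D(2) U(1,2) continuous_on_eq_continuous_at by blast
  moreover have "eventually (\<lambda>y. vector_derivative f (at y) = D y) (nhds x)"
    using eventually_nhds_in_open[OF U(1,2)] by eventually_elim (rule vector_derivative_at[OF fD])
  ultimately have "isCont (\<lambda>y. vector_derivative f (at y)) x"
    by (simp only: isCont_cong)
  thus "continuous (at x within S) (\<lambda>x. vector_derivative f (at x))"
    by (rule continuous_at_imp_continuous_at_within)
qed

lemma C1_differentiable_on_prod:
  fixes f :: "'i \<Rightarrow> real \<Rightarrow> real"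
  assumes "\<And>i. i \<in> I \<Longrightarrow> f i C1_differentiable_on S"
  shows "(\<lambda>x. \<Prod>i\<in>I. f i x) C1_differentiable_on S"
  using assms by (induction I rule: infinite_finite_induct) auto

section \<open>Convergence of the infinite product\<close>

locale sudler_limit =
  fixes \<beta> c K0 :: real
  assumes c: "0 < c" "c \<le> 1" and K0: "0 \<le> K0"
    and disc: "\<And>N. N \<ge> 1 \<Longrightarrow> \<bar>\<Sum>n=1..N. frac (real n * \<beta>) - 1/2\<bar> \<le> K0 * (1 + ln (real N))"
begin

abbreviation "y n \<equiv> frac (real n * \<beta>) - 1/2"
abbreviation "f \<equiv> sudler_factor \<beta> c"

lemma abs_y: "\<bar>y n\<bar> \<le> 1/2"
  using frac_lt_1[of "real n * \<beta>"] frac_ge_0[of "real n * \<beta>"] by linarith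

text \<open>In the Abel sum the boundary term at \<open>N\<close> cancels against the telescoped
  remainder, which leaves twice \<open>K0 * log_rate (Suc M)\<close> and hence a bound free of
  \<open>N\<close>.\<close>

lemma sum_y_over_n:
  assumes "1 \<le> M" "M \<le> N"
  shows "\<bar>\<Sum>n=Suc M..N. y n * (1 / real n)\<bar> \<le> 2 * K0 * log_rate M"
proof -
  define S where "S N = (\<Sum>n=1..N. y n)" for N
  define g where "g n = 1 / real n" for n
  have S: "\<bar>S n\<bar> \<le> K0 * (1 + ln (real n))" if "n \<ge> 1" for n using disc[OF that] by (simp add: S_def)
  have b1: "\<bar>S m * g (Suc m)\<bar> \<le> K0 * log_rate (Suc m)" if "m \<ge> 1" for m
  proof -
    have "\<bar>S m * g (Suc m)\<bar> \<le> (K0 * (1 + ln (real m))) * (1 / real (Suc m))"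
      unfolding abs_mult using S[OF that] by (intro mult_mono) (auto simp: g_def)
    also have "ln (real m) \<le> ln (real (Suc m))" using that by simp
    hence "(1 + ln (real m)) * (1 / real (Suc m)) \<le> log_rate (Suc m)"
      unfolding log_rate_def times_divide_eq_right by (intro divide_right_mono) auto
    hence "(K0 * (1 + ln (real m))) * (1 / real (Suc m)) \<le> K0 * log_rate (Suc m)"
      unfolding mult.assoc using K0 by (intro mult_left_mono)
    finally show ?thesis .
  qed
  have b2: "\<bar>\<Sum>n=Suc M..N. S n * (g n - g (Suc n))\<bar> \<le> K0 * (log_rate (Suc M) - log_rate (Suc N))"
  proof -
    have "\<bar>\<Sum>n=Suc M..N. S n * (g n - g (Suc n))\<bar> \<le> (\<Sum>n=Suc M..N. \<bar>S n * (g n - g (Suc n))\<bar>)"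
      by (rule sum_abs)
    also have "\<dots> \<le> (\<Sum>n=Suc M..N. K0 * (log_rate n - log_rate (Suc n)))"
    proof (rule sum_mono)
      fix n assume n: "n \<in> {Suc M..N}"
      have g: "g n - g (Suc n) \<ge> 0" using n by (auto simp: g_def field_simps)
      have "\<bar>S n * (g n - g (Suc n))\<bar> \<le> K0 * (1 + ln (real n)) * (g n - g (Suc n))"
        unfolding abs_mult using S[of n] n g by (intro mult_mono) auto
      also have "\<dots> \<le> K0 * (log_rate n - log_rate (Suc n))"
        using log_rate_diff[of n] n K0 unfolding mult.assoc g_def by (intro mult_left_mono) auto
      finally show "\<bar>S n * (g n - g (Suc n))\<bar> \<le> K0 * (log_rate n - log_rate (Suc n))" .
    qed
    also have "\<dots> = K0 * (\<Sum>n=Suc M..N. (log_rate n - log_rate (Suc n)))"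
      by (simp add: sum_distrib_left)
    also have "(\<Sum>n=Suc M..N. (log_rate n - log_rate (Suc n))) = log_rate (Suc M) - log_rate (Suc N)"
      using assms(2) by (induction N rule: dec_induct) auto
    finally show ?thesis .
  qed
  have "K0 * log_rate (Suc M) \<le> K0 * log_rate M"
    using log_rate_Suc_le assms K0 by (intro mult_left_mono) auto
  moreover have "(\<Sum>n=Suc M..N. y n * g n) = S N * g (Suc N) - S M * g (Suc M) + (\<Sum>n=Suc M..N. S n * (g n - g (Suc n)))"
    unfolding S_def by (rule sum_mult_Abel[OF assms(2)])
  ultimately show ?thesis
    using b1[of M] b1[of N] b2 assms unfolding g_def[symmetric] right_diff_distrib by linarith
qed

text \<open>The factors beyond this index are close to \<open>1\<close> for \<open>\<bar>x\<bar> \<le> B\<close>.\<close>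

definition head :: "real \<Rightarrow> nat" where "head B = nat \<lceil>4 * (B + 1)\<^sup>2\<rceil>"

text \<open>Collects the losses in \<open>tail_prod_bound\<close>: \<open>4 * K0\<close> from the
  linear sawtooth term, \<open>(B + 1)^2\<close> from the quadratic part of the factors, and 8 from
  replacing \<open>ln (1 + z)\<close> by \<open>z\<close>.\<close>

definition tail_const :: "real \<Rightarrow> real" where "tail_const B = 4 * K0 + (B + 1)\<^sup>2 + 8"

definition tail_log :: "real \<Rightarrow> real \<Rightarrow> real" where
  "tail_log B x = (\<Sum>i. ln (f (i + Suc (head B)) x))"

lemma head_ge: "n \<ge> head B \<Longrightarrow> real n \<ge> 4 * (B + 1)\<^sup>2"
  unfolding head_def by linarith

lemma head_ge_4: assumes "B \<ge> 0" "n \<ge> head B" shows "n \<ge> 4"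
proof -
  have "(1::real)\<^sup>2 \<le> (B + 1)\<^sup>2" using assms by (intro power_mono) auto
  thus ?thesis using head_ge[OF assms(2)] by simp
qed

text \<open>The factor is \<open>1 - 2 c y/n\<close> plus a term of order \<open>1/n^2\<close> that
  contains all dependence on \<open>x\<close>. The first estimate preserves the cancellation in the
  linear term; the second is the crude size used for positivity and for sums of squares.\<close>

lemma factor_deviation:
  assumes "\<bar>x\<bar> \<le> B" "n \<ge> head B"
  shows "\<bar>f n x - 1 + 2 * c * (y n * (1 / real n))\<bar> \<le> (B + 1)\<^sup>2 * (1 / (real n)\<^sup>2)"
    and "\<bar>f n x - 1\<bar> \<le> 2 / real n"
proof -
  have B: "B \<ge> 0" using assms by auto
  have n: "n \<ge> 4" using head_ge_4[OF B assms(2)] .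
  have eq: "f n x - 1 + 2 * c * (y n * (1 / real n)) = ((c * y n)\<^sup>2 - (x + c/2)\<^sup>2) * (1 / (real n)\<^sup>2)"
    using n by (simp add: sudler_factor_def power2_eq_square field_simps)
  have "\<bar>c * y n\<bar> \<le> 1 * (1/2)" unfolding abs_mult using c abs_y by (intro mult_mono) auto
  hence "\<bar>c * y n\<bar>\<^sup>2 \<le> (B + 1)\<^sup>2" using B by (intro power_mono) auto
  moreover have "\<bar>x + c/2\<bar>\<^sup>2 \<le> (B + 1)\<^sup>2" using assms c by (intro power_mono) auto
  moreover have "\<bar>u\<^sup>2 - v\<^sup>2\<bar> \<le> W" if "\<bar>u\<bar>\<^sup>2 \<le> W" "\<bar>v\<bar>\<^sup>2 \<le> W" for u v W :: real
    using that zero_le_power2[of u] zero_le_power2[of v] unfolding power2_abs abs_le_iff by linarith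
  ultimately have "\<bar>(c * y n)\<^sup>2 - (x + c/2)\<^sup>2\<bar> \<le> (B + 1)\<^sup>2" by blast
  hence "\<bar>((c * y n)\<^sup>2 - (x + c/2)\<^sup>2) * (1 / (real n)\<^sup>2)\<bar> \<le> (B + 1)\<^sup>2 * (1 / (real n)\<^sup>2)"
    unfolding abs_mult by (intro mult_mono) auto
  thus 1: "\<bar>f n x - 1 + 2 * c * (y n * (1 / real n))\<bar> \<le> (B + 1)\<^sup>2 * (1 / (real n)\<^sup>2)"
    unfolding eq .
  \<comment> \<open>The choice of \<open>head\<close> gives \<open>n \<ge> 4 (B + 1)^2\<close>. This
    absorbs one power of \<open>n\<close> here, and \<open>n \<ge> 4\<close> later brings
    \<open>2 / n\<close> below 1/2.\<close>
  have "(B + 1)\<^sup>2 * (1 / (real n)\<^sup>2) \<le> real n * (1 / (real n)\<^sup>2)"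
    using head_ge[OF assms(2)] by (intro mult_right_mono) auto
  also have "\<dots> = 1 / real n" using n by (simp add: power2_eq_square)
  finally have "(B + 1)\<^sup>2 * (1 / (real n)\<^sup>2) \<le> 1 / real n" .
  moreover have "\<bar>2 * c * (y n * (1 / real n))\<bar> \<le> 1 / real n"
  proof -
    have "\<bar>2 * c * (y n * (1 / real n))\<bar> = (2 * \<bar>c * y n\<bar>) * (1 / real n)"
      by (simp add: abs_mult)
    also have "\<dots> \<le> 1 * (1 / real n)" using \<open>\<bar>c * y n\<bar> \<le> 1 * (1/2)\<close> by (intro mult_right_mono) auto
    finally show ?thesis by simp
  qed
  moreover have "\<bar>f n x - 1\<bar> \<le> \<bar>f n x - 1 + 2 * c * (y n * (1 / real n))\<bar> + \<bar>2 * c * (y n * (1 / real n))\<bar>"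
    using abs_triangle_ineq4[of "f n x - 1 + 2 * c * (y n * (1 / real n))" "2 * c * (y n * (1 / real n))"]
    by (simp only: add_diff_cancel_right')
  moreover have "1 / real n + 1 / real n = 2 / real n" by simp
  moreover have "\<bar>u\<bar> \<le> s" if "v \<le> w" "\<bar>u'\<bar> \<le> w" "\<bar>u\<bar> \<le> \<bar>u''\<bar> + \<bar>u'\<bar>" "w + w = s" "\<bar>u''\<bar> \<le> v" for u u' u'' v w s :: real
    using that by linarith
  ultimately show "\<bar>f n x - 1\<bar> \<le> 2 / real n" using 1 by blast
qed

lemma factor_ge_half:
  assumes "\<bar>x\<bar> \<le> B" "n \<ge> head B"
  shows "f n x \<ge> 1/2" "\<bar>f n x - 1\<bar> \<le> 1/2"
proof -
  have "real n \<ge> 4" using head_ge_4[of B n] assms by auto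
  hence "2 / real n \<le> 1 / 2" by (simp add: field_simps)
  thus "\<bar>f n x - 1\<bar> \<le> 1/2" "f n x \<ge> 1/2" using factor_deviation(2)[OF assms] by linarith+
qed

text \<open>The bound does not involve \<open>N\<close>. It is therefore both a Cauchy criterion for
  the series of logarithms and, after letting \<open>N\<close> grow, the truncation error at
  \<open>M\<close>.\<close>

lemma tail_prod_bound:
  assumes x: "\<bar>x\<bar> \<le> B" and M: "head B \<le> M" "M \<le> N"
  shows "\<bar>ln (\<Prod>n=Suc M..N. f n x)\<bar> \<le> tail_const B * log_rate M"
proof -
  have B: "B \<ge> 0" using x by auto
  have M1: "M \<ge> 1" using head_ge_4[OF B M(1)] by simp
  define z where "z n = f n x - 1" for n
  have z: "\<bar>z n + 2 * c * (y n * (1 / real n))\<bar> \<le> (B + 1)\<^sup>2 * (1 / (real n)\<^sup>2)"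
     "\<bar>z n\<bar> \<le> 2 / real n" "\<bar>z n\<bar> \<le> 1/2" if "n \<in> {Suc M..N}" for n
    using factor_deviation[OF x, of n] factor_ge_half[OF x, of n] that M unfolding z_def by auto
  have sq: "(\<Sum>n=Suc M..N. 1 / (real n)\<^sup>2) \<le> log_rate M"
  proof -
    have "1 / real N \<ge> 0" by simp
    thus ?thesis using sum_inverse_squares_le[OF M1 M(2)] inverse_le_log_rate[OF M1] by linarith
  qed
  have "\<bar>ln (\<Prod>n=Suc M..N. 1 + z n) - (\<Sum>n=Suc M..N. z n)\<bar> \<le> 2 * (\<Sum>n=Suc M..N. (z n)\<^sup>2)"
    using z(3) by (intro abs_ln_prod_one_plus) auto
  also have "(\<Sum>n=Suc M..N. (z n)\<^sup>2) \<le> (\<Sum>n=Suc M..N. 4 * (1 / (real n)\<^sup>2))"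
  proof (rule sum_mono)
    fix n assume n: "n \<in> {Suc M..N}"
    have "\<bar>z n\<bar>\<^sup>2 \<le> (2 / real n)\<^sup>2" using z(2)[OF n] by (intro power_mono) auto
    thus "(z n)\<^sup>2 \<le> 4 * (1 / (real n)\<^sup>2)" by (simp add: power_divide)
  qed
  also have "\<dots> \<le> 4 * log_rate M"
    unfolding sum_distrib_left[symmetric] using sq by (intro mult_left_mono) auto
  finally have 1: "\<bar>ln (\<Prod>n=Suc M..N. 1 + z n) - (\<Sum>n=Suc M..N. z n)\<bar> \<le> 8 * log_rate M" by simp
  have "\<bar>(\<Sum>n=Suc M..N. z n) + 2 * c * (\<Sum>n=Suc M..N. y n * (1 / real n))\<bar>
      = \<bar>\<Sum>n=Suc M..N. z n + 2 * c * (y n * (1 / real n))\<bar>"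
    by (simp add: sum.distrib sum_distrib_left)
  also have "\<dots> \<le> (\<Sum>n=Suc M..N. \<bar>z n + 2 * c * (y n * (1 / real n))\<bar>)" by (rule sum_abs)
  also have "\<dots> \<le> (\<Sum>n=Suc M..N. (B + 1)\<^sup>2 * (1 / (real n)\<^sup>2))" by (intro sum_mono z(1))
  also have "\<dots> \<le> (B + 1)\<^sup>2 * log_rate M"
    unfolding sum_distrib_left[symmetric] using sq by (intro mult_left_mono) auto
  finally have 2: "\<bar>(\<Sum>n=Suc M..N. z n) + 2 * c * (\<Sum>n=Suc M..N. y n * (1 / real n))\<bar> \<le> (B + 1)\<^sup>2 * log_rate M" .
  have "\<bar>2 * c * (\<Sum>n=Suc M..N. y n * (1 / real n))\<bar> \<le> 2 * (2 * K0 * log_rate M)"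
    unfolding abs_mult using c sum_y_over_n[OF M1 M(2)] by (intro mult_mono) auto
  hence "\<bar>ln (\<Prod>n=Suc M..N. 1 + z n)\<bar> \<le> 8 * log_rate M + (B + 1)\<^sup>2 * log_rate M + 4 * K0 * log_rate M"
    using 1 2 by linarith
  thus ?thesis by (simp add: z_def tail_const_def algebra_simps)
qed

lemma tail_prod_pos:
  assumes "\<bar>x\<bar> \<le> B" "head B \<le> M"
  shows "(\<Prod>n=Suc M..N. f n x) > 0"
  using factor_ge_half(1)[OF assms(1)] assms(2) by (intro prod_pos) (force intro: less_le_trans[of 0 "1/2"])

lemma tail_const_pos: "tail_const B > 0"
  using K0 by (simp add: tail_const_def add_nonneg_pos)

lemma sum_ln_factor:
  assumes x: "\<bar>x\<bar> \<le> B"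
  shows "(\<Sum>i=k..<j. ln (f (i + Suc (head B)) x)) = ln (\<Prod>n=Suc (head B + k)..head B + j. f n x)"
proof -
  have "f n x \<noteq> 0" if "n \<in> {Suc (head B + k)..head B + j}" for n
    using factor_ge_half(1)[OF x, of n] that by auto
  hence "ln (\<Prod>n=Suc (head B + k)..head B + j. f n x) = (\<Sum>n=Suc (head B + k)..head B + j. ln (f n x))"
    by (intro ln_prod) auto
  also have "\<dots> = (\<Sum>i=k..<j. ln (f (i + Suc (head B)) x))"
    by (rule sum.reindex_bij_witness[of _ "\<lambda>i. i + Suc (head B)" "\<lambda>n. n - Suc (head B)"]) auto
  finally show ?thesis by simp
qed

lemma summable_tail_log:
  assumes x: "\<bar>x\<bar> \<le> B"
  shows "summable (\<lambda>i. ln (f (i + Suc (head B)) x))"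
proof (rule summable_Cauchy')
  show "\<forall>\<^sub>F m in sequentially. \<forall>n\<ge>m. norm (\<Sum>i=m..<n. ln (f (i + Suc (head B)) x)) \<le> tail_const B * log_rate (head B + m)"
    unfolding sum_ln_factor[OF x] using tail_prod_bound[OF x] by (intro always_eventually) auto
  show "(\<lambda>m. tail_const B * log_rate (head B + m)) \<longlonglongrightarrow> 0"
    using tendsto_mult[OF tendsto_const LIMSEQ_ignore_initial_segment[OF log_rate_tendsto, of "head B"], of "tail_const B"]
    by (simp add: add.commute)
qed

lemma tail_log_approx:
  assumes x: "\<bar>x\<bar> \<le> B" and N: "head B \<le> N"
  shows "\<bar>ln (\<Prod>n=Suc (head B)..N. f n x) - tail_log B x\<bar> \<le> tail_const B * log_rate N"
proof -
  define k where "k = N - head B"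
  have N': "N = head B + k" using N by (simp add: k_def)
  let ?g = "\<lambda>i. ln (f (i + Suc (head B)) x)"
  have lim: "(\<lambda>j. (\<Sum>i=0..<k. ?g i) - (\<Sum>i<j. ?g i)) \<longlonglongrightarrow> (\<Sum>i=0..<k. ?g i) - tail_log B x"
    unfolding tail_log_def by (intro tendsto_diff tendsto_const summable_LIMSEQ summable_tail_log[OF x])
  have "\<bar>(\<Sum>i=0..<k. ?g i) - tail_log B x\<bar> \<le> tail_const B * log_rate N"
  proof (rule LIMSEQ_le_const2[OF tendsto_rabs[OF lim]])
    show "\<exists>M. \<forall>j\<ge>M. \<bar>(\<Sum>i=0..<k. ?g i) - (\<Sum>i<j. ?g i)\<bar> \<le> tail_const B * log_rate N"
    proof (intro exI[of _ k] allI impI)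
      fix j assume j: "j \<ge> k"
      have "(\<Sum>i<j. ?g i) = (\<Sum>i=0..<k. ?g i) + (\<Sum>i=k..<j. ?g i)"
        using j by (simp only: lessThan_atLeast0 sum.atLeastLessThan_concat zero_le)
      hence "(\<Sum>i=0..<k. ?g i) - (\<Sum>i<j. ?g i) = - (\<Sum>i=k..<j. ?g i)" by simp
      thus "\<bar>(\<Sum>i=0..<k. ?g i) - (\<Sum>i<j. ?g i)\<bar> \<le> tail_const B * log_rate N"
        using tail_prod_bound[OF x, of N "head B + j"] j N' unfolding sum_ln_factor[OF x] by simp
    qed
  qed
  thus ?thesis unfolding sum_ln_factor[OF x] N' by simp
qed

lemma abs_tail_log:
  assumes "\<bar>x\<bar> \<le> B"
  shows "\<bar>tail_log B x\<bar> \<le> tail_const B * log_rate (head B)"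
  using tail_log_approx[OF assms, of "head B"] by simp

lemma uniform_limit_tail_prod:
  assumes U: "\<And>x. x \<in> U \<Longrightarrow> \<bar>x\<bar> \<le> B"
  shows "uniform_limit U (\<lambda>N x. \<Prod>n=Suc (head B)..N. \<bar>f n x\<bar>) (\<lambda>x. exp (tail_log B x)) sequentially"
proof (rule uniform_limitI)
  fix e :: real assume e: "e > 0"
  define R where "R = exp (tail_const B * log_rate (head B))"
  have R: "R > 0" by (simp add: R_def)
  have lim: "(\<lambda>N. tail_const B * log_rate N) \<longlonglongrightarrow> 0"
    using tendsto_mult[OF tendsto_const log_rate_tendsto, of "tail_const B"] by simp
  have "\<forall>\<^sub>F N in sequentially. tail_const B * log_rate N < min 1 (e / (2 * R))"
    using e R by (intro order_tendstoD(2)[OF lim]) auto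
  thus "\<forall>\<^sub>F N in sequentially. \<forall>x\<in>U. dist (\<Prod>n=Suc (head B)..N. \<bar>f n x\<bar>) (exp (tail_log B x)) < e"
    using eventually_ge_at_top[of "head B"]
  proof eventually_elim
    case (elim N)
    show ?case
    proof
      fix x assume "x \<in> U"
      hence x: "\<bar>x\<bar> \<le> B" by (rule U)
      define P where "P = (\<Prod>n=Suc (head B)..N. f n x)"
      have P: "P > 0" unfolding P_def by (rule tail_prod_pos[OF x]) simp
      have P': "(\<Prod>n=Suc (head B)..N. \<bar>f n x\<bar>) = P"
        using P unfolding P_def abs_prod[symmetric] by simp
      have d: "\<bar>ln P - tail_log B x\<bar> \<le> tail_const B * log_rate N"
        unfolding P_def by (rule tail_log_approx[OF x]) (use elim in auto)
      have "\<bar>exp (ln P) - exp (tail_log B x)\<bar> \<le> 2 * exp (tail_log B x) * \<bar>ln P - tail_log B x\<bar>"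
        using d elim by (intro abs_exp_diff_le) auto
      also have "\<dots> \<le> 2 * R * (tail_const B * log_rate N)"
        using d abs_tail_log[OF x] unfolding R_def by (intro mult_mono) auto
      also have "\<dots> < 2 * R * (e / (2 * R))"
        using elim R by (intro mult_strict_left_mono) auto
      also have "\<dots> = e" using R by simp
      finally show "dist (\<Prod>n=Suc (head B)..N. \<bar>f n x\<bar>) (exp (tail_log B x)) < e"
        using P by (simp add: P' dist_real_def)
    qed
  qed
qed

lemma locally_uniformly_convergent_factors:
  "locally_uniformly_convergent_prod (\<lambda>n x. \<bar>f (Suc n) x\<bar>)"
  unfolding locally_uniformly_convergent_prod_def
proof
  fix x0 :: real
  define B where "B = \<bar>x0\<bar> + 1"
  have ul: "uniform_limit {-B<..<B} (\<lambda>N x. \<Prod>n=Suc (head B)..N. \<bar>f n x\<bar>) (\<lambda>x. exp (tail_log B x)) sequentially"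
    by (rule uniform_limit_tail_prod) auto
  have "uniform_limit {-B<..<B} (\<lambda>N x. \<Prod>n=Suc (head B)..N + Suc (head B). \<bar>f n x\<bar>) (\<lambda>x. exp (tail_log B x)) sequentially"
    using filterlim_compose[OF ul filterlim_add_const_nat_at_top] .
  moreover have "(\<Prod>n=Suc (head B)..N + Suc (head B). \<bar>f n x\<bar>) = (\<Prod>n\<le>N. \<bar>f (Suc (n + head B)) x\<bar>)" for N x
    by (rule prod.reindex_bij_witness[of _ "\<lambda>i. Suc (i + head B)" "\<lambda>n. n - Suc (head B)"]) auto
  ultimately have "uniform_limit {-B<..<B} (\<lambda>N x. \<Prod>n\<le>N. \<bar>f (Suc (n + head B)) x\<bar>) (\<lambda>x. exp (tail_log B x)) sequentially"
    by simp
  \<comment> \<open>The shift is \<open>head B\<close> and not \<open>Suc (head B)\<close>, since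
    the family itself starts with the factor of index 1.\<close>
  thus "\<exists>U M g. open U \<and> x0 \<in> U \<and> (\<forall>y\<in>U. g y \<noteq> 0) \<and>
        uniform_limit U (\<lambda>N y. \<Prod>n\<le>N. \<bar>f (Suc (n + M)) y\<bar>) g sequentially"
    by (intro exI[of _ "{-B<..<B}"] exI[of _ "head B"] exI[of _ "\<lambda>x. exp (tail_log B x)"]) (auto simp: B_def)
qed

lemma split_prod:
  assumes "N \<ge> head B"
  shows "(\<Prod>n=1..N. \<bar>f n x\<bar>) = (\<Prod>n=1..head B. \<bar>f n x\<bar>) * (\<Prod>n=Suc (head B)..N. \<bar>f n x\<bar>)"
  using prod.ub_add_nat[of 1 "head B" "\<lambda>n. \<bar>f n x\<bar>" "N - head B"] assms by simp

lemma continuous_factor: "continuous_on S (\<lambda>x. f n x)"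
  unfolding sudler_factor_def by (cases "n = 0") (auto intro!: continuous_intros)

lemma uniform_limit_prod:
  assumes U: "\<And>x. x \<in> U \<Longrightarrow> \<bar>x\<bar> \<le> B"
  shows "uniform_limit U (\<lambda>N x. \<Prod>n=1..N. \<bar>f n x\<bar>)
           (\<lambda>x. (\<Prod>n=1..head B. \<bar>f n x\<bar>) * exp (tail_log B x)) sequentially"
proof -
  \<comment> \<open>Uniform convergence passes to the product of head and tail because both limits
    are bounded; for the head this follows from compactness.\<close>
  have "continuous_on {-B..B} (\<lambda>x. \<Prod>n=1..head B. \<bar>f n x\<bar>)"
    by (intro continuous_intros continuous_factor)
  hence "compact ((\<lambda>x. \<Prod>n=1..head B. \<bar>f n x\<bar>) ` {-B..B})"
    by (intro compact_continuous_image) auto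
  hence b1: "bounded ((\<lambda>x. \<Prod>n=1..head B. \<bar>f n x\<bar>) ` U)"
    by (rule bounded_subset[OF compact_imp_bounded]) (use U in \<open>force simp: abs_le_iff\<close>)
  have b2: "bounded ((\<lambda>x. exp (tail_log B x)) ` U)"
    unfolding bounded_iff
  proof (intro exI[of _ "exp (tail_const B * log_rate (head B))"] ballI)
    fix z assume "z \<in> (\<lambda>x. exp (tail_log B x)) ` U"
    then obtain x where "x \<in> U" "z = exp (tail_log B x)" by blast
    thus "norm z \<le> exp (tail_const B * log_rate (head B))"
      using abs_tail_log[OF U, of x] by simp
  qed
  have "uniform_limit U (\<lambda>N x. (\<Prod>n=1..head B. \<bar>f n x\<bar>) * (\<Prod>n=Suc (head B)..N. \<bar>f n x\<bar>))
           (\<lambda>x. (\<Prod>n=1..head B. \<bar>f n x\<bar>) * exp (tail_log B x)) sequentially"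
    by (intro uniform_lim_mult uniform_limit_const uniform_limit_tail_prod b1 b2 U)
  thus ?thesis
    by (rule uniform_limit_cong[THEN iffD2, rotated 2])
       (auto intro!: eventually_mono[OF eventually_ge_at_top[of "head B"]] split_prod[unfolded One_nat_def])
qed

lemma prodinf_factor:
  assumes x: "\<bar>x\<bar> \<le> B"
  shows "(\<Prod>n. \<bar>f (Suc n) x\<bar>) = (\<Prod>n=1..head B. \<bar>f n x\<bar>) * exp (tail_log B x)"
proof -
  obtain U M g where U: "x \<in> U" "\<And>y. y \<in> U \<Longrightarrow> g y \<noteq> 0"
     "uniform_limit U (\<lambda>N y. \<Prod>n\<le>N. \<bar>f (Suc (n + M)) y\<bar>) g sequentially"
    using locally_uniformly_convergent_factors unfolding locally_uniformly_convergent_prod_def by metis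
  \<comment> \<open>Finitely many factors may vanish at \<open>x\<close>. Beyond the first
    \<open>M\<close> of them the partial products have a nonzero limit, which is what
    \<open>convergent_prod\<close> asks for.\<close>
  have "raw_has_prod (\<lambda>n. \<bar>f (Suc n) x\<bar>) M (g x)"
    unfolding raw_has_prod_def using tendsto_uniform_limitI[OF U(3,1)] U(1,2) by auto
  hence "convergent_prod (\<lambda>n. \<bar>f (Suc n) x\<bar>)" unfolding convergent_prod_def by blast
  hence "(\<lambda>N. \<Prod>n\<le>N. \<bar>f (Suc n) x\<bar>) \<longlonglongrightarrow> (\<Prod>n. \<bar>f (Suc n) x\<bar>)"
    by (rule convergent_prod_LIMSEQ)
  moreover have "(\<Prod>n\<le>N. \<bar>f (Suc n) x\<bar>) = (\<Prod>n=1..Suc N. \<bar>f n x\<bar>)" for N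
    by (rule prod.reindex_bij_witness[of _ "\<lambda>n. n - 1" Suc]) auto
  moreover have "(\<lambda>N. \<Prod>n=1..Suc N. \<bar>f n x\<bar>) \<longlonglongrightarrow> (\<Prod>n=1..head B. \<bar>f n x\<bar>) * exp (tail_log B x)"
    using tendsto_uniform_limitI[OF uniform_limit_prod[of "{x}" B], of x] x
    by (subst filterlim_sequentially_Suc) auto
  ultimately show ?thesis using LIMSEQ_unique by simp
qed

lemma locally_uniform_limit_prod:
  "locally_uniform_limit (\<lambda>N x. \<Prod>n=1..N. \<bar>f n x\<bar>) (\<lambda>x. \<Prod>n. \<bar>f (Suc n) x\<bar>) sequentially"
  unfolding locally_uniform_limit_def
proof
  fix x0 :: real
  define B where "B = \<bar>x0\<bar> + 1"
  have "uniform_limit {-B<..<B} (\<lambda>N x. \<Prod>n=1..N. \<bar>f n x\<bar>) (\<lambda>x. (\<Prod>n=1..head B. \<bar>f n x\<bar>) * exp (tail_log B x)) sequentially"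
    by (rule uniform_limit_prod) auto
  also have "?this \<longleftrightarrow> uniform_limit {-B<..<B} (\<lambda>N x. \<Prod>n=1..N. \<bar>f n x\<bar>) (\<lambda>x. \<Prod>n. \<bar>f (Suc n) x\<bar>) sequentially"
    by (rule uniform_limit_cong') (auto simp: prodinf_factor[of _ B])
  finally show "\<exists>U. open U \<and> x0 \<in> U \<and> uniform_limit U (\<lambda>N x. \<Prod>n=1..N. \<bar>f n x\<bar>) (\<lambda>x. \<Prod>n. \<bar>f (Suc n) x\<bar>) sequentially"
    by (intro exI[of _ "{-B<..<B}"]) (auto simp: B_def)
qed

section \<open>Regularity of the limit function\<close>

definition G :: "real \<Rightarrow> real" where
  "G x = 2 * pi * \<bar>x + c\<bar> * (\<Prod>n. \<bar>f (Suc n) x\<bar>)"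

text \<open>On \<open>\<bar>x\<bar> \<le> B\<close> all zeros come from the polynomial between the
  bars; the remaining exponential is positive.\<close>

lemma G_eq:
  assumes "\<bar>x\<bar> \<le> B"
  shows "G x = (2 * pi * \<bar>(x + c) * (\<Prod>n=1..head B. f n x)\<bar>) * exp (tail_log B x)"
  unfolding G_def prodinf_factor[OF assms] by (simp add: abs_mult abs_prod)

lemma factor_derivative:
  "(f n has_real_derivative - 2 * (x + c/2) * inverse ((real n)\<^sup>2)) (at x within S)"
proof -
  define A where "A = (1 - c * (y n / real n))\<^sup>2"
  have "((\<lambda>x. A - (x + c/2)\<^sup>2 * inverse ((real n)\<^sup>2)) has_real_derivative
      - 2 * (x + c/2) * inverse ((real n)\<^sup>2)) (at x within S)"
    by (auto intro!: derivative_eq_intros simp: algebra_simps)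
  moreover have "f n = (\<lambda>x. A - (x + c/2)\<^sup>2 * inverse ((real n)\<^sup>2))"
    unfolding sudler_factor_def A_def divide_inverse[of "_\<^sup>2"] by (rule ext) (rule refl)
  ultimately show ?thesis by (simp only:)
qed

lemma C1_factor: "f n C1_differentiable_on S"
  unfolding C1_differentiable_on_def
proof (intro exI[of _ "\<lambda>x. - 2 * (x + c/2) * inverse ((real n)\<^sup>2)"] conjI ballI)
  show "(f n has_vector_derivative - 2 * (x + c/2) * inverse ((real n)\<^sup>2)) (at x)" for x
    unfolding has_real_derivative_iff_has_vector_derivative[symmetric] by (rule factor_derivative)
qed (intro continuous_intros)

text \<open>The fractional parts do not depend on \<open>x\<close>, so differentiating a logarithm
  leaves only a term of order \<open>1/n^2\<close>. The differentiated series thus passes the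
  Weierstrass test, while convergence of the series itself rests on cancellation.\<close>

lemma C1_exp_tail_log: "(\<lambda>x. exp (tail_log B x)) C1_differentiable_on {-B<..<B}"
proof -
  define S where "S = {-B<..<B}"
  have S: "\<bar>x\<bar> \<le> B" if "x \<in> S" for x using that by (auto simp: S_def)
  define g where "g i x = ln (f (i + Suc (head B)) x)" for i x
  define g' where "g' i x = (- 2 * (x + c/2) * inverse ((real (i + Suc (head B)))\<^sup>2)) / f (i + Suc (head B)) x" for i x
  have fh: "f (i + Suc (head B)) x \<ge> 1/2" if "x \<in> S" for i x
    using factor_ge_half(1)[OF S[OF that]] by simp
  have der: "(g i has_real_derivative g' i x) (at x within S)" if "x \<in> S" for i x
    unfolding g_def g'_def using fh[OF that, of i]
    by (auto intro!: derivative_eq_intros factor_derivative)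
  \<comment> \<open>The constant is \<open>2 * (B + 1) * 2\<close>, the last 2 bounding
    \<open>1 / f\<close>; the denominator shrinks from \<open>i + Suc (head B)\<close> to
    \<open>Suc i\<close>.\<close>
  have bd: "norm (g' i x) \<le> (4 * (B + 1)) * (1 / (real (Suc i))\<^sup>2)" if "x \<in> S" for i x
  proof -
    have "\<bar>g' i x\<bar> = (2 * \<bar>x + c/2\<bar>) * (1 / (real (i + Suc (head B)))\<^sup>2) * (1 / f (i + Suc (head B)) x)"
      unfolding g'_def abs_divide abs_mult using fh[OF that, of i] by (simp add: inverse_eq_divide)
    also have "\<dots> \<le> (2 * (B + 1)) * (1 / (real (Suc i))\<^sup>2) * 2"
    proof (intro mult_mono)
      show "1 / f (i + Suc (head B)) x \<le> 2"
        using fh[OF that, of i] by (subst pos_divide_le_eq) auto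
      show "1 / (real (i + Suc (head B)))\<^sup>2 \<le> 1 / (real (Suc i))\<^sup>2"
        by (intro divide_left_mono power_mono) auto
      show w: "\<bar>x + c/2\<bar> \<le> B + 1" using S[OF that] c by linarith
      have "0 \<le> B + 1" using S[OF that] by linarith
      thus "0 \<le> 2 * (B + 1)" "0 \<le> 2 * (B + 1) * (1 / (real (Suc i))\<^sup>2)" by simp_all
      show "0 \<le> 1 / f (i + Suc (head B)) x" using fh[OF that, of i] by simp
    qed simp_all
    finally show ?thesis by simp
  qed
  have sm: "summable (\<lambda>i. (4 * (B + 1)) * (1 / (real (Suc i))\<^sup>2))"
  proof (rule summable_mult)
    have "summable (\<lambda>i. 1 / (real i)\<^sup>2)"
      using inverse_power_summable[of 2, where ?'a = real] by (simp add: inverse_eq_divide)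
    thus "summable (\<lambda>i. 1 / (real (Suc i))\<^sup>2)"
      by (simp only: summable_Suc_iff[of "\<lambda>i. 1 / (real i)\<^sup>2"])
  qed
  have ul: "uniform_limit S (\<lambda>n x. \<Sum>i<n. g' i x) (\<lambda>x. \<Sum>i. g' i x) sequentially"
    using bd sm by (rule Weierstrass_m_test)
  have cont: "continuous_on S (\<lambda>x. \<Sum>i. g' i x)"
  proof (rule uniform_limit_theorem[OF _ ul])
    have "continuous_on S (g' i)" for i
    proof -
      have "\<forall>x\<in>S. f (i + Suc (head B)) x \<noteq> 0" using fh[of _ i] by fastforce
      thus ?thesis unfolding g'_def[abs_def] by (intro continuous_intros continuous_factor)
    qed
    thus "\<forall>\<^sub>F n in sequentially. continuous_on S (\<lambda>x. \<Sum>i<n. g' i x)"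
      by (intro always_eventually allI continuous_intros)
  qed auto
  have D: "(tail_log B has_real_derivative (\<Sum>i. g' i x)) (at x)" if x: "x \<in> S" for x
  proof -
    have "((\<lambda>x. \<Sum>i. g i x) has_real_derivative (\<Sum>i. g' i x)) (at x)"
    proof (rule has_field_derivative_series'(2)[OF _ der _ x])
      show "convex S" by (simp add: S_def)
      show "uniformly_convergent_on S (\<lambda>n x. \<Sum>i<n. g' i x)"
        using ul unfolding uniformly_convergent_on_def by blast
      show "summable (\<lambda>n. g n x)" unfolding g_def by (rule summable_tail_log[OF S[OF x]])
      show "x \<in> interior S" using x by (simp add: S_def)
    qed
    thus ?thesis by (simp add: g_def tail_log_def[abs_def])
  qed
  have "((\<lambda>x. exp (tail_log B x)) has_real_derivative exp (tail_log B x) * (\<Sum>i. g' i x)) (at x)" if "x \<in> S" for x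
    using D[OF that] by (auto intro!: derivative_eq_intros)
  moreover have "continuous_on S (\<lambda>x. exp (tail_log B x) * (\<Sum>i. g' i x))"
  proof -
    have "continuous_on S (tail_log B)"
      by (rule DERIV_continuous_on[of S "tail_log B" "\<lambda>x. \<Sum>i. g' i x"])
         (rule has_field_derivative_at_within[OF D])
    thus ?thesis by (intro continuous_on_mult continuous_on_exp cont)
  qed
  ultimately show ?thesis
    unfolding C1_differentiable_on_def S_def[symmetric] has_real_derivative_iff_has_vector_derivative
    by (intro exI[of _ "\<lambda>x. exp (tail_log B x) * (\<Sum>i. g' i x)"]) simp
qed

lemma continuous_G: "continuous_on S G"
proof -
  have "isCont G x0" for x0
  proof -
    define B where "B = \<bar>x0\<bar> + 1"
    have "continuous_on {-B<..<B} (\<lambda>x. (2 * pi * \<bar>(x + c) * (\<Prod>n=1..head B. f n x)\<bar>) * exp (tail_log B x))"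
      by (intro continuous_intros continuous_factor
          differentiable_imp_continuous_on[OF C1_diff_imp_diff[OF C1_exp_tail_log]])
    also have "?this \<longleftrightarrow> continuous_on {-B<..<B} G"
      by (rule continuous_on_cong) (auto simp: G_eq[of _ B])
    finally show ?thesis
      by (rule continuous_on_interior) (auto simp: B_def)
  qed
  thus ?thesis using continuous_at_imp_continuous_on by blast
qed

text \<open>Near a point where \<open>G\<close> is nonzero the polynomial head \<open>h\<close>
  keeps its sign, so \<open>\<bar>h\<bar>\<close> equals \<open>sgn (h x0) * h\<close> and the
  absolute value disappears from the formula.\<close>

lemma C1_G: "G C1_differentiable_on {x. G x \<noteq> 0}"
proof (rule C1_differentiable_on_locally)
  fix x0 assume x0: "x0 \<in> {x. G x \<noteq> 0}"
  define B where "B = \<bar>x0\<bar> + 1"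
  define h where "h x = (x + c) * (\<Prod>n=1..head B. f n x)" for x
  define U where "U = {-B<..<B} \<inter> {x. sgn (h x0) * h x > 0}"
  have G: "G x = (2 * pi * \<bar>h x\<bar>) * exp (tail_log B x)" if "\<bar>x\<bar> \<le> B" for x
    using G_eq[OF that] by (simp add: h_def)
  have h0: "h x0 \<noteq> 0" using x0 G[of x0] by (auto simp: B_def)
  have conth: "continuous_on UNIV h"
    unfolding h_def by (intro continuous_intros continuous_factor)
  have "open U"
    unfolding U_def by (intro open_Int open_greaterThanLessThan open_Collect_less continuous_intros continuous_on_subset[OF conth]) auto
  moreover have "x0 \<in> U" using h0 by (auto simp: U_def B_def sgn_if)
  moreover have "(\<lambda>x. (2 * pi * (sgn (h x0) * h x)) * exp (tail_log B x)) C1_differentiable_on U"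
  proof (intro C1_differentiable_on_mult C1_differentiable_on_const)
    show "h C1_differentiable_on U"
      unfolding h_def
      by (intro C1_differentiable_on_mult C1_differentiable_on_add C1_differentiable_on_ident
          C1_differentiable_on_const C1_differentiable_on_prod C1_factor)
    show "(\<lambda>x. exp (tail_log B x)) C1_differentiable_on U"
      by (rule C1_differentiable_on_subset[OF C1_exp_tail_log]) (auto simp: U_def)
  qed
  moreover have "G y = (2 * pi * (sgn (h x0) * h y)) * exp (tail_log B y)" if "y \<in> U" for y
  proof -
    have "\<bar>h y\<bar> = sgn (h x0) * h y" using that h0 by (auto simp: U_def sgn_if split: if_splits)
    moreover have "\<bar>y\<bar> \<le> B" using that by (auto simp: U_def abs_le_iff)
    ultimately show ?thesis using G[of y] by simp
  qed
  ultimately show "\<exists>U g. open U \<and> x0 \<in> U \<and> g C1_differentiable_on U \<and> (\<forall>y\<in>U. G y = g y)"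
    by (intro exI[of _ U] exI[of _ "\<lambda>x. (2 * pi * (sgn (h x0) * h x)) * exp (tail_log B x)"]) blast
qed

lemma open_G_nonzero: "open {x. G x \<noteq> 0}"
  by (intro open_Collect_neq continuous_G continuous_on_const)

end

section \<open>Splitting the product\<close>

lemma sin_ge_mult_cos:
  assumes "0 \<le> z" "z \<le> pi"
  shows "z * cos z \<le> sin z"
proof -
  have "sin 0 - 0 * cos 0 \<le> sin z - z * cos z"
  proof (rule DERIV_nonneg_imp_nondecreasing[OF assms(1)])
    fix t assume t: "0 \<le> t" "t \<le> z"
    have "((\<lambda>z. sin z - z * cos z) has_real_derivative t * sin t) (at t)"
      by (auto intro!: derivative_eq_intros)
    moreover have "t * sin t \<ge> 0" using t assms by (intro mult_nonneg_nonneg sin_ge_zero) auto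
    ultimately show "\<exists>y. ((\<lambda>z. sin z - z * cos z) has_real_derivative y) (at t) \<and> 0 \<le> y" by blast
  qed
  thus ?thesis by simp
qed

text \<open>The second bound is the first one at \<open>pi - z\<close>. Each controls the cotangent
  near one of its two poles, which are the two ends of the range of \<open>h\<close>.\<close>

lemma cot_bounds:
  assumes "0 < z" "z < pi"
  shows "cot z \<le> 1 / z" "- (1 / (pi - z)) \<le> cot z"
proof -
  have s: "sin z > 0" using assms by (intro sin_gt_zero)
  show "cot z \<le> 1 / z"
    using sin_ge_mult_cos[of z] assms s by (simp add: cot_def field_simps)
  have "(pi - z) * (- cos z) \<le> sin z"
    using sin_ge_mult_cos[of "pi - z"] assms by simp
  thus "- (1 / (pi - z)) \<le> cot z"
    using assms s by (simp add: cot_def field_simps)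
qed

lemma cot_square_le:
  assumes "0 < z" "z < pi"
  shows "(cot z)\<^sup>2 \<le> (1 / z)\<^sup>2 + (1 / (pi - z))\<^sup>2"
proof (cases "cot z \<ge> 0")
  case True
  hence "(cot z)\<^sup>2 \<le> (1 / z)\<^sup>2" using cot_bounds(1)[OF assms] by (intro power_mono) auto
  thus ?thesis by (meson add_increasing2 zero_le_power2)
next
  case False
  hence "(- cot z)\<^sup>2 \<le> (1 / (pi - z))\<^sup>2" using cot_bounds(2)[OF assms] by (intro power_mono) auto
  thus ?thesis by (simp add: add_increasing)
qed

lemma cot_antimono:
  assumes "0 < z" "z \<le> z'" "z' < pi"
  shows "cot z' \<le> cot z"
proof -
  have "- cot z \<le> - cot z'"
  proof (rule DERIV_nonneg_imp_nondecreasing[OF assms(2)])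
    fix t assume t: "z \<le> t" "t \<le> z'"
    hence "sin t \<noteq> 0" using assms sin_gt_zero[of t] by auto
    hence "((\<lambda>z. - cot z) has_real_derivative inverse ((sin t)\<^sup>2)) (at t)"
      using DERIV_minus[OF DERIV_cot] by fastforce
    thus "\<exists>y. ((\<lambda>z. - cot z) has_real_derivative y) (at t) \<and> 0 \<le> y" by auto
  qed
  thus ?thesis by simp
qed

text \<open>The value 1 at 0 keeps \<open>sin z = z * sinc z\<close> valid everywhere. Perturbed
  arguments may vanish, and the zero then sits in the factor \<open>z\<close>.\<close>

definition sinc :: "real \<Rightarrow> real" where "sinc z = (if z = 0 then 1 else sin z / z)"

lemma sin_eq_sinc: "sin z = z * sinc z"
  by (simp add: sinc_def)

lemma abs_sin_diff_le: "\<bar>sin z - z\<bar> \<le> \<bar>z\<bar> ^ 3 / (6::real)"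
  using Maclaurin_sin_bound[of z 3] by (simp add: sin_coeff_def numeral_3_eq_3 fact_numeral)

lemma sinc_bounds:
  assumes "\<bar>z\<bar> \<le> 1/2"
  shows "1 - z\<^sup>2 \<le> sinc z" "sinc z \<le> 1" "1/2 \<le> sinc z"
proof -
  show 1: "1 - z\<^sup>2 \<le> sinc z"
  proof (cases "z = 0")
    case False
    have "\<bar>sinc z - 1\<bar> = \<bar>sin z - z\<bar> / \<bar>z\<bar>"
      using False by (simp add: sinc_def divide_simps flip: abs_divide)
    also have "\<dots> \<le> (\<bar>z\<bar> ^ 3 / 6) / \<bar>z\<bar>" using abs_sin_diff_le by (intro divide_right_mono) auto
    also have "\<dots> = z\<^sup>2 / 6" using False by (simp add: power3_eq_cube power2_eq_square)
    also have "\<dots> \<le> z\<^sup>2" by simp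
    finally show ?thesis by linarith
  qed (simp add: sinc_def)
  have "\<bar>z\<bar>\<^sup>2 \<le> (1/2)\<^sup>2" using assms by (intro power_mono) auto
  hence "z\<^sup>2 \<le> 1/4" by (simp add: power2_eq_square)
  thus "1/2 \<le> sinc z" using 1 by linarith
  show "sinc z \<le> 1"
  proof (cases "z = 0")
    case False
    have "\<bar>sin z\<bar> \<le> \<bar>z\<bar>" by (rule abs_sin_x_le_abs_x)
    hence "\<bar>sin z / z\<bar> \<le> 1" using False by (simp add: abs_divide)
    hence "sin z / z \<le> 1" by (rule abs_le_D1)
    thus ?thesis using False by (simp add: sinc_def)
  qed (simp add: sinc_def)
qed

lemma abs_ln_sinc_le:
  assumes "\<bar>z\<bar> \<le> 1/2"
  shows "\<bar>ln (sinc z)\<bar> \<le> 2 * z\<^sup>2"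
proof -
  define t where "t = 1 - sinc z"
  have t: "0 \<le> t" "t \<le> z\<^sup>2" "t \<le> 1/2" using sinc_bounds[OF assms] by (auto simp: t_def)
  have s: "sinc z > 0" using sinc_bounds(3)[OF assms] by linarith
  have "ln (inverse (sinc z)) \<le> inverse (sinc z) - 1" using s by (intro ln_le_minus_one) auto
  moreover have "ln (inverse (sinc z)) = - ln (sinc z)" by (simp add: ln_inverse)
  moreover have "inverse (sinc z) - 1 = t * inverse (sinc z)"
    using s by (simp add: t_def field_simps)
  moreover have "t * inverse (sinc z) \<le> t * 2"
  proof -
    have "inverse (sinc z) \<le> inverse (1/2)" using sinc_bounds(3)[OF assms] by (intro le_imp_inverse_le) auto
    thus ?thesis using t by (intro mult_left_mono) auto
  qed
  moreover have "ln (sinc z) \<le> 0" using sinc_bounds(2)[OF assms] s by simp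
  ultimately show ?thesis using t by linarith
qed

text \<open>The leading factor belongs to \<open>n = q\<close>, that is to \<open>h = 0\<close>
  modulo \<open>q\<close>. The index \<open>k\<close> survives only through \<open>q\<close>,
  \<open>q'\<close> and \<open>c\<close>.\<close>

definition sudler_product :: "nat \<Rightarrow> int \<Rightarrow> real \<Rightarrow> real \<Rightarrow> real" where
  "sudler_product q q' c x = \<bar>2 * sin (pi * ((c + x) / real q))\<bar> *
     (\<Prod>h=1..<q. \<bar>2 * sin (pi * ((real h - c * frac (real h * (real_of_int q' / real q)) - x) / real q))\<bar>)"

text \<open>Purposes of the bounds on \<open>H\<close> and \<open>q\<close>:
  \<open>2 * H < q\<close> separates the pairs \<open>h, q - h\<close> from the middle;
  \<open>8 * (B + 1) \<le> H\<close> gives \<open>\<bar>t h * X h\<bar> \<le> 1/8\<close> there; the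
  bound with \<open>pi\<close> keeps arguments of \<open>sinc\<close> within 1/2;
  \<open>K1 * H < q\<close> makes the floors of \<open>h \<gamma>\<close> and
  \<open>h \<beta>\<close> agree; the last one brings the relative errors \<open>\<zeta> h\<close>
  down to 1/4.\<close>

locale sudler_finite = sudler_limit +
  fixes q :: nat and q' :: int and ck K1 B x :: real and H :: nat
  assumes cop: "coprime q' (int q)" and ck: "0 < ck" "ck \<le> 1" and K1: "0 \<le> K1"
    and ck_c: "\<bar>ck - c\<bar> \<le> K1 / (real q)\<^sup>2"
    and gamma_beta: "\<bar>real_of_int q' / real q - \<beta>\<bar> \<le> K1 / (real q)\<^sup>2"
    and disc': "\<And>N. 1 \<le> N \<Longrightarrow> N < q \<Longrightarrow>
        \<bar>\<Sum>n=1..N. frac (real n * (real_of_int q' / real q)) - 1/2\<bar> \<le> K1 * (1 + ln (real N))"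
    and x: "\<bar>x\<bar> \<le> B"
    and H: "head B \<le> H" "2 * H < q" "8 * (B + 1) \<le> real H" "pi * (real H + B + 1) \<le> real q / 2"
      "K1 * real H < real q" "8 * (K1 * (B + 7)) \<le> (real q)\<^sup>2"
begin

definition "\<gamma> = real_of_int q' / real q"
definition "u h = frac (real h * \<gamma>) - 1/2"
text \<open>Result of centring: \<open>ck * frac (h \<gamma>) + x = ck * u h + w\<close>. Under
  \<open>h \<mapsto> q - h\<close> the first summand changes sign and \<open>w\<close> stays, which
  later produces a difference of squares.\<close>

definition "w = x + ck / 2"
definition "\<tau> h = ck * u h + w"
definition "\<rho> h = \<bar>sin (pi * ((real h - \<tau> h) / real q))\<bar> / sin (pi * (real h / real q))"
abbreviation "angle h \<equiv> pi * (real h / real q)"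
definition "F h = sudler_factor \<gamma> ck h x"

abbreviation "log_err \<equiv> (1 + ln (real q)) / real H"
abbreviation "cube_err \<equiv> (real H) ^ 3 / (real q)\<^sup>2"

lemma B0: "B \<ge> 0" using x by auto
lemma H8: "H \<ge> 8"
proof -
  have "8 * 1 \<le> 8 * (B + 1)" using B0 by simp
  from order.trans[OF this H(3)] show ?thesis by simp
qed

lemma q0: "real q > 0" using H(2) by simp
lemma abs_u: "\<bar>u h\<bar> \<le> 1/2"
  using frac_lt_1[of "real h * \<gamma>"] frac_ge_0[of "real h * \<gamma>"] unfolding u_def by linarith
lemma abs_w: "\<bar>w\<bar> \<le> B + 1/2" using x ck unfolding w_def by linarith
lemma abs_ck_u: "\<bar>ck * u h\<bar> \<le> 1/2"
proof -
  have "\<bar>ck * u h\<bar> \<le> 1 * (1/2)" unfolding abs_mult using ck abs_u by (intro mult_mono) auto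
  thus ?thesis by simp
qed
lemma abs_tau: "\<bar>\<tau> h\<bar> \<le> B + 1" using abs_ck_u[of h] abs_w unfolding \<tau>_def by linarith

lemma H_le_q: "real H \<le> real q" using H(2) by linarith
lemma ln_q: "ln (real q) \<ge> 0" using H(2) H8 by simp

text \<open>As \<open>q'\<close> is prime to \<open>q\<close>, the multiples of \<open>q'/q\<close>
  in question are nonzero residues over \<open>q\<close> and keep distance \<open>1/q\<close> from
  the integers. This gap absorbs the change of slope in \<open>u_near_y\<close>.\<close>

lemma frac_gamma:
  assumes "1 \<le> h" "h < q"
  shows "frac (real h * \<gamma>) \<ge> 1 / real q" "frac (real h * \<gamma>) \<le> 1 - 1 / real q"
    "real h * \<gamma> \<notin> \<int>"
proof -
  define m where "m = (int h * q') mod int q"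
  have "\<not> int q dvd int h * q'"
    using cop assms by (auto simp: coprime_commute coprime_dvd_mult_left_iff zdvd_not_zless)
  hence m: "1 \<le> m" "m \<le> int q - 1"
    using q0 pos_mod_bound[of "int q" "int h * q'"] pos_mod_sign[of "int q" "int h * q'"]
    unfolding m_def dvd_eq_mod_eq_0 by linarith+
  have fr: "frac (real h * \<gamma>) = real_of_int m / real q"
    using frac_of_int_divide[of q "int h * q'"] q0 by (simp add: \<gamma>_def m_def)
  have "real_of_int m / real q \<ge> 1 / real q" "real_of_int m / real q \<le> 1 - 1 / real q"
    using m q0 by (auto simp: field_simps)
  thus "frac (real h * \<gamma>) \<ge> 1 / real q" "frac (real h * \<gamma>) \<le> 1 - 1 / real q"
    unfolding fr by auto
  moreover have "1 / real q > 0" using q0 by simp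
  ultimately have "frac (real h * \<gamma>) \<noteq> 0" by linarith
  thus "real h * \<gamma> \<notin> \<int>" by simp
qed

lemma u_reflect:
  assumes "1 \<le> h" "h < q"
  shows "u (q - h) = - u h"
proof -
  have "real (q - h) * \<gamma> = real_of_int q' + (- (real h * \<gamma>))"
    using assms q0 by (simp add: of_nat_diff \<gamma>_def field_simps)
  hence "frac (real (q - h) * \<gamma>) = frac (- (real h * \<gamma>))"
    by (simp only: frac_add_of_int_left)
  thus ?thesis using frac_gamma(3)[OF assms] by (simp add: u_def frac_neg)
qed

lemma sin_pos:
  assumes "1 \<le> h" "h < q"
  shows "sin (angle h) > 0"
proof (rule sin_gt_zero)
  show "angle h < pi"
    using assms q0 mult_strict_left_mono[of "real h / real q" 1 pi] by simp
qed (use assms q0 in simp)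

text \<open>Normalising by the unperturbed sines costs the factor \<open>q\<close>, by
  \<open>prod_two_sin\<close>; it compensates the \<open>1/q\<close> inside the separated
  sine.\<close>

lemma product_eq:
  "sudler_product q q' ck x = \<bar>2 * sin (pi * ((ck + x) / real q))\<bar> * real q * (\<Prod>h=1..<q. \<rho> h)"
proof -
  have "(\<Prod>h=1..<q. \<bar>2 * sin (pi * ((real h - ck * frac (real h * (real_of_int q' / real q)) - x) / real q))\<bar>)
      = (\<Prod>h=1..<q. (2 * sin (pi * real h / real q)) * \<rho> h)"
  proof (rule prod.cong[OF refl])
    fix h assume h: "h \<in> {1..<q}"
    have e: "real h - ck * frac (real h * (real_of_int q' / real q)) - x = real h - \<tau> h"
      by (simp add: \<tau>_def u_def w_def \<gamma>_def algebra_simps)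
    show "\<bar>2 * sin (pi * ((real h - ck * frac (real h * (real_of_int q' / real q)) - x) / real q))\<bar>
        = (2 * sin (pi * real h / real q)) * \<rho> h"
      unfolding e using sin_pos[of h] h by (simp add: abs_mult \<rho>_def)
  qed
  also have "\<dots> = real q * (\<Prod>h=1..<q. \<rho> h)"
    using prod_two_sin[of q] q0 prod.distrib[of "\<lambda>h. 2 * sin (pi * real h / real q)" \<rho> "{1..<q}"]
    by simp
  finally show ?thesis unfolding sudler_product_def by simp
qed

lemma prod_rho_split:
  "(\<Prod>h=1..<q. \<rho> h) = (\<Prod>h=1..H. \<rho> h * \<rho> (q - h)) * (\<Prod>h=Suc H..<q - H. \<rho> h)"
proof -
  have "(\<Prod>h=1..<q. \<rho> h) = (\<Prod>h=1..<Suc H. \<rho> h) * (\<Prod>h=Suc H..<q - H. \<rho> h) * (\<Prod>h=q - H..<q. \<rho> h)"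
  proof -
    have "(\<Prod>h=1..<Suc H. \<rho> h) * (\<Prod>h=Suc H..<q - H. \<rho> h) = (\<Prod>h=1..<q - H. \<rho> h)"
      by (rule prod.atLeastLessThan_concat) (use H(2) in auto)
    moreover have "(\<Prod>h=1..<q - H. \<rho> h) * (\<Prod>h=q - H..<q. \<rho> h) = (\<Prod>h=1..<q. \<rho> h)"
      by (rule prod.atLeastLessThan_concat) (use H(2) in auto)
    ultimately show ?thesis by simp
  qed
  also have "(\<Prod>h=q - H..<q. \<rho> h) = (\<Prod>h=1..H. \<rho> (q - h))"
    by (rule prod.reindex_bij_witness[of _ "\<lambda>h. q - h" "\<lambda>h. q - h"]) (use H(2) in auto)
  also have "{1..<Suc H} = {1..H}" by auto
  finally show ?thesis by (simp add: prod.distrib mult_ac)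
qed

text \<open>What remains of a pair of sine ratios once the arguments themselves are split off into
  \<open>F h\<close>.\<close>

definition "R h = sinc (pi * ((real h - \<tau> h) / real q)) * sinc (pi * ((real h - ck * u h + w) / real q))
                    / (sinc (angle h))\<^sup>2"

lemma sinc_arguments:
  assumes "1 \<le> h" "h \<le> H" "\<bar>v - real h\<bar> \<le> B + 1"
  shows "\<bar>pi * (v / real q)\<bar> \<le> 1/2" "(pi * (v / real q))\<^sup>2 \<le> pi\<^sup>2 * (B + 2)\<^sup>2 * (real H)\<^sup>2 / (real q)\<^sup>2"
proof -
  have v: "\<bar>v\<bar> \<le> real H + B + 1" using assms by linarith
  have e: "\<bar>pi * (v / real q)\<bar> = pi * \<bar>v\<bar> / real q" by (simp add: abs_mult)
  have "pi * \<bar>v\<bar> \<le> pi * (real H + B + 1)" using v by (intro mult_left_mono) auto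
  also have "\<dots> \<le> real q / 2" by (rule H(4))
  finally show "\<bar>pi * (v / real q)\<bar> \<le> 1/2" unfolding e using q0 by (simp add: field_simps)
  have "real H + B + 1 \<le> (B + 2) * real H"
  proof -
    have "(B + 1) * 1 \<le> (B + 1) * real H" using B0 H8 by (intro mult_left_mono) auto
    thus ?thesis by (simp add: algebra_simps)
  qed
  hence "\<bar>v\<bar>\<^sup>2 \<le> ((B + 2) * real H)\<^sup>2" using v by (intro power_mono) auto
  hence "pi\<^sup>2 * v\<^sup>2 / (real q)\<^sup>2 \<le> pi\<^sup>2 * ((B + 2) * real H)\<^sup>2 / (real q)\<^sup>2"
    by (intro divide_right_mono mult_left_mono) auto
  thus "(pi * (v / real q))\<^sup>2 \<le> pi\<^sup>2 * (B + 2)\<^sup>2 * (real H)\<^sup>2 / (real q)\<^sup>2"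
    by (simp add: power_mult_distrib power_divide mult.assoc)
qed

lemma R_bounds:
  assumes "1 \<le> h" "h \<le> H"
  shows "R h > 0" "\<bar>ln (R h)\<bar> \<le> 8 * (pi\<^sup>2 * (B + 2)\<^sup>2 * (real H)\<^sup>2 / (real q)\<^sup>2)"
proof -
  define z1 where "z1 = pi * ((real h - \<tau> h) / real q)"
  define z2 where "z2 = pi * ((real h - ck * u h + w) / real q)"
  define z3 where "z3 = angle h"
  define Y where "Y = pi\<^sup>2 * (B + 2)\<^sup>2 * (real H)\<^sup>2 / (real q)\<^sup>2"
  have "\<bar>real h - ck * u h + w - real h\<bar> \<le> B + 1"
    using abs_ck_u[of h] abs_w by linarith
  moreover have "\<bar>real h - \<tau> h - real h\<bar> \<le> B + 1" using abs_tau[of h] by simp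
  ultimately have z: "\<bar>z1\<bar> \<le> 1/2" "\<bar>z2\<bar> \<le> 1/2" "\<bar>z3\<bar> \<le> 1/2" "z1\<^sup>2 \<le> Y" "z2\<^sup>2 \<le> Y" "z3\<^sup>2 \<le> Y"
    using sinc_arguments[OF assms, of "real h - \<tau> h"] sinc_arguments[OF assms, of "real h - ck * u h + w"]
      sinc_arguments[OF assms, of "real h"] B0 unfolding z1_def z2_def z3_def Y_def by simp_all
  have p: "sinc z1 > 0" "sinc z2 > 0" "sinc z3 > 0"
    using sinc_bounds(3)[OF z(1)] sinc_bounds(3)[OF z(2)] sinc_bounds(3)[OF z(3)] by linarith+
  have R: "R h = sinc z1 * sinc z2 / (sinc z3)\<^sup>2" by (simp add: R_def z1_def z2_def z3_def)
  show "R h > 0" unfolding R using p by simp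
  have "ln (R h) = ln (sinc z1) + ln (sinc z2) - 2 * ln (sinc z3)"
    unfolding R using p by (simp add: ln_div ln_mult ln_realpow)
  moreover have "\<bar>ln (sinc z1)\<bar> \<le> 2 * Y" "\<bar>ln (sinc z2)\<bar> \<le> 2 * Y" "\<bar>ln (sinc z3)\<bar> \<le> 2 * Y"
    using abs_ln_sinc_le[OF z(1)] abs_ln_sinc_le[OF z(2)] abs_ln_sinc_le[OF z(3)] z(4-6) by linarith+
  ultimately show "\<bar>ln (R h)\<bar> \<le> 8 * (pi\<^sup>2 * (B + 2)\<^sup>2 * (real H)\<^sup>2 / (real q)\<^sup>2)"
    unfolding Y_def[symmetric] by linarith
qed

text \<open>By reflection the sine at \<open>q - h\<close> has argument \<open>pi - z2\<close>. With
  \<open>sin z = z * sinc z\<close> the linear parts combine to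
  \<open>((h - ck u)^2 - w^2) / h^2\<close>, which is \<open>F h\<close>; this is where the shape of
  the limit function comes from.\<close>

lemma rho_pair:
  assumes "1 \<le> h" "h \<le> H"
  shows "\<rho> h * \<rho> (q - h) = \<bar>F h\<bar> * R h"
proof -
  define z1 where "z1 = pi * ((real h - \<tau> h) / real q)"
  define z2 where "z2 = pi * ((real h - ck * u h + w) / real q)"
  define z3 where "z3 = angle h"
  have hq: "h < q" using assms H(2) by simp
  have z3: "z3 > 0" "sin z3 > 0" using assms q0 sin_pos[of h] hq by (auto simp: z3_def)
  have z3': "sinc z3 > 0" using z3 by (simp add: sinc_def)
  have "\<tau> (q - h) = - ck * u h + w" using u_reflect[of h] assms hq by (simp add: \<tau>_def)
  hence "real (q - h) - \<tau> (q - h) = real q - (real h - ck * u h + w)"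
    using hq by (simp add: of_nat_diff)
  hence "pi * ((real (q - h) - \<tau> (q - h)) / real q) = pi - z2"
    using q0 by (simp only: z2_def diff_divide_distrib right_diff_distrib) simp
  moreover have "pi * (real (q - h) / real q) = pi - z3"
    using hq q0 by (simp add: of_nat_diff z3_def field_simps)
  ultimately have "\<rho> (q - h) = \<bar>sin z2\<bar> / sin z3"
    by (simp add: \<rho>_def)
  moreover have "\<rho> h = \<bar>sin z1\<bar> / sin z3" by (simp add: \<rho>_def z1_def z3_def)
  ultimately have "\<rho> h * \<rho> (q - h) = \<bar>sin z1 * sin z2\<bar> / (sin z3)\<^sup>2"
    by (simp add: abs_mult power2_eq_square)
  also have "\<dots> = \<bar>(z1 * z2 / z3\<^sup>2) * (sinc z1 * sinc z2 / (sinc z3)\<^sup>2)\<bar>"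
    unfolding sin_eq_sinc by (simp add: abs_mult power_mult_distrib mult_ac)
  also have "sinc z1 * sinc z2 / (sinc z3)\<^sup>2 = R h" by (simp add: R_def z1_def z2_def z3_def)
  also have "z1 * z2 / z3\<^sup>2 = F h"
  proof -
    have "z1 * z2 / z3\<^sup>2 = (real h - \<tau> h) * (real h - ck * u h + w) / (real h)\<^sup>2"
      using q0 assms by (simp add: z1_def z2_def z3_def power2_eq_square field_simps)
    also have "\<dots> = F h"
      using assms unfolding F_def sudler_factor_def u_def[symmetric] w_def[symmetric] \<tau>_def
      by (simp add: power2_eq_square field_simps)
    finally show ?thesis .
  qed
  finally show ?thesis using R_bounds(1)[OF assms] by (simp add: abs_mult)
qed

text \<open>There are \<open>H\<close> correction factors, each with a logarithm of order
  \<open>H^2/q^2\<close>.\<close>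

lemma ln_prod_R:
  "\<bar>ln (\<Prod>h=1..H. R h)\<bar> \<le> 8 * pi\<^sup>2 * (B + 2)\<^sup>2 * cube_err"
proof -
  have "R h \<noteq> 0" if "h \<in> {1..H}" for h using R_bounds(1)[of h] that by auto
  hence "\<bar>ln (\<Prod>h=1..H. R h)\<bar> = \<bar>\<Sum>h=1..H. ln (R h)\<bar>" by (subst ln_prod) auto
  also have "\<dots> \<le> (\<Sum>h=1..H. \<bar>ln (R h)\<bar>)" by (rule sum_abs)
  also have "\<dots> \<le> (\<Sum>h=1..H. 8 * (pi\<^sup>2 * (B + 2)\<^sup>2 * (real H)\<^sup>2 / (real q)\<^sup>2))"
    using R_bounds(2) by (intro sum_mono) auto
  also have "\<dots> = 8 * pi\<^sup>2 * (B + 2)\<^sup>2 * cube_err"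
    by (simp add: power2_eq_square power3_eq_cube)
  finally show ?thesis .
qed

text \<open>Writing \<open>\<rho> h = cos t - sin t cot (\<pi> h/q)\<close> with \<open>t = \<pi> \<tau> h/q\<close>, the linear term carries the fractional
  part, which is summed by parts, and a constant that cancels under \<open>h \<mapsto> q - h\<close>.\<close>

definition "mid = {Suc H..<q - H}"
abbreviation "inv_squares h \<equiv> 1 / (real h)\<^sup>2 + 1 / (real q - real h)\<^sup>2"
definition "X h = cot (angle h)"
definition "t h = pi * (\<tau> h / real q)"
definition "z h = cos (t h) - sin (t h) * X h - 1"

lemma mid_bounds:
  assumes "h \<in> mid"
  shows "1 \<le> h" "h < q" "real h \<ge> real H" "real q - real h \<ge> real H" "0 < angle h" "angle h < pi"
proof -
  show 1: "1 \<le> h" "h < q" "real h \<ge> real H" "real q - real h \<ge> real H" using assms by (auto simp: mid_def)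
  show "0 < angle h" using 1 q0 by simp
  show "angle h < pi"
    using 1 q0 mult_strict_left_mono[of "real h / real q" 1 pi] by simp
qed

lemma inverse_angle:
  assumes "h \<in> mid"
  shows "1 / (angle h) = (real q / pi) * (1 / real h)"
    "1 / (pi - angle h) = (real q / pi) * (1 / (real q - real h))"
proof -
  have "pi - angle h = pi * ((real q - real h) / real q)"
    using q0 by (simp add: field_simps)
  thus "1 / (angle h) = (real q / pi) * (1 / real h)"
    "1 / (pi - angle h) = (real q / pi) * (1 / (real q - real h))" by simp_all
qed

lemma abs_X:
  assumes "h \<in> mid"
  shows "\<bar>X h\<bar> \<le> (real q / pi) * (1 / real H)"
    "(X h)\<^sup>2 \<le> (real q / pi)\<^sup>2 * inv_squares h"
proof -
  note m = mid_bounds[OF assms]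
  have "1 / real h \<le> 1 / real H" "1 / (real q - real h) \<le> 1 / real H"
    using m H8 by (auto intro!: divide_left_mono)
  hence "(real q / pi) * (1 / real h) \<le> (real q / pi) * (1 / real H)"
    "(real q / pi) * (1 / (real q - real h)) \<le> (real q / pi) * (1 / real H)"
    using q0 mult_left_mono[of "1 / real h" "1 / real H" "real q / pi"]
      mult_left_mono[of "1 / (real q - real h)" "1 / real H" "real q / pi"]
    by (simp_all only: divide_nonneg_nonneg pi_ge_zero of_nat_0_le_iff)
  thus "\<bar>X h\<bar> \<le> (real q / pi) * (1 / real H)"
    using cot_bounds[OF m(5,6), folded X_def] unfolding inverse_angle[OF assms] abs_le_iff by linarith
  show "(X h)\<^sup>2 \<le> (real q / pi)\<^sup>2 * inv_squares h"
    using cot_square_le[OF m(5,6), folded X_def] unfolding inverse_angle[OF assms] power_mult_distrib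
    by (simp only: distrib_left power_one_over)
qed

lemma rho_mid: "h \<in> mid \<Longrightarrow> \<rho> h = \<bar>1 + z h\<bar>"
proof -
  assume h: "h \<in> mid"
  define \<theta> where "\<theta> = angle h"
  have s: "sin \<theta> > 0" using sin_pos mid_bounds(1,2)[OF h] by (simp add: \<theta>_def)
  have "pi * ((real h - \<tau> h) / real q) = \<theta> - t h"
    by (simp only: \<theta>_def t_def diff_divide_distrib right_diff_distrib)
  hence "\<rho> h = \<bar>sin (\<theta> - t h) / sin \<theta>\<bar>"
    using s by (simp add: \<rho>_def \<theta>_def)
  also have "sin (\<theta> - t h) / sin \<theta> = 1 + z h"
  proof -
    have "X h = cos \<theta> / sin \<theta>" by (simp only: X_def cot_def \<theta>_def)
    thus ?thesis using s by (simp add: z_def sin_diff field_simps)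
  qed
  finally show ?thesis .
qed

lemma abs_t: "\<bar>t h\<bar> \<le> pi * (B + 1) / real q" "\<bar>t h\<bar> \<le> 1/2"
proof -
  have "pi * \<bar>\<tau> h\<bar> / real q \<le> pi * (B + 1) / real q"
    using abs_tau[of h] q0 by (intro divide_right_mono mult_left_mono) auto
  thus 1: "\<bar>t h\<bar> \<le> pi * (B + 1) / real q" by (simp add: t_def abs_mult)
  have "pi * (B + 1) \<le> pi * (real H + B + 1)" by (intro mult_left_mono) auto
  hence "pi * (B + 1) \<le> real q / 2" using H(4) by linarith
  hence "pi * (B + 1) / real q \<le> 1/2" using q0 by (simp add: field_simps)
  thus "\<bar>t h\<bar> \<le> 1/2" using 1 by linarith
qed

lemma abs_tX:
  assumes "h \<in> mid"
  shows "\<bar>t h * X h\<bar> \<le> 1/8" "(t h * X h)\<^sup>2 \<le> (B + 1)\<^sup>2 * inv_squares h"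
proof -
  have "\<bar>t h * X h\<bar> \<le> (pi * (B + 1) / real q) * ((real q / pi) * (1 / real H))"
    unfolding abs_mult using abs_t(1) abs_X(1)[OF assms] by (intro mult_mono) (use q0 B0 in auto)
  also have "\<dots> = (B + 1) / real H" using q0 by simp
  also have "\<dots> \<le> 1/8" using H(3) H8 by (simp add: field_simps)
  finally show "\<bar>t h * X h\<bar> \<le> 1/8" .
  have "\<bar>t h\<bar>\<^sup>2 \<le> (pi * (B + 1) / real q)\<^sup>2" using abs_t(1) by (intro power_mono) auto
  hence "(t h)\<^sup>2 * (X h)\<^sup>2 \<le> (pi * (B + 1) / real q)\<^sup>2 * ((real q / pi)\<^sup>2 * inv_squares h)"
    using abs_X(2)[OF assms] by (intro mult_mono) auto
  also have "\<dots> = ((pi * (B + 1) / real q) * (real q / pi))\<^sup>2 * inv_squares h"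
    unfolding power_mult_distrib by (simp only: mult.assoc)
  also have "(pi * (B + 1) / real q) * (real q / pi) = B + 1" using q0 by simp
  finally show "(t h * X h)\<^sup>2 \<le> (B + 1)\<^sup>2 * inv_squares h"
    by (simp only: power_mult_distrib)
qed

text \<open>The cotangent may be as large as a multiple of \<open>q/H\<close>, but
  \<open>\<bar>t h * X h\<bar> \<le> 1/8\<close> lets the cubic error of the sine be absorbed into
  \<open>(t h)^2\<close>, next to the quadratic error of the cosine.\<close>

lemma z_approx:
  assumes "h \<in> mid"
  shows "\<bar>z h + t h * X h\<bar> \<le> (t h)\<^sup>2" "\<bar>z h\<bar> \<le> 1/2" "(z h)\<^sup>2 \<le> 2 * (t h * X h)\<^sup>2 + (t h)\<^sup>2"
proof -
  have c: "\<bar>cos (t h) - 1\<bar> \<le> (t h)\<^sup>2 / 2"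
  proof -
    have "\<bar>sin (t h / 2)\<bar>\<^sup>2 \<le> \<bar>t h / 2\<bar>\<^sup>2" by (intro power_mono abs_sin_x_le_abs_x) auto
    moreover have "cos (t h) = 1 - 2 * (sin (t h / 2))\<^sup>2" using cos_double_sin[of "t h / 2"] by simp
    ultimately show ?thesis by (simp add: power_divide)
  qed
  have "\<bar>(sin (t h) - t h) * X h\<bar> \<le> (\<bar>t h\<bar> ^ 3 / 6) * \<bar>X h\<bar>"
    unfolding abs_mult by (intro mult_right_mono abs_sin_diff_le) auto
  also have "\<dots> = ((t h)\<^sup>2 / 6) * \<bar>t h * X h\<bar>" by (simp add: power3_eq_cube power2_eq_square abs_mult)
  also have "\<dots> \<le> ((t h)\<^sup>2 / 6) * (1/8)" using abs_tX(1)[OF assms] by (intro mult_left_mono) auto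
  finally have s: "\<bar>(sin (t h) - t h) * X h\<bar> \<le> (t h)\<^sup>2 / 48" by simp
  have e: "z h + t h * X h = (cos (t h) - 1) - (sin (t h) - t h) * X h" by (simp add: z_def algebra_simps)
  have t2: "(t h)\<^sup>2 \<ge> 0" by simp
  show 1: "\<bar>z h + t h * X h\<bar> \<le> (t h)\<^sup>2" unfolding e using c s t2 by linarith
  have "\<bar>t h\<bar>\<^sup>2 \<le> (1/2)\<^sup>2" using abs_t(2) by (intro power_mono) auto
  hence t4: "(t h)\<^sup>2 \<le> 1/4" by (simp add: power2_eq_square)
  show "\<bar>z h\<bar> \<le> 1/2" using 1 t4 abs_tX(1)[OF assms] by linarith
  have "(z h)\<^sup>2 \<le> 2 * (t h * X h)\<^sup>2 + 2 * (z h + t h * X h)\<^sup>2"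
  proof -
    \<comment> \<open>The square behind \<open>z^2 \<le> 2 a^2 + 2 (z + a)^2\<close>, with
      \<open>a = t h * X h\<close>.\<close>
    have "0 \<le> (z h + 2 * (t h * X h))\<^sup>2" by simp
    also have "\<dots> = 2 * (t h * X h)\<^sup>2 + 2 * (z h + t h * X h)\<^sup>2 - (z h)\<^sup>2"
      by (simp add: power2_eq_square algebra_simps)
    finally show ?thesis by linarith
  qed
  moreover have "(z h + t h * X h)\<^sup>2 \<le> (t h)\<^sup>2 * (1/4)"
  proof -
    have "\<bar>z h + t h * X h\<bar> * \<bar>z h + t h * X h\<bar> \<le> (t h)\<^sup>2 * (1/4)"
      using 1 t4 by (intro mult_mono) auto
    thus ?thesis by (simp add: power2_eq_square)
  qed
  ultimately show "(z h)\<^sup>2 \<le> 2 * (t h * X h)\<^sup>2 + (t h)\<^sup>2" using t2 by linarith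
qed

text \<open>At most \<open>q\<close> terms of order \<open>q^-2\<close>; the resulting
  \<open>1/q\<close> is weakened to \<open>1/H\<close> to match the other errors.\<close>

lemma sum_t_squares: "(\<Sum>h\<in>mid. (t h)\<^sup>2) \<le> pi\<^sup>2 * (B + 1)\<^sup>2 * (1 / real H)"
proof -
  have "(\<Sum>h\<in>mid. (t h)\<^sup>2) \<le> (\<Sum>h\<in>mid. (pi * (B + 1) / real q)\<^sup>2)"
  proof (rule sum_mono)
    fix h
    have "\<bar>t h\<bar>\<^sup>2 \<le> (pi * (B + 1) / real q)\<^sup>2" using abs_t(1) by (intro power_mono) auto
    thus "(t h)\<^sup>2 \<le> (pi * (B + 1) / real q)\<^sup>2" by simp
  qed
  also have "\<dots> = real (card mid) * (pi * (B + 1) / real q)\<^sup>2" by simp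
  also have "\<dots> \<le> real q * (pi * (B + 1) / real q)\<^sup>2"
    by (intro mult_right_mono) (auto simp: mid_def)
  also have "\<dots> = pi\<^sup>2 * (B + 1)\<^sup>2 * (1 / real q)"
    using q0 by (simp add: power2_eq_square field_simps)
  also have "\<dots> \<le> pi\<^sup>2 * (B + 1)\<^sup>2 * (1 / real H)"
    using H_le_q H8 q0 by (intro mult_left_mono divide_left_mono) auto
  finally show ?thesis .
qed

lemma reflect_mid: "h \<in> mid \<Longrightarrow> q - h \<in> mid"
  using H(2) unfolding mid_def by auto

lemma sum_mid_reflect: "(\<Sum>h\<in>mid. g (q - h)) = (\<Sum>h\<in>mid. g h)"
  by (rule sum.reindex_bij_witness[of _ "\<lambda>h. q - h" "\<lambda>h. q - h"])
     (simp_all add: reflect_mid less_imp_le[OF mid_bounds(2)])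

lemma sum_inverse_squares_mid:
  "(\<Sum>h\<in>mid. inv_squares h) \<le> 2 * (1 / real H)"
proof -
  have e: "mid = {Suc H..q - H - 1}" using H(2) by (auto simp: mid_def)
  have "1 / real (q - H - 1) \<ge> 0" by simp
  hence 1: "(\<Sum>h\<in>mid. 1 / (real h)\<^sup>2) \<le> 1 / real H"
    unfolding e using sum_inverse_squares_le[of H "q - H - 1"] H8 H(2) by linarith
  have "(\<Sum>h\<in>mid. 1 / (real q - real h)\<^sup>2) = (\<Sum>h\<in>mid. 1 / (real (q - h))\<^sup>2)"
    by (rule sum.cong) (auto simp: mid_def of_nat_diff)
  also have "\<dots> = (\<Sum>h\<in>mid. 1 / (real h)\<^sup>2)" by (rule sum_mid_reflect)
  finally show ?thesis using 1 by (simp add: sum.distrib)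
qed

lemma X_reflect: "h \<in> mid \<Longrightarrow> X (q - h) = - X h"
proof -
  assume h: "h \<in> mid"
  have "pi * (real (q - h) / real q) = pi - angle h"
    using mid_bounds(2)[OF h] q0 by (simp add: of_nat_diff field_simps)
  thus ?thesis by (simp add: X_def cot_def)
qed

lemma sum_X: "(\<Sum>h\<in>mid. X h) = 0"
proof -
  have "(\<Sum>h\<in>mid. X h) = (\<Sum>h\<in>mid. X (q - h))" by (rule sum_mid_reflect[symmetric])
  also have "\<dots> = - (\<Sum>h\<in>mid. X h)" using X_reflect by (simp flip: sum_negf)
  finally show ?thesis by simp
qed

lemma X_antimono: "1 \<le> h \<Longrightarrow> h \<le> h' \<Longrightarrow> h' < q \<Longrightarrow> X h' \<le> X h"
  unfolding X_def
proof (rule cot_antimono)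
  assume h: "1 \<le> h" "h \<le> h'" "h' < q"
  show "0 < angle h" using h q0 by simp
  show "angle h \<le> angle h'"
    using h q0 by (intro mult_left_mono divide_right_mono) auto
  show "angle h' < pi"
    using h q0 mult_strict_left_mono[of "real h' / real q" 1 pi] by simp
qed

text \<open>The cotangent is monotone, so its variation over the middle range is at most twice its
  size \<open>V\<close> at the ends. Two boundary terms and this variation make up the constant
  4.\<close>

lemma sum_uX: "\<bar>\<Sum>h\<in>mid. u h * X h\<bar> \<le> 4 * (K1 * (1 + ln (real q))) * ((real q / pi) * (1 / real H))"
proof -
  define W where "W = K1 * (1 + ln (real q))"
  define V where "V = (real q / pi) * (1 / real H)"
  define S where "S n = (\<Sum>h=1..n. u h)" for n
  define N where "N = q - H - 1"
  have e: "mid = {Suc H..N}" using H(2) by (auto simp: mid_def N_def)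
  have N: "H \<le> N" "Suc N = q - H" "N < q" "Suc N < q" using H(2) H8 by (auto simp: N_def)
  have W0: "W \<ge> 0" using K1 ln_q by (simp add: W_def)
  have S: "\<bar>S n\<bar> \<le> W" if "1 \<le> n" "n < q" for n
  proof -
    have "\<bar>S n\<bar> \<le> K1 * (1 + ln (real n))" using disc'[OF that] by (simp add: S_def u_def \<gamma>_def)
    also have "\<dots> \<le> W" unfolding W_def using that K1 by (intro mult_left_mono) auto
    finally show ?thesis .
  qed
  have a: "0 < angle H" "angle H < pi"
    using H8 H(2) q0 mult_strict_left_mono[of "real H / real q" 1 pi] by simp_all
  have "real H / real q < 1/2" using H(2) q0 by (simp add: field_simps)
  hence "angle H < pi / 2" using mult_strict_left_mono[of "real H / real q" "1/2" pi] by simp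
  hence "X H > 0" unfolding X_def by (intro cot_gt_zero a)
  moreover have "X H \<le> V" using cot_bounds(1)[OF a] by (simp add: V_def X_def)
  \<comment> \<open>\<open>Suc N = q - H\<close> is the mirror image of \<open>H\<close>, so by
    monotonicity the end values lie between \<open>- V\<close> and \<open>V\<close>.\<close>
  moreover have "X (Suc N) = - X H"
  proof -
    have "pi * (real (Suc N) / real q) = pi - angle H"
      unfolding N(2) using H(2) q0 by (simp add: of_nat_diff field_simps)
    thus ?thesis by (simp add: X_def cot_def)
  qed
  moreover have "X (Suc H) \<le> X H" "X (Suc N) \<le> X (Suc H)"
    using X_antimono[of H "Suc H"] X_antimono[of "Suc H" "Suc N"] N H8 by auto
  ultimately have XM: "\<bar>X (Suc H)\<bar> \<le> V" and XN: "\<bar>X (Suc N)\<bar> \<le> V"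
    unfolding abs_le_iff by linarith+
  have "(\<Sum>h\<in>mid. u h * X h) = S N * X (Suc N) - S H * X (Suc H) + (\<Sum>n=Suc H..N. S n * (X n - X (Suc n)))"
    unfolding e S_def by (rule sum_mult_Abel[OF N(1)])
  moreover have "\<bar>S N * X (Suc N)\<bar> \<le> W * V"
    unfolding abs_mult using S[of N] N H8 XN W0 by (intro mult_mono) auto
  moreover have "\<bar>S H * X (Suc H)\<bar> \<le> W * V"
    unfolding abs_mult using S[of H] N H8 XM W0 by (intro mult_mono) auto
  moreover have "\<bar>\<Sum>n=Suc H..N. S n * (X n - X (Suc n))\<bar> \<le> W * (X (Suc H) - X (Suc N))"
  proof -
    have "\<bar>\<Sum>n=Suc H..N. S n * (X n - X (Suc n))\<bar> \<le> (\<Sum>n=Suc H..N. \<bar>S n * (X n - X (Suc n))\<bar>)"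
      by (rule sum_abs)
    also have "\<dots> \<le> (\<Sum>n=Suc H..N. W * (X n - X (Suc n)))"
    proof (rule sum_mono)
      fix n assume n: "n \<in> {Suc H..N}"
      have "X n - X (Suc n) \<ge> 0" using X_antimono[of n "Suc n"] n N by auto
      thus "\<bar>S n * (X n - X (Suc n))\<bar> \<le> W * (X n - X (Suc n))"
        unfolding abs_mult using S[of n] n N by (intro mult_mono) (auto intro: W0)
    qed
    also have "\<dots> = W * (\<Sum>n=Suc H..N. (X n - X (Suc n)))" by (simp add: sum_distrib_left)
    also have "(\<Sum>n=Suc H..N. (X n - X (Suc n))) = X (Suc H) - X (Suc N)"
      using N(1) by (induction N rule: dec_induct) auto
    finally show ?thesis .
  qed
  moreover have "W * (X (Suc H) - X (Suc N)) \<le> W * (2 * V)"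
    using XM XN W0 by (intro mult_left_mono) auto
  ultimately show ?thesis unfolding W_def[symmetric] V_def[symmetric] by linarith
qed

lemma sum_tX: "\<bar>\<Sum>h\<in>mid. t h * X h\<bar> \<le> 4 * K1 * log_err"
proof -
  have "(\<Sum>h\<in>mid. t h * X h) = (\<Sum>h\<in>mid. (pi / real q) * (ck * (u h * X h) + w * X h))"
    by (rule sum.cong) (simp_all add: t_def \<tau>_def algebra_simps add_divide_distrib)
  also have "\<dots> = (pi / real q) * (ck * (\<Sum>h\<in>mid. u h * X h) + w * (\<Sum>h\<in>mid. X h))"
    by (simp only: sum.distrib distrib_left sum_distrib_left)
  also have "\<dots> = (pi / real q) * ck * (\<Sum>h\<in>mid. u h * X h)" by (simp add: sum_X)
  also have "\<bar>\<dots>\<bar> \<le> (pi / real q) * 1 * (4 * (K1 * (1 + ln (real q))) * ((real q / pi) * (1 / real H)))"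
    unfolding abs_mult using ck q0 by (intro mult_mono sum_uX) auto
  also have "\<dots> = 4 * K1 * log_err" using q0 by simp
  finally show ?thesis .
qed

lemma prod_rho_mid_pos: "(\<Prod>h\<in>mid. \<rho> h) > 0"
proof (rule prod_pos)
  fix h assume h: "h \<in> mid"
  show "\<rho> h > 0" unfolding rho_mid[OF h] using z_approx(2)[OF h] by linarith
qed

lemma ln_prod_rho_mid:
  "\<bar>ln (\<Prod>h\<in>mid. \<rho> h)\<bar> \<le> (4 * K1 + (8 + 3 * pi\<^sup>2) * (B + 1)\<^sup>2) * log_err"
proof -
  define Y where "Y = 1 / real H"
  define P where "P = pi\<^sup>2 * (B + 1)\<^sup>2 * Y"
  have "(\<Prod>h\<in>mid. \<rho> h) = (\<Prod>h\<in>mid. 1 + z h)"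
  proof (rule prod.cong[OF refl])
    fix h assume h: "h \<in> mid"
    show "\<rho> h = 1 + z h" unfolding rho_mid[OF h] using z_approx(2)[OF h] by linarith
  qed
  moreover have "\<bar>ln (\<Prod>h\<in>mid. 1 + z h) - (\<Sum>h\<in>mid. z h)\<bar> \<le> 2 * (\<Sum>h\<in>mid. (z h)\<^sup>2)"
    by (rule abs_ln_prod_one_plus) (use z_approx(2) in \<open>auto simp: mid_def\<close>)
  moreover have "(\<Sum>h\<in>mid. (z h)\<^sup>2) \<le> 4 * ((B + 1)\<^sup>2 * Y) + P"
  proof -
    have "(\<Sum>h\<in>mid. (z h)\<^sup>2) \<le> (\<Sum>h\<in>mid. 2 * ((B + 1)\<^sup>2 * inv_squares h) + (t h)\<^sup>2)"
    proof (rule sum_mono)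
      fix h assume h: "h \<in> mid"
      show "(z h)\<^sup>2 \<le> 2 * ((B + 1)\<^sup>2 * inv_squares h) + (t h)\<^sup>2"
        using z_approx(3)[OF h] abs_tX(2)[OF h] by linarith
    qed
    also have "\<dots> = 2 * ((B + 1)\<^sup>2 * (\<Sum>h\<in>mid. inv_squares h)) + (\<Sum>h\<in>mid. (t h)\<^sup>2)"
      by (simp only: sum.distrib[of "\<lambda>h. 2 * ((B + 1)\<^sup>2 * inv_squares h)"] sum_distrib_left)
    also have "\<dots> \<le> 2 * ((B + 1)\<^sup>2 * (2 * Y)) + P"
      using sum_inverse_squares_mid sum_t_squares unfolding P_def Y_def
      by (intro add_mono mult_left_mono) auto
    finally show ?thesis by simp
  qed
  moreover have "\<bar>(\<Sum>h\<in>mid. z h) + (\<Sum>h\<in>mid. t h * X h)\<bar> \<le> P"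
  proof -
    have "\<bar>(\<Sum>h\<in>mid. z h) + (\<Sum>h\<in>mid. t h * X h)\<bar> = \<bar>\<Sum>h\<in>mid. z h + t h * X h\<bar>"
      by (simp add: sum.distrib)
    also have "\<dots> \<le> (\<Sum>h\<in>mid. \<bar>z h + t h * X h\<bar>)" by (rule sum_abs)
    also have "\<dots> \<le> (\<Sum>h\<in>mid. (t h)\<^sup>2)" by (intro sum_mono z_approx(1))
    also have "\<dots> \<le> P" unfolding P_def Y_def by (rule sum_t_squares)
    finally show ?thesis .
  qed
  moreover have "\<bar>l\<bar> \<le> c + 8 * b + 3 * P"
    if "\<bar>l - s\<bar> \<le> 2 * v" "v \<le> 4 * b + P" "\<bar>s + v'\<bar> \<le> P" "\<bar>v'\<bar> \<le> c" for l s v v' b c :: real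
    using that by linarith
  ultimately have 1: "\<bar>ln (\<Prod>h\<in>mid. \<rho> h)\<bar> \<le> 4 * K1 * log_err + 8 * ((B + 1)\<^sup>2 * Y) + 3 * P"
    using sum_tX by simp
  have "8 * ((B + 1)\<^sup>2 * Y) + 3 * P = ((8 + 3 * pi\<^sup>2) * (B + 1)\<^sup>2) * Y"
    by (simp add: P_def algebra_simps)
  also have "\<dots> \<le> ((8 + 3 * pi\<^sup>2) * (B + 1)\<^sup>2) * log_err"
    unfolding Y_def using ln_q by (intro mult_left_mono divide_right_mono) auto
  finally show ?thesis using 1 unfolding distrib_right by linarith
qed

end

section \<open>Comparison with the limit function\<close>

context sudler_limit
begin

text \<open>\<open>(B + 3)^2\<close> bounds every head factor and \<open>K1 * (B + 7)\<close> is the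
  constant of \<open>F_near_f\<close>. The two summands come from changing \<open>ck\<close> to
  \<open>c\<close> and from changing the factors.\<close>

definition "head_const K1 B = ((B + 3)\<^sup>2) ^ head B * (K1 + (B + 1) * (real (head B) * (K1 * (B + 7))))"

text \<open>One summand for each source of logarithmic error: the ratios \<open>R\<close>, the
  middle range, the separated sine, the relative errors \<open>\<zeta>\<close>, and the truncated
  tail.\<close>

definition "rate_const K1 B = 8 * pi\<^sup>2 * (B + 2)\<^sup>2 + (4 * K1 + (8 + 3 * pi\<^sup>2) * (B + 1)\<^sup>2)
    + 2 * pi\<^sup>2 * (B + 1)\<^sup>2 + 4 * (K1 * (B + 7)) + 2 * tail_const B"

end

context sudler_finite
begin

lemma u_near_y:
  assumes "1 \<le> h" "h \<le> H"
  shows "\<bar>u h - y h\<bar> \<le> K1 * real h / (real q)\<^sup>2"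
proof -
  have hq: "h < q" using assms H(2) by simp
  have "\<bar>real h * \<gamma> - real h * \<beta>\<bar> = real h * \<bar>\<gamma> - \<beta>\<bar>"
    by (simp add: abs_mult flip: right_diff_distrib)
  also have "\<dots> \<le> real h * (K1 / (real q)\<^sup>2)"
    using gamma_beta unfolding \<gamma>_def by (intro mult_left_mono) auto
  finally have d: "\<bar>real h * \<gamma> - real h * \<beta>\<bar> \<le> K1 * real h / (real q)\<^sup>2" by (simp add: mult.commute)
  have "K1 * real h \<le> K1 * real H" using assms K1 by (intro mult_left_mono) auto
  hence "K1 * real h / (real q)\<^sup>2 < real q / (real q)\<^sup>2"
    using H(5) q0 by (intro divide_strict_right_mono) auto
  also have "\<dots> = 1 / real q" using q0 by (simp add: power2_eq_square)
  finally have lt: "K1 * real h / (real q)\<^sup>2 < 1 / real q" .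
  \<comment> \<open>A displacement below \<open>1/q\<close> cannot cross an integer.\<close>
  have "\<lfloor>real h * \<beta>\<rfloor> = \<lfloor>real h * \<gamma>\<rfloor>"
    using d lt frac_gamma(1,2)[OF assms(1) hq] unfolding frac_def by (intro floor_unique) linarith+
  hence "u h - y h = real h * \<gamma> - real h * \<beta>" by (simp add: u_def frac_def)
  thus ?thesis using d by simp
qed

text \<open>The error of the sawtooth grows like \<open>h\<close>, but the sawtooth enters the
  factor divided by \<open>h\<close>. The difference is therefore \<open>O(q^-2)\<close> uniformly
  in \<open>h\<close>.\<close>

lemma F_near_f:
  assumes "1 \<le> h" "h \<le> H"
  shows "\<bar>F h - f h x\<bar> \<le> K1 * (B + 7) / (real q)\<^sup>2"
proof -
  define K where "K = K1 / (real q)\<^sup>2"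
  have K: "K \<ge> 0" using K1 by (simp add: K_def)
  have h1: "real h \<ge> 1" using assms by simp
  have e: "F h - f h x = ((c * y h - ck * u h) / real h) * (2 - (ck * u h + c * y h) / real h)
      - ((ck / 2 - c / 2) * (2 * x + (ck / 2 + c / 2))) / (real h)\<^sup>2"
  proof -
    have sq: "(1 - v)\<^sup>2 - k\<^sup>2 / r - ((1 - v')\<^sup>2 - l\<^sup>2 / r) = (v' - v) * (2 - (v + v')) - (k\<^sup>2 - l\<^sup>2) / r"
      for v v' k l r :: real
      by (simp add: power2_eq_square algebra_simps diff_divide_distrib)
    have "(x + k)\<^sup>2 - (x + l)\<^sup>2 = (k - l) * (2 * x + (k + l))" for k l :: real
      by (simp add: power2_eq_square algebra_simps)
    note this[of "ck / 2" "c / 2"]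
    thus ?thesis
      unfolding F_def sudler_factor_def u_def[symmetric] times_divide_eq_right sq
        diff_divide_distrib[of "c * y h" "ck * u h"] add_divide_distrib[of "ck * u h" "c * y h"]
      by (simp only:)
  qed
  have "\<bar>c * y h - ck * u h\<bar> \<le> 2 * K * real h"
  proof -
    have "c * Y - ck * U = (c - ck) * Y + ck * (Y - U)" for Y U :: real by (simp add: algebra_simps)
    hence "c * y h - ck * u h = (c - ck) * y h + ck * (y h - u h)" .
    moreover have "\<bar>(c - ck) * y h\<bar> \<le> K * 1"
      unfolding abs_mult using ck_c abs_y[of h] by (intro mult_mono) (auto simp: K_def abs_minus_commute)
    moreover have "\<bar>ck * (y h - u h)\<bar> \<le> 1 * (K * real h)"
      unfolding abs_mult using ck u_near_y[OF assms] by (intro mult_mono) (auto simp: K_def abs_minus_commute)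
    moreover have "K * 1 \<le> K * real h" using K h1 by (intro mult_left_mono)
    ultimately show ?thesis by linarith
  qed
  hence 1: "\<bar>(c * y h - ck * u h) / real h\<bar> \<le> 2 * K" using h1 by (simp add: field_simps)
  have "\<bar>c * y h\<bar> \<le> 1 * (1/2)" unfolding abs_mult using c abs_y by (intro mult_mono) auto
  hence "\<bar>ck * u h + c * y h\<bar> \<le> 1" using abs_ck_u[of h] by linarith
  hence "\<bar>(ck * u h + c * y h) / real h\<bar> \<le> 1" using h1 by (simp add: field_simps)
  hence 2: "\<bar>2 - (ck * u h + c * y h) / real h\<bar> \<le> 3" by linarith
  have "\<bar>(ck / 2 - c / 2) * (2 * x + (ck / 2 + c / 2))\<bar> \<le> (K / 2) * (2 * B + 1)"
    unfolding abs_mult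
  proof (rule mult_mono)
    have "\<bar>ck - c\<bar> \<le> K" using ck_c by (simp add: K_def)
    thus "\<bar>ck / 2 - c / 2\<bar> \<le> K / 2" by linarith
    show "\<bar>2 * x + (ck / 2 + c / 2)\<bar> \<le> 2 * B + 1" using x ck c by linarith
  qed (use K in auto)
  hence "\<bar>(ck / 2 - c / 2) * (2 * x + (ck / 2 + c / 2))\<bar> / (real h)\<^sup>2 \<le> ((K / 2) * (2 * B + 1)) / 1"
    using h1 by (intro frac_le) auto
  hence "\<bar>((ck / 2 - c / 2) * (2 * x + (ck / 2 + c / 2))) / (real h)\<^sup>2\<bar> \<le> (K / 2) * (2 * B + 1)"
    unfolding abs_divide by simp
  moreover have "\<bar>((c * y h - ck * u h) / real h) * (2 - (ck * u h + c * y h) / real h)\<bar> \<le> 2 * K * 3"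
    unfolding abs_mult[of "(c * y h - ck * u h) / real h"] using 1 2 K by (intro mult_mono) auto
  ultimately have "\<bar>F h - f h x\<bar> \<le> 2 * K * 3 + (K / 2) * (2 * B + 1)" unfolding e by linarith
  \<comment> \<open>The constant obtained is \<open>B + 13/2\<close>, rounded up.\<close>
  also have "\<dots> \<le> K * (B + 7)" using K by (simp add: algebra_simps)
  finally show ?thesis by (simp add: K_def)
qed

definition "\<zeta> h = F h / f h x - 1"

lemma zeta:
  assumes "h \<in> {Suc (head B)..H}"
  shows "F h = f h x * (1 + \<zeta> h)" "\<bar>\<zeta> h\<bar> \<le> 2 * (K1 * (B + 7) / (real q)\<^sup>2)" "\<bar>\<zeta> h\<bar> \<le> 1/4" "F h > 0"
proof -
  have fh: "f h x \<ge> 1/2" using factor_ge_half(1)[OF x, of h] assms by simp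
  show 1: "F h = f h x * (1 + \<zeta> h)" using fh by (simp add: \<zeta>_def)
  have "\<zeta> h = (F h - f h x) / f h x" using fh by (simp add: \<zeta>_def field_simps)
  hence "\<bar>\<zeta> h\<bar> = \<bar>F h - f h x\<bar> / f h x" using fh by simp
  also have "\<dots> \<le> (K1 * (B + 7) / (real q)\<^sup>2) / (1/2)"
    using F_near_f[of h] assms fh by (intro frac_le) auto
  finally show 2: "\<bar>\<zeta> h\<bar> \<le> 2 * (K1 * (B + 7) / (real q)\<^sup>2)" by (simp add: mult_ac)
  have "K1 * (B + 7) / (real q)\<^sup>2 \<le> 1/8" using H(6) q0 by (simp add: field_simps)
  thus 3: "\<bar>\<zeta> h\<bar> \<le> 1/4" using 2 by linarith
  show "F h > 0" unfolding 1 using fh 3 by (intro mult_pos_pos) linarith+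
qed

text \<open>At most \<open>H\<close> relative errors of order \<open>q^-2\<close> add up to
  \<open>O(H/q^2)\<close>, which \<open>H \<le> q\<close> turns into \<open>O(1/H)\<close>; the rest
  is the truncation error of the limit product at \<open>H\<close>.\<close>

lemma ln_prod_F:
  "\<bar>ln (\<Prod>h=Suc (head B)..H. F h) - tail_log B x\<bar>
     \<le> (4 * (K1 * (B + 7)) + 2 * tail_const B) * log_err"
proof -
  define I where "I = {Suc (head B)..H}"
  define K where "K = K1 * (B + 7)"
  have K: "K \<ge> 0" using K1 B0 by (simp add: K_def)
  have "(\<Prod>h\<in>I. F h) = (\<Prod>h\<in>I. f h x) * (\<Prod>h\<in>I. 1 + \<zeta> h)"
    unfolding prod.distrib[symmetric] by (rule prod.cong) (use zeta(1) in \<open>auto simp: I_def\<close>)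
  moreover have "(\<Prod>h\<in>I. f h x) > 0" unfolding I_def by (rule tail_prod_pos[OF x]) simp
  moreover have "(\<Prod>h\<in>I. 1 + \<zeta> h) > 0"
  proof (rule prod_pos)
    fix h assume "h \<in> I"
    thus "1 + \<zeta> h > 0" using zeta(3)[of h] unfolding I_def by linarith
  qed
  ultimately have 1: "ln (\<Prod>h\<in>I. F h) = ln (\<Prod>h\<in>I. f h x) + ln (\<Prod>h\<in>I. 1 + \<zeta> h)"
    by (simp add: ln_mult)
  have "\<bar>ln (\<Prod>h\<in>I. 1 + \<zeta> h)\<bar> \<le> 4 * K * (1 / real H)"
  proof -
    have "\<bar>ln (\<Prod>h\<in>I. 1 + \<zeta> h) - (\<Sum>h\<in>I. \<zeta> h)\<bar> \<le> 2 * (\<Sum>h\<in>I. (\<zeta> h)\<^sup>2)"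
      by (rule abs_ln_prod_one_plus) (use zeta(3) in \<open>force simp: I_def\<close>)+
    hence "\<bar>ln (\<Prod>h\<in>I. 1 + \<zeta> h)\<bar> \<le> \<bar>\<Sum>h\<in>I. \<zeta> h\<bar> + (\<Sum>h\<in>I. 2 * (\<zeta> h)\<^sup>2)"
      unfolding sum_distrib_left[symmetric] by linarith
    also have "\<dots> \<le> (\<Sum>h\<in>I. \<bar>\<zeta> h\<bar>) + (\<Sum>h\<in>I. \<bar>\<zeta> h\<bar>)"
    proof (intro add_mono sum_abs sum_mono)
      fix h assume "h \<in> I"
      hence "\<bar>\<zeta> h\<bar> \<le> 1/4" using zeta(3) by (simp add: I_def)
      hence "\<bar>\<zeta> h\<bar> * \<bar>\<zeta> h\<bar> \<le> (1/4) * \<bar>\<zeta> h\<bar>" by (intro mult_right_mono) auto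
      moreover have "\<bar>\<zeta> h\<bar> * \<bar>\<zeta> h\<bar> = (\<zeta> h)\<^sup>2" by (simp add: power2_eq_square)
      ultimately show "2 * (\<zeta> h)\<^sup>2 \<le> \<bar>\<zeta> h\<bar>" by linarith
    qed
    also have "(\<Sum>h\<in>I. \<bar>\<zeta> h\<bar>) \<le> (\<Sum>h\<in>I. 2 * (K / (real q)\<^sup>2))"
      using zeta(2) by (intro sum_mono) (simp add: I_def K_def)
    also have "\<dots> = real (card I) * (2 * (K / (real q)\<^sup>2))" by simp
    also have "\<dots> \<le> real H * (2 * (K / (real q)\<^sup>2))"
      using K by (intro mult_right_mono) (auto simp: I_def)
    also have "real H * (2 * (K / (real q)\<^sup>2)) \<le> 2 * K * (1 / real H)"
    proof -
      have "real H * real H \<le> real q * real q" using H_le_q by (intro mult_mono) auto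
      hence "real H / (real q)\<^sup>2 \<le> 1 / real H" using q0 H8 by (simp add: field_simps power2_eq_square)
      hence "2 * K * (real H / (real q)\<^sup>2) \<le> 2 * K * (1 / real H)" using K by (intro mult_left_mono) auto
      thus ?thesis by (simp add: mult_ac)
    qed
    finally show ?thesis by (simp add: mult_ac)
  qed
  moreover have "1 / real H \<le> log_err" using ln_q by (intro divide_right_mono) auto
  hence "4 * K * (1 / real H) \<le> 4 * K * log_err" using K by (intro mult_left_mono) auto
  moreover have "\<bar>ln (\<Prod>h\<in>I. f h x) - tail_log B x\<bar> \<le> tail_const B * log_rate H"
    unfolding I_def by (rule tail_log_approx[OF x H(1)])
  moreover have "tail_const B * log_rate H \<le> 2 * tail_const B * log_err"
  proof -
    have "ln (real H) \<le> ln (real q)" using H_le_q H8 by simp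
    hence "log_rate H \<le> 2 * log_err"
      unfolding log_rate_def times_divide_eq_right using ln_q by (intro divide_right_mono) auto
    hence "tail_const B * log_rate H \<le> tail_const B * (2 * log_err)"
      using tail_const_pos[of B] by (intro mult_left_mono) auto
    thus ?thesis by (simp only: mult_ac)
  qed
  ultimately show ?thesis unfolding I_def[symmetric] K_def[symmetric] 1 distrib_right by linarith
qed

lemma abs_factor_le:
  assumes "\<bar>v\<bar> \<le> 1/2" "\<bar>w'\<bar> \<le> B + 1" "n \<ge> 1"
  shows "\<bar>(1 - v / real n)\<^sup>2 - w'\<^sup>2 / (real n)\<^sup>2\<bar> \<le> (B + 3)\<^sup>2"
proof -
  have n: "real n \<ge> 1" using assms by simp
  have "\<bar>v / real n\<bar> \<le> 1/2" 
    using assms(1) n frac_le[of "1/2" "\<bar>v\<bar>" 1 "real n"] by simp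
  hence "\<bar>1 - v / real n\<bar> \<le> 2" by linarith
  hence "\<bar>1 - v / real n\<bar>\<^sup>2 \<le> 2\<^sup>2" by (intro power_mono) auto
  moreover have "\<bar>w'\<bar>\<^sup>2 / (real n)\<^sup>2 \<le> (B + 1)\<^sup>2 / 1"
    using assms(2) n by (intro frac_le power_mono) auto
  moreover have "w'\<^sup>2 / (real n)\<^sup>2 \<ge> 0" by simp
  moreover have "(B + 3)\<^sup>2 \<ge> 4 + (B + 1)\<^sup>2" using B0 by (simp add: power2_eq_square algebra_simps)
  moreover have "(1 - v / real n)\<^sup>2 \<ge> 0" by simp
  moreover have "\<bar>k - l\<bar> \<le> m"
    if "k \<le> 2\<^sup>2" "l \<le> n' / 1" "l \<ge> 0" "m \<ge> 4 + n'" "k \<ge> 0" for k l m n' :: real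
    using that by simp
  ultimately show ?thesis unfolding power2_abs by blast
qed

lemma head_difference:
  "\<bar>(x + ck) * (\<Prod>h=1..head B. F h) - (x + c) * (\<Prod>h=1..head B. f h x)\<bar> \<le> head_const K1 B / (real q)\<^sup>2"
proof -
  define Z where "Z = (B + 3)\<^sup>2"
  define N where "N = head B"
  define K where "K = K1 * (B + 7)"
  have K: "K \<ge> 0" using K1 B0 by (simp add: K_def)
  have "(1::real)\<^sup>2 \<le> Z" unfolding Z_def using B0 by (intro power_mono) auto
  hence Z: "Z \<ge> 1" by simp
  have cy: "\<bar>c * y h\<bar> \<le> 1/2" for h
  proof -
    have "\<bar>c * y h\<bar> \<le> 1 * (1/2)" unfolding abs_mult using c abs_y by (intro mult_mono) auto
    thus ?thesis by simp
  qed
  have f: "\<bar>f h x\<bar> \<le> Z" if "h \<ge> 1" for h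
    using abs_factor_le[OF cy[of h] _ that, of "x + c/2"] x c unfolding sudler_factor_def Z_def by simp
  have F: "\<bar>F h\<bar> \<le> Z" if "h \<ge> 1" for h
    using abs_factor_le[OF abs_ck_u[of h] _ that, of w] abs_w
    unfolding F_def sudler_factor_def Z_def u_def w_def by simp
  have pw: "(\<Prod>h=1..N. g h) = Z ^ N * (\<Prod>h=1..N. g h / Z)" for g :: "nat \<Rightarrow> real"
    using Z by (simp add: prod_dividef)
  have "\<bar>(\<Prod>h=1..N. F h / Z) - (\<Prod>h=1..N. f h x / Z)\<bar> \<le> (\<Sum>h=1..N. \<bar>F h / Z - f h x / Z\<bar>)"
    using norm_prod_diff[of "{1..N}" "\<lambda>h. F h / Z" "\<lambda>h. f h x / Z"] F f Z by simp
  also have "\<dots> \<le> (\<Sum>h=1..N. K / (real q)\<^sup>2)"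
  proof (rule sum_mono)
    fix h assume h: "h \<in> {1..N}"
    have "\<bar>F h / Z - f h x / Z\<bar> = \<bar>F h - f h x\<bar> / Z" using Z by (simp flip: diff_divide_distrib)
    also have "\<dots> \<le> \<bar>F h - f h x\<bar> / 1" using Z by (intro divide_left_mono) auto
    also have "\<dots> \<le> K / (real q)\<^sup>2" using F_near_f[of h] h H(1) by (simp add: K_def N_def)
    finally show "\<bar>F h / Z - f h x / Z\<bar> \<le> K / (real q)\<^sup>2" .
  qed
  also have "\<dots> = real N * K / (real q)\<^sup>2" by simp
  finally have "Z ^ N * \<bar>(\<Prod>h=1..N. F h / Z) - (\<Prod>h=1..N. f h x / Z)\<bar> \<le> Z ^ N * (real N * K / (real q)\<^sup>2)"
    using Z by (intro mult_left_mono) auto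
  moreover have "(\<Prod>h=1..N. F h) - (\<Prod>h=1..N. f h x) = Z ^ N * ((\<Prod>h=1..N. F h / Z) - (\<Prod>h=1..N. f h x / Z))"
    unfolding pw[of F] pw[of "\<lambda>h. f h x"] by (simp only: right_diff_distrib)
  ultimately have 1: "\<bar>(\<Prod>h=1..N. F h) - (\<Prod>h=1..N. f h x)\<bar> \<le> Z ^ N * (real N * K / (real q)\<^sup>2)"
    using Z by (simp add: abs_mult)
  have 2: "\<bar>\<Prod>h=1..N. F h\<bar> \<le> Z ^ N"
  proof -
    have "(\<Prod>h=1..N. \<bar>F h\<bar>) \<le> (\<Prod>h=1..N. Z)" using F by (intro prod_mono) auto
    thus ?thesis by (simp add: abs_prod)
  qed
  have "(x + ck) * (\<Prod>h=1..N. F h) - (x + c) * (\<Prod>h=1..N. f h x)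
      = (ck - c) * (\<Prod>h=1..N. F h) + (x + c) * ((\<Prod>h=1..N. F h) - (\<Prod>h=1..N. f h x))"
    by (simp add: algebra_simps)
  moreover have "\<bar>(ck - c) * (\<Prod>h=1..N. F h)\<bar> \<le> (K1 / (real q)\<^sup>2) * Z ^ N"
    unfolding abs_mult using ck_c 2 K1 by (intro mult_mono) auto
  moreover have "\<bar>(x + c) * ((\<Prod>h=1..N. F h) - (\<Prod>h=1..N. f h x))\<bar> \<le> (B + 1) * (Z ^ N * (real N * K / (real q)\<^sup>2))"
    unfolding abs_mult using x c 1 B0 by (intro mult_mono) auto
  ultimately have "\<bar>(x + ck) * (\<Prod>h=1..N. F h) - (x + c) * (\<Prod>h=1..N. f h x)\<bar>
     \<le> (K1 / (real q)\<^sup>2) * Z ^ N + (B + 1) * (Z ^ N * (real N * K / (real q)\<^sup>2))" by linarith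
  also have "\<dots> = head_const K1 B / (real q)\<^sup>2"
    by (simp add: head_const_def Z_def N_def K_def divide_inverse algebra_simps)
  finally show ?thesis by (simp only: N_def)
qed

text \<open>Gathers positive quantities only, so that \<open>ln T\<close> can be compared with
  \<open>tail_log\<close>; all possible zeros stay in the head.\<close>

definition "T = sinc (pi * ((ck + x) / real q)) * (\<Prod>h=1..H. R h) * (\<Prod>h\<in>mid. \<rho> h) * (\<Prod>h=Suc (head B)..H. F h)"

lemma sinc_first: "\<bar>pi * ((ck + x) / real q)\<bar> \<le> 1/2" "(pi * ((ck + x) / real q))\<^sup>2 \<le> pi\<^sup>2 * (B + 1)\<^sup>2 * (1 / real H)"
proof -
  have "pi * \<bar>ck + x\<bar> \<le> pi * (B + 1)" using x ck by (intro mult_left_mono) auto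
  moreover have "pi * (B + 1) \<le> pi * (real H + B + 1)" by (intro mult_left_mono) auto
  ultimately have "pi * \<bar>ck + x\<bar> \<le> real q / 2" using H(4) by linarith
  moreover have "\<bar>pi * ((ck + x) / real q)\<bar> = pi * \<bar>ck + x\<bar> / real q" by (simp add: abs_mult)
  ultimately show "\<bar>pi * ((ck + x) / real q)\<bar> \<le> 1/2" using q0 by (simp only: pos_divide_le_eq)
  have "\<bar>ck + x\<bar>\<^sup>2 \<le> (B + 1)\<^sup>2" using x ck by (intro power_mono) auto
  moreover have "real H \<le> (real q)\<^sup>2" using mult_mono[of 1 "real q" "real H" "real q"] H_le_q H8 by (simp add: power2_eq_square)
  ultimately have "\<bar>ck + x\<bar>\<^sup>2 / (real q)\<^sup>2 \<le> (B + 1)\<^sup>2 / real H" using H8 by (intro frac_le) auto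
  hence "pi\<^sup>2 * (\<bar>ck + x\<bar>\<^sup>2 / (real q)\<^sup>2) \<le> pi\<^sup>2 * ((B + 1)\<^sup>2 / real H)" by (intro mult_left_mono) auto
  thus "(pi * ((ck + x) / real q))\<^sup>2 \<le> pi\<^sup>2 * (B + 1)\<^sup>2 * (1 / real H)"
    by (simp add: power_mult_distrib power_divide)
qed

lemma T_pos: "T > 0"
proof -
  have "(\<Prod>h=1..H. R h) > 0" using R_bounds(1) by (intro prod_pos) auto
  moreover have "(\<Prod>h=Suc (head B)..H. F h) > 0" using zeta(4) by (intro prod_pos) auto
  moreover have "sinc (pi * ((ck + x) / real q)) > 0" using sinc_bounds(3)[OF sinc_first(1)] by linarith
  ultimately show ?thesis unfolding T_def using prod_rho_mid_pos by (intro mult_pos_pos)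
qed

lemma product_head_tail:
  "sudler_product q q' ck x = 2 * pi * \<bar>(x + ck) * (\<Prod>h=1..head B. F h)\<bar> * T"
proof -
  have "(\<Prod>h=1..H. \<rho> h * \<rho> (q - h)) = (\<Prod>h=1..H. \<bar>F h\<bar>) * (\<Prod>h=1..H. R h)"
    unfolding prod.distrib[symmetric] by (rule prod.cong) (use rho_pair in \<open>auto simp: prod.distrib\<close>)
  moreover have "(\<Prod>h=1..H. \<bar>F h\<bar>) = \<bar>\<Prod>h=1..head B. F h\<bar> * (\<Prod>h=Suc (head B)..H. F h)"
  proof -
    have "(\<Prod>h=1..H. \<bar>F h\<bar>) = (\<Prod>h=1..head B. \<bar>F h\<bar>) * (\<Prod>h=Suc (head B)..H. \<bar>F h\<bar>)"
      using prod.ub_add_nat[of 1 "head B" "\<lambda>h. \<bar>F h\<bar>" "H - head B"] H(1) by simp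
    moreover have "(\<Prod>h=Suc (head B)..H. \<bar>F h\<bar>) = (\<Prod>h=Suc (head B)..H. F h)"
      using zeta(4) by (intro prod.cong) (auto simp: less_imp_le)
    ultimately show ?thesis by (simp add: abs_prod)
  qed
  moreover have "\<bar>2 * sin (pi * ((ck + x) / real q))\<bar> * real q = 2 * pi * \<bar>x + ck\<bar> * sinc (pi * ((ck + x) / real q))"
  proof -
    have "sinc (pi * ((ck + x) / real q)) > 0" using sinc_bounds(3)[OF sinc_first(1)] by linarith
    thus ?thesis unfolding sin_eq_sinc using q0 by (simp add: abs_mult add.commute)
  qed
  ultimately show ?thesis
    unfolding product_eq prod_rho_split T_def mid_def[symmetric] by (simp add: abs_mult mult_ac)
qed

lemma ln_T: "\<bar>ln T - tail_log B x\<bar> \<le> rate_const K1 B * (cube_err + log_err)"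
proof -
  define D where "D = log_err"
  define Q where "Q = cube_err"
  define s where "s = sinc (pi * ((ck + x) / real q))"
  have D: "1 / real H \<le> D" "D \<ge> 0" using ln_q by (auto simp: D_def intro!: divide_right_mono)
  have Q: "Q \<ge> 0" by (simp add: Q_def)
  have s: "s > 0" using sinc_bounds(3)[OF sinc_first(1)] unfolding s_def by linarith
  have R: "(\<Prod>h=1..H. R h) > 0" using R_bounds(1) by (intro prod_pos) auto
  have F: "(\<Prod>h=Suc (head B)..H. F h) > 0" using zeta(4) by (intro prod_pos) auto
  have "ln T = ln s + ln (\<Prod>h=1..H. R h) + ln (\<Prod>h\<in>mid. \<rho> h) + ln (\<Prod>h=Suc (head B)..H. F h)"
  proof -
    have "ln (v1 * v2 * v3 * v4) = ln v1 + ln v2 + ln v3 + ln v4"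
      if "v1 > 0" "v2 > 0" "v3 > 0" "v4 > 0" for v1 v2 v3 v4 :: real
      using that by (simp add: ln_mult)
    thus ?thesis unfolding T_def s_def[symmetric] using s R F prod_rho_mid_pos by blast
  qed
  moreover have "\<bar>ln s\<bar> \<le> 2 * pi\<^sup>2 * (B + 1)\<^sup>2 * D"
  proof -
    have "pi\<^sup>2 * (B + 1)\<^sup>2 * (1 / real H) \<le> pi\<^sup>2 * (B + 1)\<^sup>2 * D" using D by (intro mult_left_mono) auto
    thus ?thesis using abs_ln_sinc_le[OF sinc_first(1)] sinc_first(2) unfolding s_def by linarith
  qed
  moreover note ln_prod_R[folded Q_def] ln_prod_rho_mid[folded D_def] ln_prod_F[folded D_def]
  moreover have "\<bar>l1 + l2 + l3 + l4 - l\<bar> \<le> a1 + a2 + a3 + a4"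
    if "\<bar>l1\<bar> \<le> a1" "\<bar>l2\<bar> \<le> a2" "\<bar>l3\<bar> \<le> a3" "\<bar>l4 - l\<bar> \<le> a4" for l1 l2 l3 l4 l a1 a2 a3 a4 :: real
    using that by linarith
  ultimately have 1: "\<bar>ln T - tail_log B x\<bar> \<le> 2 * pi\<^sup>2 * (B + 1)\<^sup>2 * D + 8 * pi\<^sup>2 * (B + 2)\<^sup>2 * Q
     + (4 * K1 + (8 + 3 * pi\<^sup>2) * (B + 1)\<^sup>2) * D + (4 * (K1 * (B + 7)) + 2 * tail_const B) * D"
    by simp
  have "rate_const K1 B * (Q + D) = 2 * pi\<^sup>2 * (B + 1)\<^sup>2 * D + 8 * pi\<^sup>2 * (B + 2)\<^sup>2 * Q
     + (4 * K1 + (8 + 3 * pi\<^sup>2) * (B + 1)\<^sup>2) * D + (4 * (K1 * (B + 7)) + 2 * tail_const B) * D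
     + (rate_const K1 B - 8 * pi\<^sup>2 * (B + 2)\<^sup>2) * Q + 8 * pi\<^sup>2 * (B + 2)\<^sup>2 * D"
    unfolding rate_const_def by (simp only: distrib_right distrib_left left_diff_distrib)
  moreover have "(rate_const K1 B - 8 * pi\<^sup>2 * (B + 2)\<^sup>2) * Q \<ge> 0"
    unfolding rate_const_def using Q K1 B0 tail_const_pos[of B] by (intro mult_nonneg_nonneg) auto
  moreover have "8 * pi\<^sup>2 * (B + 2)\<^sup>2 * D \<ge> 0" using D by simp
  ultimately show ?thesis using 1 unfolding D_def[symmetric] Q_def[symmetric] by linarith
qed

text \<open>The multiplicative error comes from exponentiating \<open>ln T - tail_log B x\<close>,
  the additive one from the head, multiplied by the bounded \<open>T\<close>. The constants see
  \<open>x\<close> only through \<open>B\<close>.\<close>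

lemma rate:
  assumes "rate_const K1 B * (cube_err + log_err) \<le> 1"
  shows "\<exists>e e'. sudler_product q q' ck x = (1 + e) * G x + e' \<and>
     \<bar>e\<bar> \<le> 2 * rate_const K1 B * (cube_err + log_err) \<and>
     \<bar>e'\<bar> \<le> 2 * pi * head_const K1 B * exp (tail_const B * log_rate (head B) + 1) / (real q)\<^sup>2"
proof -
  define \<epsilon> where "\<epsilon> = rate_const K1 B * (cube_err + log_err)"
  define d where "d = ln T - tail_log B x"
  define L where "L = exp (tail_log B x)"
  define A where "A = (x + ck) * (\<Prod>h=1..head B. F h)"
  define A' where "A' = (x + c) * (\<Prod>h=1..head B. f h x)"
  define e where "e = exp d - 1"
  define e' where "e' = 2 * pi * (\<bar>A\<bar> - \<bar>A'\<bar>) * T"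
  have d: "\<bar>d\<bar> \<le> \<epsilon>" "\<epsilon> \<le> 1" using ln_T assms by (auto simp: d_def \<epsilon>_def)
  have T: "T = exp (tail_log B x + d)" using T_pos by (simp add: d_def)
  have "sudler_product q q' ck x = (1 + e) * G x + e'"
  proof -
    have "G x = (2 * pi * \<bar>A'\<bar>) * L" using G_eq[OF x] by (simp add: A'_def L_def)
    moreover have "T = L * exp d" by (simp add: T L_def exp_add)
    ultimately show ?thesis
      unfolding product_head_tail A_def[symmetric] e_def e'_def by (simp add: algebra_simps)
  qed
  moreover have "\<bar>e\<bar> \<le> 2 * \<epsilon>"
  proof -
    have "\<bar>exp d - exp 0\<bar> \<le> 2 * exp 0 * \<bar>d - 0\<bar>" using d by (intro abs_exp_diff_le) auto
    thus ?thesis using d by (simp add: e_def)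
  qed
  moreover have "\<bar>e'\<bar> \<le> (2 * pi * (head_const K1 B / (real q)\<^sup>2)) * exp (tail_const B * log_rate (head B) + 1)"
  proof -
    have "\<bar>\<bar>A\<bar> - \<bar>A'\<bar>\<bar> \<le> \<bar>A - A'\<bar>" by (rule abs_triangle_ineq3)
    hence "\<bar>\<bar>A\<bar> - \<bar>A'\<bar>\<bar> \<le> head_const K1 B / (real q)\<^sup>2"
      using head_difference unfolding A_def A'_def by linarith
    hence m: "2 * pi * \<bar>\<bar>A\<bar> - \<bar>A'\<bar>\<bar> \<le> 2 * pi * (head_const K1 B / (real q)\<^sup>2)"
      by (rule mult_left_mono) simp
    have T': "T \<le> exp (tail_const B * log_rate (head B) + 1)"
      unfolding T using abs_tail_log[OF x] d by simp
    have "0 \<le> 2 * pi * \<bar>\<bar>A\<bar> - \<bar>A'\<bar>\<bar>" by simp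
    hence "0 \<le> 2 * pi * (head_const K1 B / (real q)\<^sup>2)" using m by (rule order.trans)
    hence "2 * pi * \<bar>\<bar>A\<bar> - \<bar>A'\<bar>\<bar> * T
        \<le> (2 * pi * (head_const K1 B / (real q)\<^sup>2)) * exp (tail_const B * log_rate (head B) + 1)"
      using T_pos by (intro mult_mono[OF m T']) auto
    moreover have "\<bar>e'\<bar> = 2 * pi * \<bar>\<bar>A\<bar> - \<bar>A'\<bar>\<bar> * T" using T_pos by (simp add: e'_def abs_mult)
    ultimately show ?thesis by simp
  qed
  ultimately show ?thesis unfolding \<epsilon>_def by (intro exI[of _ e] exI[of _ e']) (simp add: mult_ac)
qed

end

section \<open>Perturbed Sudler products along the period\<close>

abbreviation (input) "rate_err z \<equiv> z powr (-1/2) * ln z powr (3/4)"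

context sudler_limit
begin

text \<open>The hypotheses of \<open>sudler_finite\<close> apart from the sign of \<open>K1\<close>
  and the bounds on \<open>H\<close> and \<open>q\<close>; the truncation point is chosen from
  \<open>q\<close> alone, which keeps the estimate uniform in the remaining data.\<close>

definition admissible :: "real \<Rightarrow> real \<Rightarrow> nat \<Rightarrow> int \<Rightarrow> real \<Rightarrow> real \<Rightarrow> bool" where
  "admissible K1 B q q' ck x \<longleftrightarrow> coprime q' (int q) \<and> 0 < ck \<and> ck \<le> 1 \<and> \<bar>ck - c\<bar> \<le> K1 / (real q)\<^sup>2 \<and>
     \<bar>real_of_int q' / real q - \<beta>\<bar> \<le> K1 / (real q)\<^sup>2 \<and>
     (\<forall>N. 1 \<le> N \<longrightarrow> N < q \<longrightarrow>
        \<bar>\<Sum>n=1..N. frac (real n * (real_of_int q' / real q)) - 1/2\<bar> \<le> K1 * (1 + ln (real N))) \<and>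
     \<bar>x\<bar> \<le> B"

lemma eventually_rate:
  assumes K1: "K1 \<ge> 0" and B: "B \<ge> 0"
  shows "\<exists>K\<ge>0. \<exists>Q0. \<forall>(q::nat)\<ge>Q0. \<forall>q' ck x. admissible K1 B q q' ck x \<longrightarrow>
     (\<exists>e e'. sudler_product q q' ck x = (1 + e) * G x + e' \<and>
        \<bar>e\<bar> \<le> K * rate_err (real q) \<and>
        \<bar>e'\<bar> \<le> K * real q powr (-2))"
proof -
  define Rc where "Rc = rate_const K1 B"
  define g where "g z = z powr (1/2) * ln z powr (1/4)" for z :: real
  define err where "err z = (g z + 1) ^ 3 / z\<^sup>2 + (1 + ln z) / g z" for z :: real
  define K where "K = 20 * Rc + 2 * pi * head_const K1 B * exp (tail_const B * log_rate (head B) + 1)"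
  have hc: "head_const K1 B \<ge> 0" using K1 B by (simp add: head_const_def)
  have Rc: "Rc \<ge> 0" using K1 B tail_const_pos[of B] by (simp add: Rc_def rate_const_def)
  have K: "K \<ge> 0" "20 * Rc \<le> K" "2 * pi * head_const K1 B * exp (tail_const B * log_rate (head B) + 1) \<le> K"
    using hc Rc by (simp_all add: K_def)
  have l1: "filterlim g at_top at_top" unfolding g_def by real_asymp
  have l2: "((\<lambda>z. (g z + 1) / z) \<longlongrightarrow> 0) at_top" unfolding g_def by real_asymp
  have l3: "(err \<longlongrightarrow> 0) at_top" unfolding err_def g_def by real_asymp
  \<comment> \<open>Both summands of \<open>err\<close> are asymptotic to \<open>rate_err\<close>,
    so any constant above 2 holds eventually.\<close>
  have l4: "eventually (\<lambda>z. err z \<le> 10 * rate_err z) at_top"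
    unfolding err_def g_def by real_asymp
  have l2': "eventually (\<lambda>z. d * ((g z + 1) / z) < e) at_top" if "e > 0" for d e :: real
  proof -
    have "((\<lambda>z. d * ((g z + 1) / z)) \<longlongrightarrow> d * 0) at_top" by (intro tendsto_intros l2)
    thus ?thesis by (rule order_tendstoD) (use that in simp)
  qed
  have l3': "eventually (\<lambda>z. Rc * err z < 1) at_top"
  proof -
    have "((\<lambda>z. Rc * err z) \<longlongrightarrow> Rc * 0) at_top" by (intro tendsto_intros l3)
    thus ?thesis by (rule order_tendstoD) simp
  qed
  \<comment> \<open>Conditions stated with \<open>g z + 1\<close>, which dominates
    \<open>H = \<lceil>g z\<rceil>\<close>. They hold eventually because \<open>g z\<close> tends to
    infinity but is of smaller order than \<open>z\<close>.\<close>
  define large where "large z \<longleftrightarrow> real (head B) \<le> g z \<and> 8 * (B + 1) \<le> g z \<and> B + 1 \<le> g z \<and> 1 \<le> g z \<and>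
      2 * ((g z + 1) / z) < 1 \<and> (2 * pi) * ((g z + 1) / z) < 1/2 \<and> K1 * ((g z + 1) / z) < 1 \<and>
      8 * (K1 * (B + 7)) \<le> z \<and> 1 \<le> z \<and> Rc * err z < 1 \<and>
      err z \<le> 10 * rate_err z" for z
  have "eventually large at_top"
    unfolding large_def[abs_def]
    by (intro eventually_conj l2' l3' l4 eventually_ge_at_top filterlim_at_top[THEN iffD1, rule_format, OF l1]) auto
  hence "eventually (\<lambda>q::nat. large q) sequentially"
    using filterlim_real_sequentially by (rule eventually_compose_filterlim)
  then obtain Q0 :: nat where Q0: "\<And>q. q \<ge> Q0 \<Longrightarrow> large q"
    unfolding eventually_sequentially by blast
  show ?thesis
  proof (rule exI[of _ K], intro conjI K(1), rule exI[of _ Q0], intro allI impI)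
    fix q :: nat and q' :: int and ck x :: real
    assume "q \<ge> Q0" and adm: "admissible K1 B q q' ck x"
    define gq where "gq = g q"
    define H where "H = nat \<lceil>gq\<rceil>"
    from Q0[OF \<open>q \<ge> Q0\<close>] have g: "real (head B) \<le> gq" "8 * (B + 1) \<le> gq" "B + 1 \<le> gq" "1 \<le> gq"
      "2 * ((gq + 1) / q) < 1" "(2 * pi) * ((gq + 1) / q) < 1/2" "K1 * ((gq + 1) / q) < 1"
      "8 * (K1 * (B + 7)) \<le> real q" "1 \<le> real q" "Rc * err q < 1"
      "err q \<le> 10 * rate_err (real q)"
      unfolding gq_def large_def by auto
    have q0: "real q > 0" using g(9) by linarith
    have H: "gq \<le> real H" "real H \<le> gq + 1" unfolding H_def using g(4) by linarith+
    have H2: "2 * real H < real q"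
    proof -
      have "2 * (gq + 1) < real q" using g(5) q0 by (simp add: field_simps)
      moreover have "2 * real H \<le> 2 * (gq + 1)" using H(2) by (rule mult_left_mono) simp
      ultimately show ?thesis by (rule le_less_trans[rotated])
    qed
    have err: "real H ^ 3 / (real q)\<^sup>2 + (1 + ln (real q)) / real H \<le> err q"
      unfolding err_def gq_def[symmetric]
    proof (intro add_mono divide_right_mono divide_left_mono power_mono)
      show "0 \<le> 1 + ln (real q)" using g(9) by simp
      show "0 < real H * gq" using H g(4) by (intro mult_pos_pos) linarith+
    qed (use H g(4) in auto)
    interpret sudler_finite \<beta> c K0 q q' ck K1 B x H
    proof unfold_locales
      show "head B \<le> H" using g(1) H(1) by linarith
      show "2 * H < q" using H2 by linarith
      show "8 * (B + 1) \<le> real H" using g(2) H(1) by linarith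
      show "pi * (real H + B + 1) \<le> real q / 2"
      proof -
        have "pi * (real H + B + 1) \<le> pi * (2 * (gq + 1))" using H g(3) by (intro mult_left_mono) auto
        also have "\<dots> \<le> real q / 2" using g(6) q0 by (simp add: field_simps)
        finally show ?thesis .
      qed
      show "K1 * real H < real q"
      proof -
        have "K1 * real H \<le> K1 * (gq + 1)" using H K1 by (intro mult_left_mono) auto
        also have "\<dots> < real q" using g(7) q0 by (simp add: field_simps)
        finally show ?thesis .
      qed
      have "real q * 1 \<le> real q * real q" using g(9) by (intro mult_left_mono) auto
      thus "8 * (K1 * (B + 7)) \<le> (real q)\<^sup>2" using g(8) unfolding power2_eq_square by linarith
    qed (use adm K1 in \<open>auto simp: admissible_def\<close>)
    have "Rc * (cube_err + log_err) \<le> Rc * err q"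
      using err Rc by (rule mult_left_mono)
    hence "Rc * (cube_err + log_err) \<le> 1" using g(10) by linarith
    from rate[folded Rc_def, OF this] obtain e e' where e: "sudler_product q q' ck x = (1 + e) * G x + e'"
     "\<bar>e\<bar> \<le> 2 * Rc * (cube_err + log_err)"
     "\<bar>e'\<bar> \<le> 2 * pi * head_const K1 B * exp (tail_const B * log_rate (head B) + 1) / (real q)\<^sup>2"
      by blast
    define \<epsilon> where "\<epsilon> = real q powr (-1/2) * ln q powr (3/4)"
    have \<epsilon>: "\<epsilon> \<ge> 0" by (simp add: \<epsilon>_def)
    have "2 * Rc * (cube_err + log_err) \<le> 2 * Rc * (10 * \<epsilon>)"
      using order.trans[OF err g(11)] Rc unfolding \<epsilon>_def by (intro mult_left_mono) auto
    moreover have "20 * Rc * \<epsilon> \<le> K * \<epsilon>" using K(2) \<epsilon> by (rule mult_right_mono)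
    ultimately have "\<bar>e\<bar> \<le> K * \<epsilon>" using e(2) by linarith
    moreover have "\<bar>e'\<bar> \<le> K * real q powr (-2)"
    proof -
      have "\<bar>e'\<bar> \<le> K / (real q)\<^sup>2" using e(3) divide_right_mono[OF K(3), of "(real q)\<^sup>2"] by simp
      also have "\<dots> = K * real q powr (-2)"
        using q0 by (simp add: powr_minus powr_numeral divide_inverse)
      finally show ?thesis .
    qed
    ultimately show "\<exists>e e'. sudler_product q q' ck x = (1 + e) * G x + e' \<and>
        \<bar>e\<bar> \<le> K * rate_err (real q) \<and> \<bar>e'\<bar> \<le> K * real q powr (-2)"
      using e(1) unfolding \<epsilon>_def by blast
  qed
qed

end

section \<open>From the perturbed product to a product over residues\<close>

lemma abs_sin_add_int: "\<bar>sin (pi * (real_of_int i + z))\<bar> = \<bar>sin (pi * z)\<bar>"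
proof -
  have s: "sin (pi * real_of_int i) = 0" by (simp add: sin_zero_iff_int2 mult.commute)
  hence "\<bar>cos (pi * real_of_int i)\<bar> = 1" using sin_zero_abs_cos_one by blast
  thus ?thesis using s by (simp add: distrib_left sin_add abs_mult)
qed

lemma abs_sin_sign: "\<bar>sin (pi * ((-1) ^ k * z))\<bar> = \<bar>sin (pi * z)\<bar>"
  by (cases "even k") auto

text \<open>With \<open>n = q' h\<close> modulo \<open>q\<close>, the determinant identity gives
  \<open>n p = (-1)^j h\<close> modulo \<open>q\<close>. Hence \<open>n \<alpha>\<close> is
  \<open>(-1)^j (h - n \<delta>) / q\<close> up to an integer, where \<open>n / q\<close> is the
  fractional part of \<open>h q'/q\<close>. The alternating sign of the perturbation lets one sign
  factor out of the argument.\<close>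

lemma (in pos_cf) perturbed_sudler_eq:
  fixes j :: nat
  defines "q \<equiv> nat (cf_den a (Suc j))"
  shows "perturbed_sudler a (Suc j) x
       = sudler_product q (cf_den a j) (den (Suc j) * cf_delta a (Suc j)) x"
proof -
  define p where "p = cf_num a (Suc j)"
  define q' where "q' = cf_den a j"
  define p' where "p' = cf_num a j"
  define \<delta> where "\<delta> = cf_delta a (Suc j)"
  define \<alpha> where "\<alpha> = cf_value a"
  have q: "q > 0" "int q = cf_den a (Suc j)" "den (Suc j) = real q"
    using cf_den_pos[of "Suc j"] by (simp_all add: q_def del: cf_den.simps)
  have det: "p * q' - p' * int q = (-1) ^ j"
    using cf_det[of a j] unfolding p_def q'_def p'_def q(2) .
  have cop: "coprime q' (int q)" unfolding q'_def q(2) by (rule coprime_cf_den_Suc)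
  have \<alpha>: "real q * \<alpha> = real_of_int p + (-1) ^ Suc j * \<delta>"
  proof -
    have "(-1) ^ Suc j * \<delta> = ((-1) ^ Suc j * (-1) ^ Suc j) * (real q * \<alpha> - real_of_int p)"
      by (simp only: \<delta>_def cf_delta_def q(3) \<alpha>_def p_def mult.assoc)
    also have "(-1) ^ Suc j * (-1) ^ Suc j = (1::real)" by (simp flip: power_add)
    finally show ?thesis by simp
  qed
  define \<phi> where "\<phi> n = \<bar>2 * sin (pi * (real n * \<alpha> + (-1) ^ Suc j * x / real q))\<bar>" for n
  have "perturbed_sudler a (Suc j) x = (\<Prod>n=1..q. \<phi> n)"
    unfolding perturbed_sudler_def \<phi>_def q(3) q_def \<alpha>_def ..
  also have "{1..q} = insert q {1..<q}" using q(1) by auto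
  hence "(\<Prod>n=1..q. \<phi> n) = \<phi> q * (\<Prod>n=1..<q. \<phi> n)" by simp
  also have "\<phi> q = \<bar>2 * sin (pi * ((real q * \<delta> + x) / real q))\<bar>"
  proof -
    have "real q * \<alpha> + (-1) ^ Suc j * x / real q = real_of_int p + (-1) ^ Suc j * ((real q * \<delta> + x) / real q)"
      unfolding \<alpha> using q(1) by (simp add: field_simps)
    thus ?thesis unfolding \<phi>_def abs_mult by (simp only: abs_sin_add_int abs_sin_sign)
  qed
  also have "(\<Prod>n=1..<q. \<phi> n) = (\<Prod>h=1..<q. \<phi> (nat ((q' * int h) mod int q)))"
  proof -
    let ?f = "\<lambda>h. nat ((q' * int h) mod int q)"
    have "bij_betw ?f {..<q} {..<q}" using bij_betw_affine_mod[OF cop q(1), of 0] by simp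
    hence "bij_betw ?f ({..<q} - {0}) ({..<q} - {?f 0})"
      using q(1) by (intro bij_betw_DiffI) (auto simp: bij_betw_def)
    moreover have "{..<q} - {0} = {1..<q}" by auto
    ultimately have "bij_betw ?f {1..<q} {1..<q}" by simp
    thus ?thesis by (rule prod.reindex_bij_betw[symmetric])
  qed
  also have "\<dots> = (\<Prod>h=1..<q. \<bar>2 * sin (pi * ((real h - (real q * \<delta>) * frac (real h * (real_of_int q' / real q)) - x) / real q))\<bar>)"
  proof (rule prod.cong[OF refl])
    fix h assume "h \<in> {1..<q}"
    define d where "d = (q' * int h) div int q"
    define n where "n = (q' * int h) mod int q"
    have n0: "0 \<le> n" "n < int q" using q(1) by (auto simp: n_def)
    have n: "q' * int h = d * int q + n" by (simp add: d_def n_def)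
    have fr: "frac (real h * (real_of_int q' / real q)) = real_of_int n / real q"
      using frac_of_int_divide[OF q(1), of "q' * int h"] by (simp add: n_def mult.commute)
    have np: "n * p = (-1) ^ j * int h + int q * (int h * p' - d * p)"
    proof -
      have n': "n = q' * int h - d * int q" using n by simp
      show ?thesis unfolding n' det[symmetric] by (simp add: algebra_simps)
    qed
    hence np': "real_of_int n * real_of_int p = (-1) ^ j * real h + real q * real_of_int (int h * p' - d * p)"
      using arg_cong[OF np, of real_of_int] by simp
    have "real_of_int n * (real q * \<alpha>) = real_of_int n * real_of_int p + (-1) ^ Suc j * (real_of_int n * \<delta>)"
      unfolding \<alpha> by (simp add: algebra_simps)
    hence "real q * (real_of_int n * \<alpha>) + (-1) ^ Suc j * x
        = real q * real_of_int (int h * p' - d * p) + (-1) ^ j * (real h - real_of_int n * \<delta> - x)"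
      unfolding np' by (simp add: algebra_simps)
    moreover have "v + y / real q = i + w * (z / real q)" if "real q * v + y = real q * i + w * z" for v y i w z
    proof -
      have "(real q * v + y) / real q = (real q * i + w * z) / real q" unfolding that ..
      thus ?thesis using q(1) by (simp add: add_divide_distrib)
    qed
    ultimately have "real_of_int n * \<alpha> + (-1) ^ Suc j * x / real q
        = real_of_int (int h * p' - d * p) + (-1) ^ j * ((real h - real_of_int n * \<delta> - x) / real q)"
      by blast
    moreover have "real (nat n) = real_of_int n" using n0 by simp
    moreover have "(real q * \<delta>) * (real_of_int n / real q) = real_of_int n * \<delta>" using q(1) by simp
    ultimately show "\<phi> (nat ((q' * int h) mod int q)) =
        \<bar>2 * sin (pi * ((real h - (real q * \<delta>) * frac (real h * (real_of_int q' / real q)) - x) / real q))\<bar>"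
      unfolding \<phi>_def fr n_def[symmetric] abs_mult by (simp only: abs_sin_add_int abs_sin_sign)
  qed
  finally show ?thesis
    unfolding sudler_product_def \<delta>_def[symmetric] q(3) q'_def[symmetric] .
qed

context periodic_cf_residue
begin

section \<open>The reversed period and the approximation of \<open>alpha_rev\<close>\<close>

definition "b n = (if n = 0 then 0 else a (s + r + p - (n - 1) mod p))"

lemma b_pos: "pos_cf b"
proof
  fix n :: nat assume "n \<ge> 1"
  moreover have "(n - 1) mod p < p" using p1 by simp
  hence "s + r + p - (n - 1) mod p \<ge> 1" using r1 by linarith
  ultimately show "b n \<ge> 1" unfolding b_def using pos by simp
qed

lemma alpha_rev_eq: "alpha_rev a s p r = cf_value b"
  by (simp add: alpha_rev_def b_def[abs_def])

lemma periodic_shift: "n > s \<Longrightarrow> a (n + m * p) = a n"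
proof (induction m)
  case (Suc m)
  have "\<forall>n>s. a (n + p) = a n" using periodic by (simp add: periodic_cf_def)
  hence "a (n + m * p + p) = a (n + m * p)" using Suc.prems by (simp only: trans_less_add1)
  thus ?case using Suc by (simp add: ac_simps)
qed auto

text \<open>The reversed period is \<open>a\<close> read downwards from \<open>ix m\<close>. The
  condition \<open>i \<le> m * p + r\<close> says that the index on the right exceeds
  \<open>s\<close>, so that periodicity applies.\<close>

lemma b_reverse:
  assumes "1 \<le> i" "i \<le> m * p + r"
  shows "b i = a (Suc (ix m) - i)"
proof -
  define d where "d = (i - 1) div p"
  define e where "e = (i - 1) mod p"
  have i: "i = Suc (d * p + e)" using assms(1) by (simp add: d_def e_def)
  have e: "e < p" using p1 by (simp add: e_def)
  have "a (s + r + p - e + m * p) = a (s + r + p - e)"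
    using e r1 by (intro periodic_shift) linarith
  moreover have "a (Suc (ix m) - i + Suc d * p) = a (Suc (ix m) - i)"
    using assms by (intro periodic_shift) linarith
  moreover have "s + r + p - e + m * p = Suc (ix m) - i + Suc d * p"
    using assms e unfolding i by simp
  ultimately show ?thesis using assms(1) by (simp add: b_def e_def)
qed

text \<open>Reversal down to \<open>Suc s\<close> writes \<open>q_k\<close> and
  \<open>q_(k-1)\<close> as combinations of two consecutive convergents of \<open>b\<close> with the
  fixed weights \<open>q_(s+1)\<close> and \<open>q_s\<close>. Hence
  \<open>q_k * cf_value b - q_(k-1)\<close> is \<open>O(1/Q)\<close>, and \<open>Q\<close> is at
  least a constant times \<open>q_k\<close>.\<close>

lemma reverse_quotient:
  assumes "m \<ge> 1"
  shows "\<bar>den (ix m - 1) / den (ix m) - cf_value b\<bar>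
     \<le> (den (Suc s) + den s)\<^sup>2 / (den (ix m))\<^sup>2"
proof -
  interpret b: pos_cf b by (rule b_pos)
  define k where "k = s + m * p + r"
  define j where "j = m * p + r - 2"
  define q where "q = den k"
  define q1 where "q1 = den (Suc s)"
  define q2 where "q2 = den s"
  define Q where "Q = real_of_int (cf_den b (Suc j))"
  have "1 * 1 \<le> m * p" using assms p1 by (intro mult_mono) auto
  hence mp: "m * p + r \<ge> 2" using r1 by linarith
  have kj: "Suc j < k" "k - Suc j = Suc s" "k - Suc j - 1 = s" "Suc j + 1 = m * p + r"
    using mp by (auto simp: k_def j_def)
  have rev: "cf_den a k = cf_den b (Suc j) * cf_den a (Suc s) + cf_den b j * cf_den a s"
     "cf_den a (k - 1) = cf_num b (Suc j) * cf_den a (Suc s) + cf_num b j * cf_den a s"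
    using cf_den_reverse[of b j a k] b_reverse[of _ m] kj unfolding k_def by (auto simp: b_def)
  have pos': "q > 0" "q1 > 0" "q2 > 0" "Q > 0"
    using cf_den_pos[of k] cf_den_pos[of s] cf_den_pos[of "Suc s"] b.cf_den_pos[of "Suc j"]
    unfolding q_def q1_def q2_def Q_def by linarith+
  have Qj: "real_of_int (cf_den b j) \<le> Q" using b.cf_den_Suc_ge[of j] unfolding Q_def by linarith
  have "q = Q * q1 + real_of_int (cf_den b j) * q2" unfolding q_def rev(1) by (simp add: Q_def q1_def q2_def)
  also have "\<dots> \<le> Q * q1 + Q * q2" using Qj pos' by (intro add_mono mult_right_mono) auto
  finally have qle: "q \<le> (q1 + q2) * Q" by (simp add: algebra_simps)
  define \<beta> where "\<beta> = cf_value b"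
  have "q * \<beta> - den (k - 1) =
     q1 * (Q * \<beta> - real_of_int (cf_num b (Suc j))) + q2 * (real_of_int (cf_den b j) * \<beta> - real_of_int (cf_num b j))"
    unfolding q_def rev by (simp add: q1_def q2_def Q_def algebra_simps)
  moreover have "\<bar>q1 * (Q * \<beta> - real_of_int (cf_num b (Suc j)))\<bar> \<le> q1 * (1 / Q)"
    unfolding abs_mult Q_def \<beta>_def b.abs_cf_delta using b.cf_delta_le[of "Suc j"] pos'
    by (intro mult_mono) (auto simp: less_imp_le[OF b.cf_delta_pos])
  \<comment> \<open>For the earlier convergent the sharper bound by the next denominator is used, so
    that both errors are over the same \<open>Q\<close>.\<close>
  moreover have "\<bar>q2 * (real_of_int (cf_den b j) * \<beta> - real_of_int (cf_num b j))\<bar> \<le> q2 * (1 / Q)"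
    unfolding abs_mult \<beta>_def b.abs_cf_delta using b.cf_den_Suc_delta_le[of j] pos'
    by (intro mult_mono) (auto simp: less_imp_le[OF b.cf_delta_pos] Q_def field_simps simp del: cf_den.simps)
  ultimately have "\<bar>q * \<beta> - den (k - 1)\<bar> \<le> q1 * (1 / Q) + q2 * (1 / Q)" by linarith
  also have "\<dots> = (q1 + q2) / Q" by (simp add: add_divide_distrib)
  also have "\<dots> \<le> (q1 + q2)\<^sup>2 / q"
  proof -
    have "(q1 + q2) * q \<le> (q1 + q2) * ((q1 + q2) * Q)" using qle pos' by (intro mult_left_mono) auto
    thus ?thesis using pos' by (simp add: field_simps power2_eq_square)
  qed
  finally have 1: "\<bar>q * \<beta> - den (k - 1)\<bar> \<le> (q1 + q2)\<^sup>2 / q" .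
  have "den (k - 1) / q - \<beta> = - (q * \<beta> - den (k - 1)) / q"
    using pos' by (simp add: field_simps)
  hence "\<bar>den (k - 1) / q - \<beta>\<bar> = \<bar>q * \<beta> - den (k - 1)\<bar> / q"
    using pos' by (simp only: abs_divide abs_minus_cancel abs_of_pos)
  also have "\<dots> \<le> ((q1 + q2)\<^sup>2 / q) / q" using 1 pos' by (intro divide_right_mono) auto
  also have "\<dots> = (q1 + q2)\<^sup>2 / q\<^sup>2" by (simp add: power2_eq_square)
  finally show ?thesis unfolding q1_def q2_def q_def k_def \<beta>_def .
qed

lemma b_bounded: "\<exists>A\<ge>1. \<forall>n\<ge>1. b n \<le> A"
proof (intro exI[of _ "Max (insert 1 (a ` {..s + r + p}))"] conjI allI impI)
  fix n :: nat assume "n \<ge> 1"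
  thus "b n \<le> Max (insert 1 (a ` {..s + r + p}))"
    by (intro Max_ge) (auto simp: b_def)
qed (auto intro: Max_ge)

text \<open>One bound concerns the limit slope, the other, with a single constant, all slopes within
  \<open>K2 / q^2\<close> of it. Convergents of \<open>b\<close> serve for both: their denominators
  satisfy \<open>Q \<le> N < q\<close>, so \<open>K2 / q^2 \<le> K2 / Q^2\<close> only worsens the
  constant of approximation.\<close>

lemma sudler_limit_exists: "\<exists>K0. sudler_limit (alpha_rev a s p r) c K0 \<and>
   (\<forall>K2\<ge>0. \<exists>K3. \<forall>\<gamma> q. \<bar>\<gamma> - alpha_rev a s p r\<bar> \<le> K2 / (real q)\<^sup>2 \<longrightarrow> (\<forall>N. 1 \<le> N \<longrightarrow> N < q \<longrightarrow>
        \<bar>\<Sum>n=1..N. frac (real n * \<gamma>) - 1/2\<bar> \<le> K3 * (1 + ln (real N))))"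
proof -
  interpret b: pos_cf b by (rule b_pos)
  obtain A where A: "A \<ge> 1" "\<And>n. n \<ge> 1 \<Longrightarrow> b n \<le> A" using b_bounded by blast
  have A1: "real_of_int A + 1 > 1" using A(1) by linarith
  have gen: "\<bar>\<Sum>n=1..N. frac (real n * \<gamma>) - 1/2\<bar> \<le> (1/2 + 2 * (1 + K2)) * (1 + (real_of_int A + 1)) * (1 + ln (real N))"
    if "\<bar>\<gamma> - cf_value b\<bar> \<le> K2 / (real q)\<^sup>2" "1 \<le> N" "N < q" "K2 \<ge> 0" for \<gamma> K2 q N
  proof (rule sum_frac_log_bound[where M = q])
    fix N' :: nat assume N': "1 \<le> N'" "N' < q"
    from b.convergent_between[OF A(2) N'(1)] obtain P and Q :: nat where
      PQ: "coprime P (int Q)" "0 < Q" "Q \<le> N'" "real N' \<le> (real_of_int A + 1) * real Q"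
        "\<bar>cf_value b - real_of_int P / real Q\<bar> \<le> 1 / (real Q)\<^sup>2" by blast
    have "K2 / (real q)\<^sup>2 \<le> K2 / (real Q)\<^sup>2"
      using that(4) PQ(2,3) N' by (intro divide_left_mono power_mono mult_pos_pos) auto
    hence "\<bar>\<gamma> - real_of_int P / real Q\<bar> \<le> 1 / (real Q)\<^sup>2 + K2 / (real Q)\<^sup>2"
      using that(1) PQ(5) by linarith
    hence "\<bar>\<gamma> - real_of_int P / real Q\<bar> \<le> (1 + K2) / (real Q)\<^sup>2" by (simp add: add_divide_distrib)
    thus "\<exists>P Q. coprime P (int Q) \<and> 0 < Q \<and> Q \<le> N' \<and> real N' \<le> (real_of_int A + 1) * real Q \<and>
       \<bar>\<gamma> - real_of_int P / real Q\<bar> \<le> (1 + K2) / (real Q)\<^sup>2"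
      using PQ by blast
  qed (use A1 that in auto)
  have "sudler_limit (cf_value b) c ((1/2 + 2 * (1 + 0)) * (1 + (real_of_int A + 1)))"
  proof
    fix N :: nat assume "N \<ge> 1"
    thus "\<bar>\<Sum>n=1..N. frac (real n * cf_value b) - 1/2\<bar> \<le> (1/2 + 2 * (1 + 0)) * (1 + (real_of_int A + 1)) * (1 + ln (real N))"
      using gen[of "cf_value b" 0 "Suc N" N] by simp
  qed (use den_delta_limit A1 in auto)
  thus ?thesis unfolding alpha_rev_eq using gen by blast
qed

end

section \<open>Rates for all convergents\<close>

lemma continuous_on_Icc_bounded:
  fixes f :: "real \<Rightarrow> real"
  assumes "continuous_on {u..v} f"
  shows "\<exists>D. \<forall>x\<in>{u..v}. \<bar>f x\<bar> \<le> D"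
proof -
  have "bounded (f ` {u..v})"
    by (rule compact_imp_bounded[OF compact_continuous_image[OF assms compact_Icc]])
  thus ?thesis by (simp add: bounded_iff)
qed

text \<open>Stated for one index and one point with explicit errors; the error functions of the
  theorem are obtained from it by choice at the very end.\<close>

definition rate_bound :: "(nat \<Rightarrow> int) \<Rightarrow> nat \<Rightarrow> nat \<Rightarrow> real \<Rightarrow> nat \<Rightarrow> real \<Rightarrow> real \<Rightarrow> real \<Rightarrow> bool" where
  "rate_bound a s p K k x e e' \<longleftrightarrow>
    perturbed_sudler a k x = (1 + e) * G_limit a s p (cf_residue s p k) x + e' \<and>
    \<bar>e\<bar> \<le> K * rate_err (real_of_int (cf_den a k)) \<and> \<bar>e'\<bar> \<le> K * real_of_int (cf_den a k) powr (-2)"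

definition sudler_rate :: "(nat \<Rightarrow> int) \<Rightarrow> nat \<Rightarrow> nat \<Rightarrow> real \<Rightarrow> nat \<Rightarrow> real \<Rightarrow> bool" where
  "sudler_rate a s p K k x \<longleftrightarrow> (\<exists>e e'. rate_bound a s p K k x e e')"

lemma sudler_rate_mono: "sudler_rate a s p K k x \<Longrightarrow> K \<le> K' \<Longrightarrow> sudler_rate a s p K' k x"
proof -
  assume "sudler_rate a s p K k x" "K \<le> K'"
  moreover have "K * \<epsilon> \<le> K' * \<epsilon>" if "\<epsilon> \<ge> 0" for \<epsilon>
    using \<open>K \<le> K'\<close> that by (rule mult_right_mono)
  ultimately show ?thesis
    unfolding sudler_rate_def rate_bound_def by (meson order.trans mult_nonneg_nonneg powr_ge_zero)
qed


context periodic_cf_residue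
begin

lemma cf_residue_eq:
  assumes "r \<le> p"
  shows "cf_residue s p (s + m * p + r) = r"
proof -
  have "int (s + m * p + r) - int s - 1 = int (r - 1) + int m * int p" using r1 by (simp add: of_nat_diff)
  hence "(int (s + m * p + r) - int s - 1) mod int p = int (r - 1) mod int p"
    by (simp only: mod_mult_self1)
  also have "\<dots> = int (r - 1)" using assms r1 by (intro mod_pos_pos_trivial) auto
  finally have "(int (s + m * p + r) - int s - 1) mod int p = int (r - 1)" .
  thus ?thesis unfolding cf_residue_def using r1 by (simp only: nat_int)
qed

abbreviation "Gr \<equiv> G_limit a s p r"

lemma G_factor_eq:
  "G_factor a s p r n x = \<bar>sudler_factor (alpha_rev a s p r) c n x\<bar>"
  by (simp add: G_factor_def sudler_factor_def Let_def)

lemma G_limit_eq: "Gr x = sudler_limit.G (alpha_rev a s p r) c x"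
proof -
  obtain K0 where "sudler_limit (alpha_rev a s p r) c K0"
    using sudler_limit_exists by blast
  then interpret sudler_limit "alpha_rev a s p r" c K0 .
  show ?thesis by (simp add: G_limit_def G_def G_factor_eq)
qed

lemma limit_function:
  "locally_uniformly_convergent_prod (\<lambda>n. G_factor a s p r (Suc n))"
  "locally_uniform_limit (\<lambda>N x. \<Prod>n = 1..N. G_factor a s p r n x)
          (\<lambda>x. \<Prod>n. G_factor a s p r (Suc n) x) sequentially"
  "continuous_on S Gr"
  "open {x. Gr x \<noteq> 0}"
  "Gr C1_differentiable_on {x. Gr x \<noteq> 0}"
proof -
  obtain K0 where "sudler_limit (alpha_rev a s p r) c K0"
    using sudler_limit_exists by blast
  then interpret sudler_limit "alpha_rev a s p r" c K0 .
  have f: "G_factor a s p r n = (\<lambda>x. \<bar>f n x\<bar>)" for n by (rule ext) (rule G_factor_eq)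
  have G: "Gr = G" by (rule ext) (rule G_limit_eq)
  show "locally_uniformly_convergent_prod (\<lambda>n. G_factor a s p r (Suc n))"
    unfolding f by (rule locally_uniformly_convergent_factors)
  show "locally_uniform_limit (\<lambda>N x. \<Prod>n = 1..N. G_factor a s p r n x)
          (\<lambda>x. \<Prod>n. G_factor a s p r (Suc n) x) sequentially"
    unfolding f by (rule locally_uniform_limit_prod)
  show "continuous_on S Gr" unfolding G by (rule continuous_G)
  show "open {x. Gr x \<noteq> 0}" unfolding G by (rule open_G_nonzero)
  show "Gr C1_differentiable_on {x. Gr x \<noteq> 0}" unfolding G by (rule C1_G)
qed

text \<open>A single \<open>K1\<close> dominates the constants of the reversed quotient, of the
  discrepancy and of \<open>q \<delta>\<close>, which makes all late indices of the residue class
  admissible at once.\<close>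

lemma eventually_sudler_rate:
  assumes B: "B \<ge> 0" and rp: "r \<le> p"
  shows "\<exists>K M. K \<ge> 0 \<and> (\<forall>m\<ge>M. \<forall>x. \<bar>x\<bar> \<le> B \<longrightarrow> sudler_rate a s p K (ix m) x)"
proof -
  define \<beta> where "\<beta> = alpha_rev a s p r"
  define K2 where "K2 = (den (Suc s) + den s)\<^sup>2"
  obtain K0 where K0: "sudler_limit \<beta> c K0"
    and all: "\<forall>K2\<ge>0. \<exists>K3. \<forall>\<gamma> q. \<bar>\<gamma> - \<beta>\<bar> \<le> K2 / (real q)\<^sup>2 \<longrightarrow> (\<forall>N. 1 \<le> N \<longrightarrow> N < q \<longrightarrow>
        \<bar>\<Sum>n=1..N. frac (real n * \<gamma>) - 1/2\<bar> \<le> K3 * (1 + ln (real N)))"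
    using sudler_limit_exists unfolding \<beta>_def by blast
  have "K2 \<ge> 0" by (simp add: K2_def)
  then obtain K3 where K3: "\<And>\<gamma> q N. \<bar>\<gamma> - \<beta>\<bar> \<le> K2 / (real q)\<^sup>2 \<Longrightarrow> 1 \<le> N \<Longrightarrow> N < q \<Longrightarrow>
        \<bar>\<Sum>n=1..N. frac (real n * \<gamma>) - 1/2\<bar> \<le> K3 * (1 + ln (real N))"
    using all by blast
  obtain K4 where K4: "\<And>m. \<bar>den (ix m) * cf_delta a (ix m) - c\<bar>
       \<le> K4 / (den (ix m))\<^sup>2"
    using den_delta_limit(3) by blast
  define K1 where "K1 = K2 + \<bar>K3\<bar> + \<bar>K4\<bar>"
  have K1: "K1 \<ge> 0" "K2 \<le> K1" "K3 \<le> K1" "K4 \<le> K1" using \<open>K2 \<ge> 0\<close> by (auto simp: K1_def)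
  interpret sudler_limit \<beta> c K0 by (rule K0)
  from eventually_rate[OF K1(1) B] obtain K Q0 where K: "K \<ge> 0" and rate:
    "\<And>q q' ck x. q \<ge> Q0 \<Longrightarrow> admissible K1 B q q' ck x \<Longrightarrow>
     \<exists>e e'. sudler_product q q' ck x = (1 + e) * G x + e' \<and>
        \<bar>e\<bar> \<le> K * rate_err (real q) \<and> \<bar>e'\<bar> \<le> K * real q powr (-2)"
    by blast
  have "sudler_rate a s p K (ix m) x" if m: "m \<ge> max 1 Q0" and x: "\<bar>x\<bar> \<le> B" for m x
  proof -
    define k where "k = s + m * p + r"
    define j where "j = k - 1"
    define q where "q = nat (cf_den a k)"
    have kj: "k = Suc j" using r1 by (simp add: j_def k_def)
    have q: "int q = cf_den a k" "den k = real q" "q > 0"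
      using cf_den_pos[of k] by (simp_all add: q_def)
    have "m * 1 \<le> m * p" using p1 by (intro mult_left_mono) auto
    hence "int m \<le> cf_den a k" using cf_den_ge[of k] unfolding k_def by linarith
    hence qm: "q \<ge> Q0" using m q(1) by linarith
    have "coprime (cf_den a j) (int q)" unfolding q(1) kj by (rule coprime_cf_den_Suc)
    moreover have "0 < real q * cf_delta a k" using q(3) cf_delta_pos[of k] by simp
    moreover have "real q * cf_delta a k \<le> 1" using cf_den_delta_le[of k] unfolding q(2) .
    moreover have "\<bar>real q * cf_delta a k - c\<bar> \<le> K1 / (real q)\<^sup>2"
      using K4[of m, folded k_def, unfolded q(2)] divide_right_mono[OF K1(4), of "(real q)\<^sup>2"] by simp
    moreover have g: "\<bar>den j / real q - \<beta>\<bar> \<le> K2 / (real q)\<^sup>2"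
      using reverse_quotient[of m, folded k_def j_def, unfolded q(2)] m
      unfolding K2_def \<beta>_def alpha_rev_eq by simp
    moreover have "\<bar>den j / real q - \<beta>\<bar> \<le> K1 / (real q)\<^sup>2"
      using g divide_right_mono[OF K1(2), of "(real q)\<^sup>2"] by simp
    moreover have "\<forall>N. 1 \<le> N \<longrightarrow> N < q \<longrightarrow>
        \<bar>\<Sum>n=1..N. frac (real n * (den j / real q)) - 1/2\<bar> \<le> K1 * (1 + ln (real N))"
    proof (intro allI impI)
      fix N assume N: "1 \<le> N" "N < q"
      have "K3 * (1 + ln (real N)) \<le> K1 * (1 + ln (real N))"
        using N by (intro mult_right_mono K1) auto
      thus "\<bar>\<Sum>n=1..N. frac (real n * (den j / real q)) - 1/2\<bar> \<le> K1 * (1 + ln (real N))"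
        using K3[OF g N] by linarith
    qed
    ultimately have "admissible K1 B q (cf_den a j) (real q * cf_delta a k) x"
      using x unfolding admissible_def by blast
    note rate[OF qm this]
    moreover have "perturbed_sudler a k x = sudler_product q (cf_den a j) (real q * cf_delta a k) x"
      using perturbed_sudler_eq[of j x, folded kj, folded q_def, unfolded q(2)] .
    moreover have "G_limit a s p (cf_residue s p k) x = G x"
      unfolding k_def cf_residue_eq[OF rp] G_limit_eq \<beta>_def ..
    ultimately show ?thesis unfolding sudler_rate_def rate_bound_def k_def[symmetric] q(2) by simp
  qed
  thus ?thesis using K by blast
qed

text \<open>The relative error becomes an absolute one because \<open>Gr\<close> is bounded on
  compact intervals; denominators of size at least \<open>m\<close> send both errors to
  zero.\<close>

lemma perturbed_sudler_converges:
  assumes rp: "r \<le> p"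
  shows "locally_uniform_limit (\<lambda>m. perturbed_sudler a (ix m)) Gr sequentially"
  unfolding locally_uniform_limit_def
proof
  fix x0 :: real
  define B where "B = \<bar>x0\<bar> + 1"
  define q where "q m = den (ix m)" for m
  have "B \<ge> 0" by (simp add: B_def)
  from eventually_sudler_rate[OF this rp] obtain K M where K: "K \<ge> 0"
    and rate: "\<And>m x. m \<ge> M \<Longrightarrow> \<bar>x\<bar> \<le> B \<Longrightarrow> sudler_rate a s p K (ix m) x"
    by blast
  obtain D where D: "\<And>x. x \<in> {-B..B} \<Longrightarrow> \<bar>Gr x\<bar> \<le> D"
    using continuous_on_Icc_bounded[OF limit_function(3)[of "{-B..B}"]] by blast
  define h where "h z = K * rate_err z * D + K * z powr (-2)" for z :: real
  have bound: "\<bar>perturbed_sudler a (ix m) x - Gr x\<bar> \<le> h (q m)"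
    if m: "m \<ge> M" and x: "\<bar>x\<bar> \<le> B" for m x
  proof -
    obtain e e' where e: "perturbed_sudler a (ix m) x = (1 + e) * Gr x + e'"
      "\<bar>e\<bar> \<le> K * rate_err (q m)" "\<bar>e'\<bar> \<le> K * q m powr (-2)"
      using rate[OF m x] unfolding sudler_rate_def rate_bound_def cf_residue_eq[OF rp] q_def by blast
    have "\<bar>e * Gr x\<bar> \<le> K * rate_err (q m) * D"
      unfolding abs_mult
    proof (rule mult_mono[OF e(2)])
      show "\<bar>Gr x\<bar> \<le> D" by (rule D) (use x in auto)
    qed (use K in simp_all)
    thus ?thesis using e unfolding h_def by (simp add: algebra_simps)
  qed
  have "real m \<le> q m" for m
  proof -
    have "m * 1 \<le> m * p" using p1 by (intro mult_left_mono) auto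
    hence "int m \<le> cf_den a (ix m)" using cf_den_ge[of "ix m"] by linarith
    thus ?thesis unfolding q_def by linarith
  qed
  hence q: "filterlim q at_top sequentially"
    by (intro filterlim_at_top_mono[OF filterlim_real_sequentially] always_eventually) simp
  have "(h \<longlongrightarrow> K * 0 * D + K * 0) at_top"
    unfolding h_def by (intro tendsto_intros) real_asymp+
  hence "(h \<longlongrightarrow> 0) at_top" by simp
  from filterlim_compose[OF this q] have lim: "(\<lambda>m. h (q m)) \<longlonglongrightarrow> 0" .
  have "uniform_limit {-B<..<B} (\<lambda>m. perturbed_sudler a (ix m)) Gr sequentially"
  proof (rule uniform_limitI)
    fix \<epsilon> :: real assume "\<epsilon> > 0"
    hence "\<forall>\<^sub>F m in sequentially. h (q m) < \<epsilon>" using order_tendstoD(2)[OF lim] by blast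
    thus "\<forall>\<^sub>F m in sequentially. \<forall>x\<in>{-B<..<B}.
        dist (perturbed_sudler a (ix m) x) (Gr x) < \<epsilon>"
      using eventually_ge_at_top[of M]
    proof eventually_elim
      case (elim m)
      show ?case
      proof
        fix x assume "x \<in> {-B<..<B}"
        hence "\<bar>x\<bar> \<le> B" by auto
        from bound[OF elim(2) this] elim(1)
        show "dist (perturbed_sudler a (ix m) x) (Gr x) < \<epsilon>"
          unfolding dist_real_def by linarith
      qed
    qed
  qed
  thus "\<exists>U. open U \<and> x0 \<in> U \<and> uniform_limit U (\<lambda>m. perturbed_sudler a (ix m)) Gr sequentially"
    by (intro exI[of _ "{-B<..<B}"]) (auto simp: B_def)
qed

text \<open>For a fixed index the whole difference goes into the additive error, with
  \<open>e = 0\<close>; continuity bounds it on a compact interval. This covers small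
  \<open>k\<close>, including denominator 1, where the logarithm is zero.\<close>

lemma trivial_rate:
  assumes "cf_residue s p k = r"
  shows "\<exists>K\<ge>0. \<forall>x\<in>{u..v}. sudler_rate a s p K k x"
proof -
  define q where "q = den k"
  have q: "q > 0" using cf_den_pos[of k] unfolding q_def by linarith
  have "continuous_on {u..v} (\<lambda>x. perturbed_sudler a k x - Gr x)"
    unfolding perturbed_sudler_def q_def[symmetric]
    using q by (intro continuous_intros limit_function(3)) auto
  from continuous_on_Icc_bounded[OF this]
  obtain D where D: "\<And>x. x \<in> {u..v} \<Longrightarrow> \<bar>perturbed_sudler a k x - Gr x\<bar> \<le> D"
    by blast
  have "sudler_rate a s p (\<bar>D\<bar> * q\<^sup>2) k x" if "x \<in> {u..v}" for x
    unfolding sudler_rate_def rate_bound_def assms q_def[symmetric]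
  proof (rule exI[of _ 0], rule exI[of _ "perturbed_sudler a k x - Gr x"], intro conjI)
    have "q\<^sup>2 * q powr (-2) = 1" using q by (simp add: powr_minus powr_numeral)
    hence "\<bar>D\<bar> * q\<^sup>2 * q powr (-2) = \<bar>D\<bar>" by (simp only: mult.assoc mult_1_right)
    moreover have "\<bar>perturbed_sudler a k x - Gr x\<bar> \<le> \<bar>D\<bar>" using D[OF that] by linarith
    ultimately show "\<bar>perturbed_sudler a k x - Gr x\<bar> \<le> \<bar>D\<bar> * q\<^sup>2 * q powr (-2)" by (simp only:)
  qed simp_all
  thus ?thesis by (intro exI[of _ "\<bar>D\<bar> * q\<^sup>2"]) simp
qed

end

section \<open>Assembling the residue classes\<close>

lemma cf_residue_range:
  assumes "p \<ge> 1"
  shows "cf_residue s p k \<in> {1..p}"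
proof -
  have "(int k - int s - 1) mod int p < int p" using assms by simp
  thus ?thesis using assms by (simp add: cf_residue_def nat_less_iff Suc_le_eq)
qed

lemma cf_index_decomposition:
  assumes "p \<ge> 1" "k > s"
  shows "k = s + ((k - s - 1) div p) * p + cf_residue s p k"
proof -
  have "int k - int s - 1 = int (k - s - 1)" using assms by simp
  hence "(int k - int s - 1) mod int p = int ((k - s - 1) mod p)" by (simp only: zmod_int)
  hence "cf_residue s p k = (k - s - 1) mod p + 1"
    unfolding cf_residue_def by (simp only: nat_int)
  thus ?thesis using assms div_mult_mod_eq[of "k - s - 1" p] by linarith
qed

lemma periodic_cf_residueI: "periodic_cf a s p \<Longrightarrow> r \<in> {1..p} \<Longrightarrow> periodic_cf_residue a s p r"
  by unfold_locales auto

lemma rate_functions: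
  assumes per: "periodic_cf a s p"
  shows "\<exists>A e e'. \<forall>k\<ge>1. \<forall>x\<in>{u..v}. rate_bound a s p A k x (e k x) (e' k x)"
proof -
  define B where "B = max \<bar>u\<bar> \<bar>v\<bar>"
  have p1: "p \<ge> 1" using per by (simp add: periodic_cf_def)
  note loc = periodic_cf_residueI[OF per]
  have "\<forall>r\<in>{1..p}. \<exists>K M. K \<ge> 0 \<and> (\<forall>m\<ge>M. \<forall>x. \<bar>x\<bar> \<le> B \<longrightarrow> sudler_rate a s p K (s + m * p + r) x)"
  proof
    fix r assume r: "r \<in> {1..p}"
    show "\<exists>K M. K \<ge> 0 \<and> (\<forall>m\<ge>M. \<forall>x. \<bar>x\<bar> \<le> B \<longrightarrow> sudler_rate a s p K (s + m * p + r) x)"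
      by (rule periodic_cf_residue.eventually_sudler_rate[OF loc[OF r]]) (use r in \<open>auto simp: B_def\<close>)
  qed
  then obtain K M where KM: "\<And>r. r \<in> {1..p} \<Longrightarrow> K r \<ge> 0"
      "\<And>r m x. r \<in> {1..p} \<Longrightarrow> m \<ge> M r \<Longrightarrow> \<bar>x\<bar> \<le> B \<Longrightarrow> sudler_rate a s p (K r) (s + m * p + r) x"
    by (metis (no_types))
  have "\<forall>k. \<exists>D\<ge>0. \<forall>x\<in>{u..v}. sudler_rate a s p D k x"
  proof
    fix k
    interpret k: periodic_cf_residue a s p "cf_residue s p k" by (rule loc[OF cf_residue_range[OF p1]])
    show "\<exists>D\<ge>0. \<forall>x\<in>{u..v}. sudler_rate a s p D k x" by (rule k.trivial_rate) simp
  qed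
  then obtain D where D: "\<And>k. D k \<ge> 0" "\<And>k x. x \<in> {u..v} \<Longrightarrow> sudler_rate a s p (D k) k x"
    by metis
  \<comment> \<open>Sums of nonnegative constants stand in for maxima. From \<open>k0\<close> on
    every residue class has passed its own threshold; below it finitely many indices remain, each
    with its own constant \<open>D k\<close>.\<close>
  define k0 where "k0 = s + 1 + (\<Sum>r\<in>{1..p}. M r) * p"
  define A where "A = (\<Sum>r\<in>{1..p}. K r) + (\<Sum>k<k0. D k)"
  have A1: "K r \<le> A" if "r \<in> {1..p}" for r
  proof -
    have "K r \<le> (\<Sum>r\<in>{1..p}. K r)" using that KM(1) by (intro member_le_sum) auto
    moreover have "(\<Sum>k<k0. D k) \<ge> 0" using D(1) by (intro sum_nonneg)
    ultimately show ?thesis by (simp add: A_def)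
  qed
  have A2: "D k \<le> A" if "k < k0" for k
  proof -
    have "D k \<le> (\<Sum>k<k0. D k)" using that D(1) by (intro member_le_sum) auto
    moreover have "(\<Sum>r\<in>{1..p}. K r) \<ge> 0" using KM(1) by (intro sum_nonneg)
    ultimately show ?thesis by (simp add: A_def)
  qed
  have "sudler_rate a s p A k x" if x: "x \<in> {u..v}" for k x
  proof (cases "k < k0")
    case True
    show ?thesis by (rule sudler_rate_mono[OF D(2)[OF x] A2[OF True]])
  next
    case False
    define r where "r = cf_residue s p k"
    define m where "m = (k - s - 1) div p"
    have r: "r \<in> {1..p}" unfolding r_def by (rule cf_residue_range[OF p1])
    have "k > s" using False by (simp add: k0_def)
    hence k: "k = s + m * p + r" unfolding m_def r_def by (rule cf_index_decomposition[OF p1])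
    have "(\<Sum>r\<in>{1..p}. M r) * p \<le> k - s - 1" using False by (simp add: k0_def)
    hence "(\<Sum>r\<in>{1..p}. M r) \<le> m" unfolding m_def using p1 by (simp add: less_eq_div_iff_mult_less_eq)
    moreover have "M r \<le> (\<Sum>r\<in>{1..p}. M r)" using r by (intro member_le_sum) auto
    ultimately have "M r \<le> m" by simp
    moreover have "\<bar>x\<bar> \<le> B" using x by (auto simp: B_def)
    ultimately have "sudler_rate a s p (K r) k x" unfolding k by (intro KM(2) r)
    thus ?thesis by (rule sudler_rate_mono[OF _ A1[OF r]])
  qed
  hence "\<forall>k x. \<exists>e e'. x \<in> {u..v} \<longrightarrow> rate_bound a s p A k x e e'"
    unfolding sudler_rate_def by blast
  then obtain e e' where "\<forall>k x. x \<in> {u..v} \<longrightarrow> rate_bound a s p A k x (e k x) (e' k x)"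
    unfolding choice_iff by blast
  thus ?thesis by blast
qed

theorem theorem7:
  fixes a :: "nat \<Rightarrow> int" and s p :: nat
  assumes "periodic_cf a s p"
  shows
    "(\<forall>r\<in>{1..p}.
        locally_uniformly_convergent_prod (\<lambda>n. G_factor a s p r (Suc n)) \<and>
        locally_uniform_limit (\<lambda>N x. \<Prod>n = 1..N. G_factor a s p r n x)
          (\<lambda>x. \<Prod>n. G_factor a s p r (Suc n) x) sequentially \<and>
        continuous_on UNIV (G_limit a s p r) \<and>
        open {x. G_limit a s p r x \<noteq> 0} \<and>
        G_limit a s p r C1_differentiable_on {x. G_limit a s p r x \<noteq> 0}) \<and>
     (\<forall>u v. \<exists>(A::real) (e :: nat \<Rightarrow> real \<Rightarrow> real) (e' :: nat \<Rightarrow> real \<Rightarrow> real).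
        \<forall>k\<ge>1. \<forall>x\<in>{u..v}.
          perturbed_sudler a k x = (1 + e k x) * G_limit a s p (cf_residue s p k) x + e' k x \<and>
          \<bar>e k x\<bar> \<le> A * (real_of_int (cf_den a k) powr (- 1 / 2)
                          * ln (real_of_int (cf_den a k)) powr (3 / 4)) \<and>
          \<bar>e' k x\<bar> \<le> A * real_of_int (cf_den a k) powr (- 2)) \<and>
     (\<forall>r\<in>{1..p}.
        locally_uniform_limit (\<lambda>m. perturbed_sudler a (s + m * p + r)) (G_limit a s p r)
          sequentially)"
proof -
  note loc = periodic_cf_residueI[OF assms]
  show ?thesis
    by (intro conjI ballI allI rate_functions[OF assms, unfolded rate_bound_def]
        periodic_cf_residue.limit_function[OF loc] periodic_cf_residue.perturbed_sudler_converges[OF loc]) auto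
qed

end
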